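(* Let $\mathcal{D}$ be a set and let $\mathit{UCP}(\mathcal{D})$ be the $\mathbb{K}$-vector space with basis $\mathcal{UPT}(\mathcal{D})$. Extend the product $\cdot$ of partitioned trees bilinearly to $\mathit{UCP}(\mathcal{D})$, and define a bilinear product $\bullet$ by: for all $T,T'\in\mathcal{UPT}(\mathcal{D})$, $$T\bullet T'=\begin{cases}\displaystyle\sum_{s\in V(T)}T\bullet_{s,*}T' & \text{if } T'\neq\emptyset,\\[2mm] \displaystyle\sum_{s\in V(T)}T[+1]_s & \text{if } T'=\emptyset.\end{cases}$$ Then $(\mathit{UCP}(\mathcal{D}),\cdot,\bullet)$ is the free unitary Com-PreLie algebra generated by the one-vertex trees $\tau_{(0,d)}$, $d\in\mathcal{D}$: it is a unitary Com-PreLie algebra with unit $\emptyset$, and for every unitary Com-PreLie algebra $A$ and every family $(a_d)_{d\in\mathcal{D}}$ of elements of $A$ there is a unique unitary Com-PreLie algebra morphism $\mathit{UCP}(\mathcal{D})\to A$ sending $\tau_{(0,d)}$ to $a_d$ for all $d\in\mathcal{D}$.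
   Context: $\mathbb{K}$ is a field of characteristic zero. A Com-PreLie algebra is a vector space $A$ with bilinear products $\cdot,\bullet$ such that $\cdot$ is associative and commutative, $(a\bullet b)\bullet c-a\bullet(b\bullet c)=(a\bullet c)\bullet b-a\bullet(c\bullet b)$ and $(a\cdot b)\bullet c=(a\bullet c)\cdot b+a\cdot(b\bullet c)$ for all $a,b,c$; it is unitary if $(A,\cdot)$ has a unit. A (unitary) morphism preserves both products (and the unit). A partitioned forest is a (finite) rooted forest $F$ with vertex set $V(F)$, edges oriented from the roots to the leaves, together with a partition of $V(F)$ into blocks such that two vertices in the same block are either both roots or have the same parent. It is a partitioned tree if all its roots lie in one block; the empty forest $\emptyset$ is a partitioned tree. $\mathcal{UPT}(\mathcal{D})$ is the set of isomorphism classes of partitioned trees (including $\emptyset$) whose vertices are decorated by elements of $\mathbb{N}\times\mathcal{D}$, $\mathbb{N}=\{0,1,2,\ldots\}$. $\tau_{(k,d)}$ is the tree with one vertex, decorated by $(k,d)$. $T\cdot T'$ is the disjoint union of $T$ and $T'$ in which the block of roots of $T$ and the block of roots of $T'$ are merged into one block, all other blocks being unchanged (unit $\emptyset$). For a vertex $s$ of $T$ and $T'\ne\emptyset$, $T\bullet_{s,*}T'$ is obtained by adding edges from $s$ to every root of $T'$, all the blocks of $T$ and $T'$ being kept unchanged. $T[+1]_s$ is $T$ with the decoration $(i,d)$ of $s$ replaced by $(i+1,d)$. *)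

theory Defs
  imports
    Complex_Main
    "HOL-Library.Disjoint_Sets"
    "HOL-Library.FuncSet"
    "HOL-Library.Nat_Bijection"
    "HOL-Library.Poly_Mapping"
begin

section \<open>Com-PreLie algebras\<close>

text \<open>
  The underlying vector space of an algebra is a subspace \<open>A\<close> of the vector space carried by a type;
  the products are only constrained on \<open>A\<close>.
\<close>

locale com_prelie_algebra = vector_space scale
  for scale :: "'k::field_char_0 \<Rightarrow> 'a::ab_group_add \<Rightarrow> 'a" (infixr \<open>*s\<close> 75) +
  fixes A :: "'a set"
    and dot :: "'a \<Rightarrow> 'a \<Rightarrow> 'a" (infixl \<open>\<odot>\<close> 70)
    and bul :: "'a \<Rightarrow> 'a \<Rightarrow> 'a" (infixl \<open>\<bullet>\<close> 70)
  assumes subspace_carrier: "subspace A"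
    and dot_closed: "\<lbrakk>a \<in> A; b \<in> A\<rbrakk> \<Longrightarrow> a \<odot> b \<in> A"
    and dot_add_left: "\<lbrakk>a \<in> A; b \<in> A; c \<in> A\<rbrakk> \<Longrightarrow> (a + b) \<odot> c = a \<odot> c + b \<odot> c"
    and dot_add_right: "\<lbrakk>a \<in> A; b \<in> A; c \<in> A\<rbrakk> \<Longrightarrow> a \<odot> (b + c) = a \<odot> b + a \<odot> c"
    and dot_scale_left: "\<lbrakk>a \<in> A; b \<in> A\<rbrakk> \<Longrightarrow> (k *s a) \<odot> b = k *s (a \<odot> b)"
    and dot_scale_right: "\<lbrakk>a \<in> A; b \<in> A\<rbrakk> \<Longrightarrow> a \<odot> (k *s b) = k *s (a \<odot> b)"
    and bul_closed: "\<lbrakk>a \<in> A; b \<in> A\<rbrakk> \<Longrightarrow> a \<bullet> b \<in> A"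
    and bul_add_left: "\<lbrakk>a \<in> A; b \<in> A; c \<in> A\<rbrakk> \<Longrightarrow> (a + b) \<bullet> c = a \<bullet> c + b \<bullet> c"
    and bul_add_right: "\<lbrakk>a \<in> A; b \<in> A; c \<in> A\<rbrakk> \<Longrightarrow> a \<bullet> (b + c) = a \<bullet> b + a \<bullet> c"
    and bul_scale_left: "\<lbrakk>a \<in> A; b \<in> A\<rbrakk> \<Longrightarrow> (k *s a) \<bullet> b = k *s (a \<bullet> b)"
    and bul_scale_right: "\<lbrakk>a \<in> A; b \<in> A\<rbrakk> \<Longrightarrow> a \<bullet> (k *s b) = k *s (a \<bullet> b)"
    and dot_assoc: "\<lbrakk>a \<in> A; b \<in> A; c \<in> A\<rbrakk> \<Longrightarrow> (a \<odot> b) \<odot> c = a \<odot> (b \<odot> c)"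
    and dot_commute: "\<lbrakk>a \<in> A; b \<in> A\<rbrakk> \<Longrightarrow> a \<odot> b = b \<odot> a"
    and pre_lie: "\<lbrakk>a \<in> A; b \<in> A; c \<in> A\<rbrakk> \<Longrightarrow>
          (a \<bullet> b) \<bullet> c - a \<bullet> (b \<bullet> c) = (a \<bullet> c) \<bullet> b - a \<bullet> (c \<bullet> b)"
    and leibniz: "\<lbrakk>a \<in> A; b \<in> A; c \<in> A\<rbrakk> \<Longrightarrow>
          (a \<odot> b) \<bullet> c = (a \<bullet> c) \<odot> b + a \<odot> (b \<bullet> c)"

locale unitary_com_prelie_algebra = com_prelie_algebra scale A dot bul
  for scale :: "'k::field_char_0 \<Rightarrow> 'a::ab_group_add \<Rightarrow> 'a"
    and A :: "'a set"
    and dot :: "'a \<Rightarrow> 'a \<Rightarrow> 'a"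
    and bul :: "'a \<Rightarrow> 'a \<Rightarrow> 'a" +
  fixes one :: 'a
  assumes one_closed: "one \<in> A"
    and dot_one_left: "a \<in> A \<Longrightarrow> dot one a = a"
    and dot_one_right: "a \<in> A \<Longrightarrow> dot a one = a"

locale unitary_com_prelie_morphism =
  source: unitary_com_prelie_algebra scale A dot bul one +
  target: unitary_com_prelie_algebra scale' B dot' bul' one'
  for scale :: "'k::field_char_0 \<Rightarrow> 'a::ab_group_add \<Rightarrow> 'a" and A dot bul one
    and scale' :: "'k \<Rightarrow> 'b::ab_group_add \<Rightarrow> 'b" and B dot' bul' one' +
  fixes \<phi> :: "'a \<Rightarrow> 'b"
  assumes maps_to: "x \<in> A \<Longrightarrow> \<phi> x \<in> B"
    and map_add: "\<lbrakk>x \<in> A; y \<in> A\<rbrakk> \<Longrightarrow> \<phi> (x + y) = \<phi> x + \<phi> y"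
    and map_scale: "x \<in> A \<Longrightarrow> \<phi> (scale k x) = scale' k (\<phi> x)"
    and map_dot: "\<lbrakk>x \<in> A; y \<in> A\<rbrakk> \<Longrightarrow> \<phi> (dot x y) = dot' (\<phi> x) (\<phi> y)"
    and map_bul: "\<lbrakk>x \<in> A; y \<in> A\<rbrakk> \<Longrightarrow> \<phi> (bul x y) = bul' (\<phi> x) (\<phi> y)"
    and map_one: "\<phi> one = one'"


section \<open>Partitioned forests and trees\<close>

text \<open>
  An edge \<open>(u, v)\<close> says that \<open>u\<close> is the parent of \<open>v\<close>. The values of \<open>deco\<close> outside of \<open>verts\<close> are
  irrelevant. Vertices are decorated by pairs in \<open>\<nat> \<times> 'd\<close>.
\<close>

record ('v, 'd) pforest =
  verts :: "'v set"
  edges :: "('v \<times> 'v) set"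
  blocks :: "'v set set"
  deco :: "'v \<Rightarrow> nat \<times> 'd"

definition roots :: "('v, 'd) pforest \<Rightarrow> 'v set" where
  "roots F = {v \<in> verts F. \<forall>u. (u, v) \<notin> edges F}"

definition partitioned_forest :: "('v, 'd) pforest \<Rightarrow> bool" where
  "partitioned_forest F \<longleftrightarrow>
     finite (verts F) \<and> edges F \<subseteq> verts F \<times> verts F \<and>
     acyclic (edges F) \<and> single_valued ((edges F)\<inverse>) \<and>
     partition_on (verts F) (blocks F) \<and>
     (\<forall>B\<in>blocks F. \<forall>x\<in>B. \<forall>y\<in>B.
        (x \<in> roots F \<and> y \<in> roots F) \<or> (\<exists>u. (u, x) \<in> edges F \<and> (u, y) \<in> edges F))"

definition partitioned_tree :: "('v, 'd) pforest \<Rightarrow> bool" where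
  "partitioned_tree F \<longleftrightarrow> partitioned_forest F \<and>
     (\<forall>x\<in>roots F. \<forall>y\<in>roots F. \<exists>B\<in>blocks F. x \<in> B \<and> y \<in> B)"

definition forest_iso :: "('v \<Rightarrow> 'w) \<Rightarrow> ('v, 'd) pforest \<Rightarrow> ('w, 'd) pforest \<Rightarrow> bool" where
  "forest_iso f F G \<longleftrightarrow>
     bij_betw f (verts F) (verts G) \<and>
     edges G = map_prod f f ` edges F \<and>
     blocks G = (`) f ` blocks F \<and>
     (\<forall>x\<in>verts F. deco G (f x) = deco F x)"

definition relabel :: "('v \<Rightarrow> 'w) \<Rightarrow> ('v, 'd) pforest \<Rightarrow> ('w, 'd) pforest" where
  "relabel f F =
     \<lparr>verts = f ` verts F, edges = map_prod f f ` edges F, blocks = (`) f ` blocks F,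
      deco = deco F \<circ> inv_into (verts F) f\<rparr>"

definition empty_forest :: "('v, 'd) pforest" where
  "empty_forest = \<lparr>verts = {}, edges = {}, blocks = {}, deco = undefined\<rparr>"

definition single_vertex :: "'v \<Rightarrow> nat \<times> 'd \<Rightarrow> ('v, 'd) pforest" where
  "single_vertex v p = \<lparr>verts = {v}, edges = {}, blocks = {{v}}, deco = (\<lambda>_. p)\<rparr>"

text \<open>
  In a nonempty partitioned tree the block of roots is the set \<open>roots F\<close>; the empty tree has no such
  block, so that \<open>{{}}\<close> has to be removed when both factors are empty.
\<close>

definition tree_prod :: "('v, 'd) pforest \<Rightarrow> ('w, 'd) pforest \<Rightarrow> ('v + 'w, 'd) pforest" where
  "tree_prod F G =
     \<lparr>verts = verts F <+> verts G,
      edges = map_prod Inl Inl ` edges F \<union> map_prod Inr Inr ` edges G,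
      blocks = (`) Inl ` (blocks F - {roots F}) \<union> (`) Inr ` (blocks G - {roots G})
                 \<union> ({roots F <+> roots G} - {{}}),
      deco = case_sum (deco F) (deco G)\<rparr>"

definition graft :: "'v \<Rightarrow> ('v, 'd) pforest \<Rightarrow> ('w, 'd) pforest \<Rightarrow> ('v + 'w, 'd) pforest" where
  "graft s F G =
     \<lparr>verts = verts F <+> verts G,
      edges = map_prod Inl Inl ` edges F \<union> map_prod Inr Inr ` edges G
                \<union> {Inl s} \<times> Inr ` roots G,
      blocks = (`) Inl ` blocks F \<union> (`) Inr ` blocks G,
      deco = case_sum (deco F) (deco G)\<rparr>"

definition bump :: "'v \<Rightarrow> ('v, 'd) pforest \<Rightarrow> ('v, 'd) pforest" where
  "bump s F = F\<lparr>deco := (deco F)(s := apfst Suc (deco F s))\<rparr>"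

lemma partitioned_forestI:
  assumes "finite (verts F)" "edges F \<subseteq> verts F \<times> verts F" "acyclic (edges F)"
    "single_valued ((edges F)\<inverse>)" "partition_on (verts F) (blocks F)"
    "\<And>B x y. \<lbrakk>B \<in> blocks F; x \<in> B; y \<in> B\<rbrakk> \<Longrightarrow>
        (x \<in> roots F \<and> y \<in> roots F) \<or> (\<exists>u. (u, x) \<in> edges F \<and> (u, y) \<in> edges F)"
  shows "partitioned_forest F"
  unfolding partitioned_forest_def by (intro conjI ballI assms)

lemma partitioned_treeI:
  assumes "partitioned_forest F"
    "\<And>x y. \<lbrakk>x \<in> roots F; y \<in> roots F\<rbrakk> \<Longrightarrow> \<exists>B\<in>blocks F. x \<in> B \<and> y \<in> B"
  shows "partitioned_tree F"
  unfolding partitioned_tree_def by (intro conjI ballI assms)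

lemma forest_isoD:
  assumes "forest_iso f F G"
  shows "inj_on f (verts F)" "verts G = f ` verts F" "edges G = map_prod f f ` edges F"
    "blocks G = (`) f ` blocks F" "x \<in> verts F \<Longrightarrow> deco G (f x) = deco F x"
  using assms by (auto simp: forest_iso_def bij_betw_def)

lemma forest_isoI:
  assumes "inj_on f (verts F)" "verts G = f ` verts F" "edges G = map_prod f f ` edges F"
    "blocks G = (`) f ` blocks F" "\<And>x. x \<in> verts F \<Longrightarrow> deco G (f x) = deco F x"
  shows "forest_iso f F G"
  using assms by (auto simp: forest_iso_def bij_betw_def)

lemma forest_iso_refl: "forest_iso id F F"
  by (auto simp: forest_iso_def map_prod.id)

lemma forest_iso_trans:
  assumes "forest_iso f F G" "forest_iso g G H"
  shows "forest_iso (g \<circ> f) F H"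
proof (rule forest_isoI)
  note f = forest_isoD[OF assms(1)] and g = forest_isoD[OF assms(2)]
  show "inj_on (g \<circ> f) (verts F)" using f g by (metis comp_inj_on)
  show "verts H = (g \<circ> f) ` verts F" using f g by (simp add: image_comp)
  show "edges H = map_prod (g \<circ> f) (g \<circ> f) ` edges F"
    using f g by (simp add: image_comp map_prod_compose)
  show "blocks H = (`) (g \<circ> f) ` blocks F"
    using f g by (simp add: image_comp image_image)
  show "deco H ((g \<circ> f) x) = deco F x" if "x \<in> verts F" for x
    using f g that by simp
qed

lemma blocks_subset: "\<lbrakk>partitioned_forest F; B \<in> blocks F\<rbrakk> \<Longrightarrow> B \<subseteq> verts F"
  by (auto simp: partitioned_forest_def partition_on_def)

lemma edges_subset: "partitioned_forest F \<Longrightarrow> edges F \<subseteq> verts F \<times> verts F"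
  by (auto simp: partitioned_forest_def)

lemma forest_iso_sym:
  assumes F: "partitioned_forest F" and iso: "forest_iso f F G"
  shows "forest_iso (inv_into (verts F) f) G F"
proof (rule forest_isoI)
  let ?g = "inv_into (verts F) f"
  note f = forest_isoD[OF iso]
  have gf: "?g (f x) = x" if "x \<in> verts F" for x using f(1) that by simp
  show "inj_on ?g (verts G)" using f(2) by (simp add: inj_on_inv_into)
  show "verts F = ?g ` verts G" using f gf by (force simp: image_iff)
  have "map_prod ?g ?g ` edges G = (\<lambda>p. p) ` edges F"
    unfolding f(3) image_image using edges_subset[OF F] gf by (intro image_cong) auto
  then show "edges F = map_prod ?g ?g ` edges G" by simp
  have "(`) ?g ` blocks G = (\<lambda>B. B) ` blocks F"
    unfolding f(4) image_image using blocks_subset[OF F] gf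
    by (intro image_cong) (auto simp: image_iff subset_iff)
  then show "blocks F = (`) ?g ` blocks G" by simp
  show "deco F (?g x) = deco G x" if "x \<in> verts G" for x
    using that f gf by auto
qed

lemma iso_roots:
  assumes F: "partitioned_forest F" and iso: "forest_iso f F G"
  shows "roots G = f ` roots F"
proof -
  note f = forest_isoD[OF iso]
  have edge: "(f x, f y) \<in> edges G \<longleftrightarrow> (x, y) \<in> edges F" if "x \<in> verts F" "y \<in> verts F" for x y
  proof
    assume "(f x, f y) \<in> edges G"
    then obtain a b where "(a, b) \<in> edges F" "f x = f a" "f y = f b" using f(3) by auto
    moreover from this have "a \<in> verts F" "b \<in> verts F" using edges_subset[OF F] by auto
    ultimately show "(x, y) \<in> edges F" using that f(1) by (metis inj_onD)
  next
    assume "(x, y) \<in> edges F"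
    then show "(f x, f y) \<in> edges G" unfolding f(3) by (rule map_prod_imageI)
  qed
  have "f x \<in> roots G \<longleftrightarrow> x \<in> roots F" if x: "x \<in> verts F" for x
  proof -
    have "\<exists>a\<in>verts F. u = f a" if "(u, v) \<in> edges G" for u v
      using that edges_subset[OF F] unfolding f(3) by auto
    then have "(\<exists>u. (u, f x) \<in> edges G) \<longleftrightarrow> (\<exists>u\<in>verts F. (f u, f x) \<in> edges G)"
      by blast
    also have "\<dots> \<longleftrightarrow> (\<exists>u. (u, x) \<in> edges F)"
      using edge[OF _ x] edges_subset[OF F] by blast
    finally show ?thesis using x f(2) by (auto simp: roots_def)
  qed
  moreover have "roots F \<subseteq> verts F" "roots G \<subseteq> f ` verts F" using f(2) by (auto simp: roots_def)
  ultimately show ?thesis by blast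
qed

lemma iso_partitioned_forest:
  assumes F: "partitioned_forest F" and iso: "forest_iso f F G"
  shows "partitioned_forest G"
proof -
  note f = forest_isoD[OF iso]
  let ?V = "verts F" and ?E = "edges F"
  let ?g = "inv_into ?V f"
  have E: "?E \<subseteq> ?V \<times> ?V" by (rule edges_subset[OF F])
  have gf: "?g (f x) = x" if "x \<in> ?V" for x using f(1) that by simp
  have EG: "(?g u, ?g v) \<in> ?E" if uv: "(u, v) \<in> edges G" for u v
  proof -
    obtain a b where ab: "(a, b) \<in> ?E" "u = f a" "v = f b" using uv unfolding f(3) by auto
    then have "a \<in> ?V" "b \<in> ?V" using E by auto
    then show ?thesis using ab by (simp only: gf)
  qed
  have "finite (verts G)"
    unfolding f(2) using F by (simp add: partitioned_forest_def)
  moreover have "edges G \<subseteq> verts G \<times> verts G"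
    unfolding f(2,3) using E by auto
  moreover have "acyclic (edges G)"
  proof -
    have "(?g x, ?g y) \<in> ?E\<^sup>+" if "(x, y) \<in> (edges G)\<^sup>+" for x y
      using that
    proof (induction rule: trancl_induct)
      case (base y)
      then show ?case by (intro r_into_trancl EG)
    next
      case (step y z)
      from step.IH EG[OF step.hyps(2)] show ?case by (rule trancl_into_trancl)
    qed
    then show ?thesis using F by (auto simp: acyclic_def partitioned_forest_def)
  qed
  moreover have "single_valued ((edges G)\<inverse>)"
  proof (rule single_valuedI)
    fix x y z assume "(x, y) \<in> (edges G)\<inverse>" "(x, z) \<in> (edges G)\<inverse>"
    then have yz: "(y, x) \<in> edges G" "(z, x) \<in> edges G" by simp_all
    then have "?g y = ?g z"
      using EG F unfolding partitioned_forest_def by (metis converse_iff single_valuedD)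
    moreover have "y \<in> f ` ?V" "z \<in> f ` ?V" using yz E unfolding f(3) by auto
    ultimately show "y = z" by (simp add: inv_into_injective)
  qed
  moreover have "partition_on (verts G) (blocks G)"
  proof -
    have P: "partition_on ?V (blocks F)" using F by (simp add: partitioned_forest_def)
    moreover have "{} \<notin> (`) f ` blocks F" using partition_onD3[OF P] by auto
    ultimately show ?thesis using partition_on_inj_image[OF P f(1)] f(2,4) by simp
  qed
  moreover have "(x \<in> roots G \<and> y \<in> roots G) \<or> (\<exists>u. (u, x) \<in> edges G \<and> (u, y) \<in> edges G)"
    if "B \<in> blocks G" "x \<in> B" "y \<in> B" for B x y
  proof -
    from that obtain C a b where C: "C \<in> blocks F" "a \<in> C" "b \<in> C" "x = f a" "y = f b"
      unfolding f(4) by auto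
    then have "(a \<in> roots F \<and> b \<in> roots F) \<or> (\<exists>u. (u, a) \<in> ?E \<and> (u, b) \<in> ?E)"
      using F unfolding partitioned_forest_def by blast
    then show ?thesis
    proof
      assume "\<exists>u. (u, a) \<in> ?E \<and> (u, b) \<in> ?E"
      then obtain u where "(u, a) \<in> ?E" "(u, b) \<in> ?E" by blast
      then have "(f u, x) \<in> edges G" "(f u, y) \<in> edges G"
        unfolding f(3) C(4,5) by (auto intro: map_prod_imageI)
      then show ?thesis by blast
    qed (simp add: C(4,5) iso_roots[OF F iso])
  qed
  ultimately show ?thesis by (rule partitioned_forestI)
qed

lemma iso_partitioned_tree:
  assumes F: "partitioned_tree F" and iso: "forest_iso f F G"
  shows "partitioned_tree G"
proof -
  have pf: "partitioned_forest F" using F by (simp add: partitioned_tree_def)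
  have "\<exists>B\<in>blocks G. x \<in> B \<and> y \<in> B" if xy: "x \<in> roots G" "y \<in> roots G" for x y
  proof -
    obtain a b where ab: "a \<in> roots F" "b \<in> roots F" "x = f a" "y = f b"
      using xy iso_roots[OF pf iso] by auto
    then obtain B where "B \<in> blocks F" "a \<in> B" "b \<in> B"
      using F by (auto simp: partitioned_tree_def)
    then show ?thesis using ab forest_isoD(4)[OF iso] by blast
  qed
  then show ?thesis
    by (rule partitioned_treeI[OF iso_partitioned_forest[OF pf iso]])
qed

lemma relabel_iso:
  assumes "inj_on f (verts F)" shows "forest_iso f F (relabel f F)"
  using assms by (auto simp: relabel_def intro!: forest_isoI)

lemma acyclic_sum_edges:
  assumes "acyclic E" "acyclic E'"
  shows "acyclic (map_prod Inl Inl ` E \<union> map_prod Inr Inr ` E' \<union> {Inl s} \<times> Inr ` R)"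
    (is "acyclic ?S")
proof -
  have "(\<exists>a b. x = Inl a \<and> y = Inl b \<and> (a, b) \<in> E\<^sup>+) \<or>
        (\<exists>a b. x = Inr a \<and> y = Inr b \<and> (a, b) \<in> E'\<^sup>+) \<or>
        (\<exists>a b. x = Inl a \<and> y = Inr b)" if "(x, y) \<in> ?S\<^sup>+" for x y
    using that
  proof (induction rule: trancl_induct)
    case (base y)
    then show ?case by (elim UnE imageE SigmaE) auto
  next
    case (step y z)
    from step.hyps(2) consider a b where "y = Inl a" "z = Inl b" "(a, b) \<in> E"
      | a b where "y = Inr a" "z = Inr b" "(a, b) \<in> E'" | a b where "y = Inl a" "z = Inr b"
      by (elim UnE imageE SigmaE) auto
    then show ?case using step.IH by cases (auto intro: trancl_into_trancl)
  qed
  then have "(x, x) \<notin> ?S\<^sup>+" for x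
    using assms unfolding acyclic_def by (metis Inl_Inr_False Inl_inject Inr_inject)
  then show ?thesis unfolding acyclic_def by blast
qed

lemma partition_on_Plus:
  assumes "partition_on A P" "partition_on B Q"
  shows "partition_on (A <+> B) ((`) Inl ` P \<union> (`) Inr ` Q)"
proof (rule partition_onI)
  show "\<Union> ((`) Inl ` P \<union> (`) Inr ` Q) = A <+> B"
    unfolding partition_onD1[OF assms(1)] partition_onD1[OF assms(2)] by auto
  show "{} \<notin> (`) Inl ` P \<union> (`) Inr ` Q"
    using partition_onD3[OF assms(1)] partition_onD3[OF assms(2)] by auto
next
  fix p q assume "p \<in> (`) Inl ` P \<union> (`) Inr ` Q" "q \<in> (`) Inl ` P \<union> (`) Inr ` Q" "p \<noteq> q"
  then show "disjnt p q"
    using disjointD[OF partition_onD2[OF assms(1)]] disjointD[OF partition_onD2[OF assms(2)]]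
    unfolding disjnt_def by (elim UnE imageE) blast+
qed

lemma roots_block:
  assumes F: "partitioned_tree F" and "verts F \<noteq> {}"
  shows "roots F \<in> blocks F"
proof -
  let ?E = "edges F"
  have P: "partition_on (verts F) (blocks F)" and ac: "acyclic ?E" and fin: "finite (verts F)"
    and E: "?E \<subseteq> verts F \<times> verts F"
    using F by (auto simp: partitioned_tree_def partitioned_forest_def)
  have sib: "(x \<in> roots F \<and> y \<in> roots F) \<or> (\<exists>u. (u, x) \<in> ?E \<and> (u, y) \<in> ?E)"
    if "B \<in> blocks F" "x \<in> B" "y \<in> B" for B x y
    using F that unfolding partitioned_tree_def partitioned_forest_def by blast
  have one: "\<exists>B\<in>blocks F. x \<in> B \<and> y \<in> B" if "x \<in> roots F" "y \<in> roots F" for x y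
    using F that unfolding partitioned_tree_def by blast
  have "finite ?E" using E fin by (blast intro: finite_subset)
  with ac have "wf ?E" by (simp add: finite_acyclic_wf)
  then obtain r where r: "r \<in> verts F" "\<And>u. (u, r) \<in> ?E \<Longrightarrow> u \<notin> verts F"
    using assms(2) by (meson ex_in_conv wfE_min)
  then have r: "r \<in> roots F" using E by (auto simp: roots_def)
  then obtain B where B: "B \<in> blocks F" "r \<in> B" using one by blast
  have "B \<subseteq> roots F" using sib[OF B(1) B(2)] r by (auto simp: roots_def)
  moreover have "roots F \<subseteq> B"
  proof
    fix x assume "x \<in> roots F"
    then obtain C where "C \<in> blocks F" "r \<in> C" "x \<in> C" using one r by blast
    moreover have "C = B"
      using disjointD[OF partition_onD2[OF P] \<open>C \<in> blocks F\<close> B(1)] \<open>r \<in> C\<close> B(2) by blast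
    ultimately show "x \<in> B" by simp
  qed
  ultimately show ?thesis using B by simp
qed

lemma tree_verts_empty:
  assumes "partitioned_tree F" "verts F = {}"
  shows "edges F = {}" "blocks F = {}" "roots F = {}"
  using assms by (auto simp: partitioned_tree_def partitioned_forest_def partition_on_empty roots_def)

lemma edges_graft:
  "(u, Inl x) \<in> edges (graft s F G) \<longleftrightarrow> (\<exists>a. u = Inl a \<and> (a, x) \<in> edges F)"
  "(u, Inr y) \<in> edges (graft s F G) \<longleftrightarrow>
     (\<exists>b. u = Inr b \<and> (b, y) \<in> edges G) \<or> u = Inl s \<and> y \<in> roots G"
  by (force simp: graft_def)+

lemma edges_tree_prod:
  "(u, Inl x) \<in> edges (tree_prod F G) \<longleftrightarrow> (\<exists>a. u = Inl a \<and> (a, x) \<in> edges F)"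
  "(u, Inr y) \<in> edges (tree_prod F G) \<longleftrightarrow> (\<exists>b. u = Inr b \<and> (b, y) \<in> edges G)"
  by (force simp: tree_prod_def)+

lemma verts_graft: "verts (graft s F G) = verts F <+> verts G"
  and verts_tree_prod: "verts (tree_prod F G) = verts F <+> verts G"
  by (simp_all add: graft_def tree_prod_def)

lemma roots_graft: "roots (graft s F G) = Inl ` roots F"
proof (rule set_eqI)
  show "z \<in> roots (graft s F G) \<longleftrightarrow> z \<in> Inl ` roots F" for z
    by (cases z) (simp_all add: roots_def verts_graft edges_graft image_iff Plus_def, blast+)
qed

lemma roots_tree_prod: "roots (tree_prod F G) = roots F <+> roots G"
proof (rule set_eqI)
  show "z \<in> roots (tree_prod F G) \<longleftrightarrow> z \<in> roots F <+> roots G" for z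
    by (cases z) (auto simp: roots_def verts_tree_prod edges_tree_prod)
qed

lemma graft_tree:
  assumes F: "partitioned_tree F" and G: "partitioned_tree G" and s: "s \<in> verts F"
  shows "partitioned_tree (graft s F G)"
proof -
  let ?H = "graft s F G"
  have f: "finite (verts F)" "edges F \<subseteq> verts F \<times> verts F" "acyclic (edges F)"
      "single_valued ((edges F)\<inverse>)" "partition_on (verts F) (blocks F)"
    and g: "finite (verts G)" "edges G \<subseteq> verts G \<times> verts G" "acyclic (edges G)"
      "single_valued ((edges G)\<inverse>)" "partition_on (verts G) (blocks G)"
    using F G by (auto simp: partitioned_tree_def partitioned_forest_def)
  have "finite (verts ?H)"
    using f(1) g(1) by (simp add: graft_def)
  moreover have "edges ?H \<subseteq> verts ?H \<times> verts ?H"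
    using f(2) g(2) s unfolding graft_def pforest.simps
    by (intro Un_least) (auto simp: roots_def)
  moreover have "acyclic (edges ?H)"
    unfolding graft_def pforest.simps using f(3) g(3) by (rule acyclic_sum_edges)
  moreover have "single_valued ((edges ?H)\<inverse>)"
  proof (rule single_valuedI, unfold converse_iff)
    fix x y z assume "(y, x) \<in> edges ?H" "(z, x) \<in> edges ?H"
    then show "y = z"
      using f(4) g(4)
      by (cases x) (auto simp: edges_graft roots_def single_valued_def)
  qed
  moreover have "partition_on (verts ?H) (blocks ?H)"
    unfolding graft_def pforest.simps using f(5) g(5) by (rule partition_on_Plus)
  moreover have "(x \<in> roots ?H \<and> y \<in> roots ?H) \<or> (\<exists>u. (u, x) \<in> edges ?H \<and> (u, y) \<in> edges ?H)"
    if xy: "B \<in> blocks ?H" "x \<in> B" "y \<in> B" for B x y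
  proof -
    consider C a b where "C \<in> blocks F" "a \<in> C" "b \<in> C" "x = Inl a" "y = Inl b"
      | C a b where "C \<in> blocks G" "a \<in> C" "b \<in> C" "x = Inr a" "y = Inr b"
      using xy unfolding graft_def pforest.simps by blast
    then show ?thesis
    proof cases
      case 1
      then have "(a \<in> roots F \<and> b \<in> roots F) \<or> (\<exists>u. (u, a) \<in> edges F \<and> (u, b) \<in> edges F)"
        using F unfolding partitioned_tree_def partitioned_forest_def by blast
      then show ?thesis unfolding 1(4,5) roots_graft edges_graft by blast
    next
      case 2
      then have "(a \<in> roots G \<and> b \<in> roots G) \<or> (\<exists>u. (u, a) \<in> edges G \<and> (u, b) \<in> edges G)"
        using G unfolding partitioned_tree_def partitioned_forest_def by blast
      then show ?thesis unfolding 2(4,5) roots_graft edges_graft by blast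
    qed
  qed
  moreover have "\<exists>B\<in>blocks ?H. x \<in> B \<and> y \<in> B" if "x \<in> roots ?H" "y \<in> roots ?H" for x y
  proof -
    obtain a b where ab: "a \<in> roots F" "b \<in> roots F" "x = Inl a" "y = Inl b"
      using \<open>x \<in> roots ?H\<close> \<open>y \<in> roots ?H\<close> unfolding roots_graft by blast
    then obtain B where "B \<in> blocks F" "a \<in> B" "b \<in> B"
      using F unfolding partitioned_tree_def by blast
    then show ?thesis unfolding ab graft_def by auto
  qed
  ultimately show ?thesis by (rule partitioned_treeI[OF partitioned_forestI])
qed

lemma partition_on_join:
  assumes P: "partition_on A P" and K: "K \<subseteq> P"
  shows "partition_on A ((P - K) \<union> ({\<Union> K} - {{}}))"
proof -
  have "\<Union> K \<inter> \<Union> (P - K) = {}"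
    using K disjointD[OF partition_onD2[OF P]] by blast
  then have diff: "A - \<Union> K = \<Union> (P - K)" and sub: "\<Union> K \<subseteq> A"
    using K partition_onD1[OF P] by blast+
  have part: "partition_on (\<Union> (P - K)) (P - K)"
    using P unfolding partition_on_def by (auto intro: pairwise_subset)
  show ?thesis
  proof (cases "\<Union> K = {}")
    case True
    then show ?thesis using part diff unfolding True by simp
  next
    case False
    have "insert (\<Union> K) (P - K) = P - K \<union> ({\<Union> K} - {{}})" using False by blast
    moreover have "disjnt (\<Union> K) (\<Union> (P - K))" using diff by (auto simp: disjnt_def)
    ultimately show ?thesis
      using part sub False partition_on_insert[of "\<Union> K" "P - K" A] by (simp only: diff simp_thms)
  qed
qed

lemma partition_on_merge:
  assumes P: "partition_on A P" and R: "R \<in> P \<or> R = {} \<and> P = {}"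
    and Q: "partition_on B Q" and S: "S \<in> Q \<or> S = {} \<and> Q = {}"
  shows "partition_on (A <+> B)
           ((`) Inl ` (P - {R}) \<union> (`) Inr ` (Q - {S}) \<union> ({R <+> S} - {{}}))"
proof -
  let ?P = "(`) Inl ` P \<union> (`) Inr ` Q"
  define K where "K = ?P \<inter> {Inl ` R, Inr ` S}"
  have ne: "{} \<notin> P" "{} \<notin> Q" using partition_onD3 P Q by blast+
  have *: "Inl ` C \<noteq> (Inr ` D :: ('a + 'b) set)" if "C \<in> P \<or> D \<in> Q" for C D
  proof
    assume "Inl ` C = (Inr ` D :: ('a + 'b) set)"
    then have "C = {}" "D = {}" by blast+
    then show False using that ne by simp
  qed
  have "\<Union> K = R <+> S"
    using R S unfolding K_def Plus_def by blast
  moreover have "?P - K = (`) Inl ` (P - {R}) \<union> (`) Inr ` (Q - {S})"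
  proof (rule set_eqI)
    fix z
    show "z \<in> ?P - K \<longleftrightarrow> z \<in> (`) Inl ` (P - {R}) \<union> (`) Inr ` (Q - {S})"
      using * *[THEN not_sym] by (auto simp: K_def inj_image_eq_iff)
  qed
  ultimately show ?thesis
    using partition_on_join[OF partition_on_Plus[OF P Q], of K] by (simp add: K_def)
qed

lemma tree_prod_tree:
  assumes F: "partitioned_tree F" and G: "partitioned_tree G"
  shows "partitioned_tree (tree_prod F G)"
proof -
  let ?H = "tree_prod F G"
  have f: "finite (verts F)" "edges F \<subseteq> verts F \<times> verts F" "acyclic (edges F)"
      "single_valued ((edges F)\<inverse>)" "partition_on (verts F) (blocks F)"
    and g: "finite (verts G)" "edges G \<subseteq> verts G \<times> verts G" "acyclic (edges G)"
      "single_valued ((edges G)\<inverse>)" "partition_on (verts G) (blocks G)"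
    using F G by (auto simp: partitioned_tree_def partitioned_forest_def)
  have "finite (verts ?H)"
    using f(1) g(1) by (simp add: tree_prod_def)
  moreover have "edges ?H \<subseteq> verts ?H \<times> verts ?H"
    using f(2) g(2) unfolding tree_prod_def pforest.simps by (intro Un_least) auto
  moreover have "acyclic (edges ?H)"
    using acyclic_sum_edges[OF f(3) g(3)] by (rule acyclic_subset) (auto simp: tree_prod_def)
  moreover have "single_valued ((edges ?H)\<inverse>)"
  proof (rule single_valuedI, unfold converse_iff)
    fix x y z assume "(y, x) \<in> edges ?H" "(z, x) \<in> edges ?H"
    then show "y = z"
      using f(4) g(4)
      by (cases x) (auto simp: edges_tree_prod single_valued_def)
  qed
  moreover have "partition_on (verts ?H) (blocks ?H)"
    using partition_on_merge[OF f(5) _ g(5)] roots_block[OF F] roots_block[OF G]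
      tree_verts_empty[OF F] tree_verts_empty[OF G]
    by (cases "verts F = {}"; cases "verts G = {}") (simp_all add: tree_prod_def)
  moreover have "(x \<in> roots ?H \<and> y \<in> roots ?H) \<or> (\<exists>u. (u, x) \<in> edges ?H \<and> (u, y) \<in> edges ?H)"
    if xy: "B \<in> blocks ?H" "x \<in> B" "y \<in> B" for B x y
  proof -
    consider C a b where "C \<in> blocks F" "a \<in> C" "b \<in> C" "x = Inl a" "y = Inl b"
      | C a b where "C \<in> blocks G" "a \<in> C" "b \<in> C" "x = Inr a" "y = Inr b"
      | "x \<in> roots ?H" "y \<in> roots ?H"
      using xy unfolding roots_tree_prod unfolding tree_prod_def pforest.simps by blast
    then show ?thesis
    proof cases
      case 1
      then have "(a \<in> roots F \<and> b \<in> roots F) \<or> (\<exists>u. (u, a) \<in> edges F \<and> (u, b) \<in> edges F)"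
        using F unfolding partitioned_tree_def partitioned_forest_def by blast
      then show ?thesis unfolding 1(4,5) roots_tree_prod edges_tree_prod by blast
    next
      case 2
      then have "(a \<in> roots G \<and> b \<in> roots G) \<or> (\<exists>u. (u, a) \<in> edges G \<and> (u, b) \<in> edges G)"
        using G unfolding partitioned_tree_def partitioned_forest_def by blast
      then show ?thesis unfolding 2(4,5) roots_tree_prod edges_tree_prod by blast
    qed simp
  qed
  moreover have "\<exists>B\<in>blocks ?H. x \<in> B \<and> y \<in> B" if "x \<in> roots ?H" "y \<in> roots ?H" for x y
    using that unfolding roots_tree_prod by (auto simp: tree_prod_def)
  ultimately show ?thesis by (rule partitioned_treeI[OF partitioned_forestI])
qed

lemma bump_tree: "partitioned_tree F \<Longrightarrow> partitioned_tree (bump s F)"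
  by (simp add: bump_def partitioned_tree_def partitioned_forest_def roots_def)

lemma empty_forest_tree: "partitioned_tree empty_forest"
  by (auto simp: empty_forest_def partitioned_tree_def partitioned_forest_def partition_on_empty
      roots_def acyclic_def)

lemma single_vertex_tree: "partitioned_tree (single_vertex v p)"
  by (auto simp: single_vertex_def partitioned_tree_def partitioned_forest_def partition_on_def
      roots_def acyclic_def)

lemma iso_roots_tree: "\<lbrakk>partitioned_tree F; forest_iso f F G\<rbrakk> \<Longrightarrow> roots G = f ` roots F"
  unfolding partitioned_tree_def by (elim conjE) (rule iso_roots)

lemma inj_on_map_sum: "\<lbrakk>inj_on f A; inj_on g B\<rbrakk> \<Longrightarrow> inj_on (map_sum f g) (A <+> B)"
  by (rule inj_onI) (auto dest: inj_onD)

lemma map_sum_image_Plus: "map_sum f g ` (A <+> B) = f ` A <+> g ` B"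
  by (simp add: Plus_def image_Un image_image)

lemma map_sum_image_edges:
  "map_prod (map_sum f g) (map_sum f g) ` map_prod Inl Inl ` E = map_prod Inl Inl ` map_prod f f ` E"
  "map_prod (map_sum f g) (map_sum f g) ` map_prod Inr Inr ` E' = map_prod Inr Inr ` map_prod g g ` E'"
  by (simp_all add: image_image map_prod_def split_beta)

lemma image_Times_map_prod: "map_prod h k ` (A \<times> B) = h ` A \<times> k ` B"
  by (rule map_prod_surj_on) simp_all

lemma graft_iso:
  assumes F: "partitioned_tree F" "forest_iso f F F'" and G: "partitioned_tree G" "forest_iso g G G'"
  shows "forest_iso (map_sum f g) (graft s F G) (graft (f s) F' G')"
proof (rule forest_isoI)
  note f = forest_isoD[OF F(2)] and g = forest_isoD[OF G(2)]
  have r: "roots G' = g ` roots G"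
    using G by (rule iso_roots_tree)
  show "inj_on (map_sum f g) (verts (graft s F G))"
    using f(1) g(1) unfolding verts_graft by (rule inj_on_map_sum)
  show "verts (graft (f s) F' G') = map_sum f g ` verts (graft s F G)"
    unfolding verts_graft f(2) g(2) by (rule map_sum_image_Plus[symmetric])
  show "edges (graft (f s) F' G') = map_prod (map_sum f g) (map_sum f g) ` edges (graft s F G)"
    unfolding graft_def pforest.simps f(3) g(3) r image_Un map_sum_image_edges
    by (simp add: image_Times_map_prod image_image)
  show "blocks (graft (f s) F' G') = (`) (map_sum f g) ` blocks (graft s F G)"
    unfolding graft_def pforest.simps f(4) g(4) by (simp add: image_Un image_image)
  show "deco (graft (f s) F' G') (map_sum f g x) = deco (graft s F G) x"
    if "x \<in> verts (graft s F G)" for x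
    using that f(5) g(5) unfolding verts_graft unfolding graft_def by auto
qed

lemma tree_prod_iso:
  assumes F: "partitioned_tree F" "forest_iso f F F'" and G: "partitioned_tree G" "forest_iso g G G'"
  shows "forest_iso (map_sum f g) (tree_prod F G) (tree_prod F' G')"
proof (rule forest_isoI)
  note f = forest_isoD[OF F(2)] and g = forest_isoD[OF G(2)]
  have r: "roots F' = f ` roots F" "roots G' = g ` roots G"
    using iso_roots_tree[OF F] iso_roots_tree[OF G] .
  have inj_image: "(`) h ` (P - {R}) = (`) h ` P - {h ` R}"
    if "inj_on h V" "\<Union> P \<subseteq> V" "R \<subseteq> V" for h :: "'x \<Rightarrow> 'y" and P R V
    using that inj_on_image_eq_iff[OF that(1)] by (auto simp: Sup_le_iff)
  have bF: "blocks F' - {roots F'} = (`) f ` (blocks F - {roots F})"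
    using F(1) f(1,4) r by (subst inj_image[of f "verts F"])
      (auto simp: roots_def partitioned_tree_def partitioned_forest_def partition_on_def)
  have bG: "blocks G' - {roots G'} = (`) g ` (blocks G - {roots G})"
    using G(1) g(1,4) r by (subst inj_image[of g "verts G"])
      (auto simp: roots_def partitioned_tree_def partitioned_forest_def partition_on_def)
  have m: "roots F' <+> roots G' = map_sum f g ` (roots F <+> roots G)"
    unfolding r by (rule map_sum_image_Plus[symmetric])
  show "inj_on (map_sum f g) (verts (tree_prod F G))"
    using f(1) g(1) unfolding verts_tree_prod by (rule inj_on_map_sum)
  show "verts (tree_prod F' G') = map_sum f g ` verts (tree_prod F G)"
    unfolding verts_tree_prod f(2) g(2) by (rule map_sum_image_Plus[symmetric])
  show "edges (tree_prod F' G') = map_prod (map_sum f g) (map_sum f g) ` edges (tree_prod F G)"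
    unfolding tree_prod_def pforest.simps f(3) g(3) image_Un map_sum_image_edges ..
  have "{roots F' <+> roots G'} - {{}} = (`) (map_sum f g) ` ({roots F <+> roots G} - {{}})"
    unfolding m by auto
  then show "blocks (tree_prod F' G') = (`) (map_sum f g) ` blocks (tree_prod F G)"
    unfolding tree_prod_def pforest.simps bF bG by (simp add: image_Un image_image)
  show "deco (tree_prod F' G') (map_sum f g x) = deco (tree_prod F G) x"
    if "x \<in> verts (tree_prod F G)" for x
    using that f(5) g(5) unfolding verts_tree_prod unfolding tree_prod_def by auto
qed

lemma bump_iso:
  assumes "forest_iso f F F'" "s \<in> verts F"
  shows "forest_iso f (bump s F) (bump (f s) F')"
  using assms by (auto simp: forest_iso_def bump_def bij_betw_def dest: inj_onD)


section \<open>Isomorphism classes\<close>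

text \<open>
  Every finite forest is isomorphic to one whose vertices are natural numbers, so that \<open>'d upt\<close>
  consists of all isomorphism classes of partitioned trees decorated by \<open>\<nat> \<times> 'd\<close>.
\<close>

definition tree_equiv :: "('v, 'd) pforest \<Rightarrow> ('v, 'd) pforest \<Rightarrow> bool" where
  "tree_equiv F G \<longleftrightarrow> partitioned_tree F \<and> partitioned_tree G \<and> (\<exists>f. forest_iso f F G)"

lemma tree_equivI: "\<lbrakk>partitioned_tree F; forest_iso f F G\<rbrakk> \<Longrightarrow> tree_equiv F G"
  unfolding tree_equiv_def by (intro conjI exI) (assumption, rule iso_partitioned_tree)

lemma tree_equiv_refl: "partitioned_tree F \<Longrightarrow> tree_equiv F F"
  by (rule tree_equivI[OF _ forest_iso_refl])

quotient_type 'd upt = "(nat, 'd) pforest" / partial: tree_equiv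
proof (rule part_equivpI)
  show "\<exists>F :: (nat, 'd) pforest. tree_equiv F F"
    using tree_equiv_refl[OF empty_forest_tree] by blast
  show "symp (tree_equiv :: (nat, 'd) pforest \<Rightarrow> _)"
    unfolding symp_def tree_equiv_def partitioned_tree_def by (meson forest_iso_sym)
  show "transp (tree_equiv :: (nat, 'd) pforest \<Rightarrow> _)"
    unfolding transp_def tree_equiv_def by (meson forest_iso_trans)
qed

text \<open>Disjoint unions of vertex sets are renumbered by \<^term>\<open>sum_encode\<close>.\<close>

lemma renumber_iso: "forest_iso sum_encode F (relabel sum_encode F)"
  using inj_sum_encode by (rule relabel_iso)

lemma renumber_equiv:
  assumes "partitioned_tree F" "forest_iso h F F'"
  shows "tree_equiv (relabel sum_encode F) (relabel sum_encode F')"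
proof -
  have "partitioned_forest F" using assms(1) by (simp add: partitioned_tree_def)
  from forest_iso_sym[OF this renumber_iso]
  obtain k where "forest_iso k (relabel sum_encode F) F" by blast
  then have "forest_iso (sum_encode \<circ> (h \<circ> k)) (relabel sum_encode F) (relabel sum_encode F')"
    by (intro forest_iso_trans[OF _ renumber_iso] forest_iso_trans[OF _ assms(2)])
  with iso_partitioned_tree[OF assms(1) renumber_iso] show ?thesis by (rule tree_equivI)
qed

lift_definition empty_tree :: "'d upt" is empty_forest
  by (rule tree_equiv_refl[OF empty_forest_tree])

lift_definition tau :: "nat \<times> 'd \<Rightarrow> 'd upt" is "single_vertex 0"
  by (rule tree_equiv_refl[OF single_vertex_tree])

lift_definition upt_prod :: "'d upt \<Rightarrow> 'd upt \<Rightarrow> 'd upt"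
  is "\<lambda>F G. relabel sum_encode (tree_prod F G)"
proof -
  fix F F' G G' :: "(nat, 'd) pforest"
  assume "tree_equiv F F'" "tree_equiv G G'"
  then obtain f g where "partitioned_tree F" "forest_iso f F F'" "partitioned_tree G" "forest_iso g G G'"
    unfolding tree_equiv_def by blast
  then show "tree_equiv (relabel sum_encode (tree_prod F G)) (relabel sum_encode (tree_prod F' G'))"
    by (intro renumber_equiv[OF tree_prod_tree tree_prod_iso])
qed

lemma abs_upt_eqI: "tree_equiv F G \<Longrightarrow> abs_upt F = abs_upt G"
  using Quotient3_upt by (rule Quotient3_rel_abs)

definition basis :: "'d upt \<Rightarrow> ('d upt \<Rightarrow>\<^sub>0 'k::field_char_0)" where
  "basis T = Poly_Mapping.single T 1"

lift_definition upt_bul :: "'d upt \<Rightarrow> 'd upt \<Rightarrow> ('d upt \<Rightarrow>\<^sub>0 'k::field_char_0)"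
  is "\<lambda>F G. if verts G \<noteq> {}
            then \<Sum>s\<in>verts F. basis (abs_upt (relabel sum_encode (graft s F G)))
            else \<Sum>s\<in>verts F. basis (abs_upt (bump s F))"
proof -
  fix F F' G G' :: "(nat, 'd) pforest"
  assume "tree_equiv F F'" "tree_equiv G G'"
  then obtain f g where F: "partitioned_tree F" "forest_iso f F F'"
    and G: "partitioned_tree G" "forest_iso g G G'"
    unfolding tree_equiv_def by blast
  note f = forest_isoD[OF F(2)] and g = forest_isoD[OF G(2)]
  have reindex: "(\<Sum>s\<in>verts F'. h s) = (\<Sum>s\<in>verts F. h (f s))" for h :: "nat \<Rightarrow> 'd upt \<Rightarrow>\<^sub>0 'k"
    unfolding f(2) using sum.reindex[OF f(1), of h] by simp
  have "abs_upt (relabel sum_encode (graft s F G)) = abs_upt (relabel sum_encode (graft (f s) F' G'))"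
    if "s \<in> verts F" for s
    by (rule abs_upt_eqI[OF renumber_equiv[OF graft_tree[OF F(1) G(1) that] graft_iso[OF F G]]])
  moreover have "abs_upt (bump s F) = abs_upt (bump (f s) F')" if "s \<in> verts F" for s
    by (rule abs_upt_eqI[OF tree_equivI[OF bump_tree[OF F(1)] bump_iso[OF F(2) that]]])
  moreover have "verts G' = {} \<longleftrightarrow> verts G = {}" using g(2) by simp
  ultimately show
    "(if verts G \<noteq> {}
      then \<Sum>s\<in>verts F. basis (abs_upt (relabel sum_encode (graft s F G)))
      else \<Sum>s\<in>verts F. basis (abs_upt (bump s F)) :: 'd upt \<Rightarrow>\<^sub>0 'k) =
     (if verts G' \<noteq> {}
      then \<Sum>s\<in>verts F'. basis (abs_upt (relabel sum_encode (graft s F' G')))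
      else \<Sum>s\<in>verts F'. basis (abs_upt (bump s F')))"
    unfolding reindex by (auto intro!: sum.cong)
qed

lift_definition upt_decos :: "'d upt \<Rightarrow> (nat \<times> 'd) set" is "\<lambda>F. deco F ` verts F"
proof -
  fix F G :: "(nat, 'd) pforest"
  assume "tree_equiv F G"
  then obtain f where "forest_iso f F G" unfolding tree_equiv_def by blast
  from forest_isoD[OF this] show "deco F ` verts F = deco G ` verts G"
    by (simp add: image_image)
qed

definition UPT :: "'d set \<Rightarrow> 'd upt set" where
  "UPT D = {T. upt_decos T \<subseteq> UNIV \<times> D}"


section \<open>The algebra \<open>UCP(D)\<close>\<close>

definition UCP :: "'d set \<Rightarrow> ('d upt \<Rightarrow>\<^sub>0 'k::field_char_0) set" where
  "UCP D = {x. Poly_Mapping.keys x \<subseteq> UPT D}"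

definition ucp_scale :: "'k::field_char_0 \<Rightarrow> ('d upt \<Rightarrow>\<^sub>0 'k) \<Rightarrow> ('d upt \<Rightarrow>\<^sub>0 'k)" where
  "ucp_scale c = Poly_Mapping.map ((*) c)"

definition bilinear_extension ::
  "('d upt \<Rightarrow> 'd upt \<Rightarrow> ('d upt \<Rightarrow>\<^sub>0 'k)) \<Rightarrow>
   ('d upt \<Rightarrow>\<^sub>0 'k) \<Rightarrow> ('d upt \<Rightarrow>\<^sub>0 'k::field_char_0) \<Rightarrow> ('d upt \<Rightarrow>\<^sub>0 'k)" where
  "bilinear_extension m x y =
     (\<Sum>S\<in>Poly_Mapping.keys x. \<Sum>T\<in>Poly_Mapping.keys y.
        ucp_scale (Poly_Mapping.lookup x S * Poly_Mapping.lookup y T) (m S T))"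

definition ucp_dot ::
  "('d upt \<Rightarrow>\<^sub>0 'k::field_char_0) \<Rightarrow> ('d upt \<Rightarrow>\<^sub>0 'k) \<Rightarrow> ('d upt \<Rightarrow>\<^sub>0 'k)" where
  "ucp_dot = bilinear_extension (\<lambda>S T. basis (upt_prod S T))"

definition ucp_bul ::
  "('d upt \<Rightarrow>\<^sub>0 'k::field_char_0) \<Rightarrow> ('d upt \<Rightarrow>\<^sub>0 'k) \<Rightarrow> ('d upt \<Rightarrow>\<^sub>0 'k)" where
  "ucp_bul = bilinear_extension upt_bul"

end

theory Submission
  imports Defs "HOL-Library.Multiset" "HOL-Library.Countable"
begin

text \<open>
  In a Com-PreLie algebra with unit \<open>1\<close> the Leibniz rule forces \<open>1 \<bullet> c = 0\<close>. A vertex decorated by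
  \<open>(k, d)\<close> with child blocks \<open>B\<^sub>1, \<dots>, B\<^sub>n\<close> is evaluated as the symmetric brace
  \<open>a\<^sub>d {1, \<dots>, 1, b\<^sub>1, \<dots>, b\<^sub>n}\<close> with \<open>k\<close> copies of \<open>1\<close>, where \<open>b\<^sub>i\<close> is the product of the values of the
  vertices of \<open>B\<^sub>i\<close>; a tree is evaluated as the product over its roots. Since \<open>- \<bullet> c\<close> is a derivation
  of the product and acts on a brace by inserting \<open>c\<close> as a new argument or by acting on one of the
  arguments, the value of \<open>F\<close> multiplied by \<open>c\<close> is the sum over the vertices of \<open>F\<close> of the values
  obtained by inserting \<open>c\<close> there. So evaluation is a morphism. It is the only one because every tree
  is generated by single vertices: several roots are separated by the product, and a child block of a
  single root \<open>r\<close> is split off by writing the tree as \<open>F \<bullet> G\<close> minus trees with the same number of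
  vertices but fewer child blocks at the root.
\<close>

section \<open>Symmetric braces of a pre-Lie algebra\<close>

text \<open>Raising a decoration and grafting a tree look different, but both add one argument to a
  brace: the empty tree has value \<open>1\<close>, so acting by it must insert a further
  \<open>1\<close>. This is why a decoration is evaluated as a number of copies of \<open>1\<close>.
  Because \<open>1 \<bullet> c = 0\<close>, these copies give no terms when \<open>c\<close> acts,
  in accordance with the fact that a decoration offers no vertex at which \<open>c\<close> could be
  inserted. To treat both cases at once, evaluation carries at each vertex a free multiset
  \<open>X\<close> of extra arguments, and the claim becomes: adding \<open>c\<close> to
  \<open>X s\<close> and summing over all \<open>s\<close> multiplies the value by \<open>c\<close>.
  Child blocks are unordered, so the brace has to be a function of a multiset; this is where the
  pre-Lie identity of the target enters. The target algebra lives on a subspace, whereas recursion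
  over trees is simpler for products defined everywhere; a linear projection onto the subspace
  reconciles the two.\<close>

text \<open>
  Only the values of the products are required to be fixed by the unit: this is what remains when
  products defined on a subspace are extended to the whole type through a linear projection.
\<close>

locale total_com_prelie =
  fixes dot :: "'a::ab_group_add \<Rightarrow> 'a \<Rightarrow> 'a" (infixl \<open>\<otimes>\<close> 70)
    and bul :: "'a \<Rightarrow> 'a \<Rightarrow> 'a" (infixl \<open>\<lhd>\<close> 70)
    and one :: 'a
  assumes dot_add: "(x + y) \<otimes> z = x \<otimes> z + y \<otimes> z"
    and bul_add_left: "(x + y) \<lhd> z = x \<lhd> z + y \<lhd> z"
    and bul_add_right: "x \<lhd> (y + z) = x \<lhd> y + x \<lhd> z"
    and dot_assoc: "(x \<otimes> y) \<otimes> z = x \<otimes> (y \<otimes> z)"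
    and dot_commute: "x \<otimes> y = y \<otimes> x"
    and pre_lie: "(x \<lhd> y) \<lhd> z - x \<lhd> (y \<lhd> z) = (x \<lhd> z) \<lhd> y - x \<lhd> (z \<lhd> y)"
    and leibniz: "(x \<otimes> y) \<lhd> z = (x \<lhd> z) \<otimes> y + x \<otimes> (y \<lhd> z)"
    and one_dot_dot: "one \<otimes> (x \<otimes> y) = x \<otimes> y"
    and one_dot_bul: "one \<otimes> (x \<lhd> y) = x \<lhd> y"
    and one_dot_one: "one \<otimes> one = one"
begin

lemma dot_left_commute: "x \<otimes> (y \<otimes> z) = y \<otimes> (x \<otimes> z)"
  by (metis dot_assoc dot_commute)

lemma dot_add_right: "x \<otimes> (y + z) = x \<otimes> y + x \<otimes> z"
  by (metis dot_add dot_commute)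

sublocale dot_left: additive "\<lambda>x. x \<otimes> z" for z
  by unfold_locales (rule dot_add)

sublocale dot_right: additive "\<lambda>z. x \<otimes> z" for x
  by unfold_locales (rule dot_add_right)

sublocale bul_left: additive "\<lambda>x. x \<lhd> z" for z
  by unfold_locales (rule bul_add_left)

sublocale bul_right: additive "\<lambda>z. x \<lhd> z" for x
  by unfold_locales (rule bul_add_right)

text \<open>\<open>one\<close> is its own square and fixes the values of \<open>\<lhd>\<close>, so
  Leibniz yields \<open>one \<lhd> c\<close> twice.\<close>

lemma one_bul: "one \<lhd> c = 0"
proof -
  have "one \<lhd> c = (one \<otimes> one) \<lhd> c" by (simp add: one_dot_one)
  also have "\<dots> = one \<lhd> c + one \<lhd> c"
    by (simp only: leibniz one_dot_bul dot_commute[of "one \<lhd> c"])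
  finally show ?thesis by simp
qed

text \<open>
  The brace \<open>a {y\<^sub>1, \<dots>, y\<^sub>n}\<close> of Oudom and Guin; the pre-Lie identity makes it independent of the
  order of the arguments.
\<close>

function br :: "'a \<Rightarrow> 'a list \<Rightarrow> 'a" where
  "br a [] = a"
| "br a (y # ys) = br a ys \<lhd> y - (\<Sum>i<length ys. br a (ys[i := ys ! i \<lhd> y]))"
  by pat_completeness auto
termination by (relation "measure (length \<circ> snd)") auto

text \<open>Additivity in every argument is needed already to see that the order of the arguments is
  irrelevant: there two terms that act on the same entry have to be merged.\<close>

lemma br_add:
  "i < length ys \<Longrightarrow> br a (ys[i := x + y]) = br a (ys[i := x]) + br a (ys[i := y])"
proof (induction "length ys" arbitrary: ys i x y)
  case (Suc n)
  then obtain z zs where ys: "ys = z # zs" and n: "n = length zs" by (cases ys) auto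
  note IH = Suc.hyps(1)[OF n]
  show ?case
  proof (cases i)
    case 0
    then show ?thesis
      by (simp add: ys bul_add_right IH sum.distrib)
  next
    case (Suc k)
    then have k: "k < length zs" using Suc.prems ys by simp
    \<comment> \<open>The summand \<open>j = k\<close> acts on the updated entry itself. In all
      others the update at \<open>k\<close> commutes with the one at \<open>j\<close> and is moved
      outside, where the induction hypothesis applies.\<close>
    have split: "(\<Sum>j<length zs. br a (zs[k := w, j := zs[k := w] ! j \<lhd> z])) =
        br a (zs[k := w \<lhd> z]) + (\<Sum>j\<in>{..<length zs} - {k}. br a ((zs[j := zs ! j \<lhd> z])[k := w]))" for w
    proof -
      have "(\<Sum>j\<in>{..<length zs} - {k}. br a (zs[k := w, j := zs[k := w] ! j \<lhd> z])) =
          (\<Sum>j\<in>{..<length zs} - {k}. br a ((zs[j := zs ! j \<lhd> z])[k := w]))"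
        by (intro sum.cong refl arg_cong[of _ _ "br a"]) (simp add: list_update_swap[of k])
      then show ?thesis using k by (subst sum.remove[of _ k]) auto
    qed
    have IH': "br a (zs[j := v, k := x + y]) = br a (zs[j := v, k := x]) + br a (zs[j := v, k := y])" for j v
      using Suc.hyps(1)[of "zs[j := v]" k] n k by simp
    show ?thesis
      by (simp add: ys Suc split IH[OF k] IH' bul_add_left sum.distrib del: list_update_swap)
  qed
qed simp

text \<open>The choice of an ordering is harmless by \<open>br_eq_brm\<close>. It is made before
  that lemma because its induction already uses \<open>brm\<close> on shorter lists.\<close>

definition brm :: "'a \<Rightarrow> 'a multiset \<Rightarrow> 'a" where
  "brm a M = br a (SOME l. mset l = M)"

text \<open>Turns the sum over positions in the recursion of \<open>br\<close> into a sum over the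
  multiset of arguments, so that the correction term visibly ignores their order.\<close>

lemma sum_list_update_mset:
  "(\<Sum>i<length ys. h (mset (ys[i := ys ! i \<lhd> y]))) =
     (\<Sum>x\<in>#mset ys. h (add_mset (x \<lhd> y) (mset ys - {#x#})) :: 'a)"
proof -
  have "(\<Sum>x\<in>#mset ys. h (add_mset (x \<lhd> y) (mset ys - {#x#}))) =
      sum_list (map (\<lambda>x. h (add_mset (x \<lhd> y) (mset ys - {#x#}))) ys)"
    unfolding sum_mset_sum_list[symmetric] mset_map ..
  also have "\<dots> = (\<Sum>i<length ys. h (add_mset (ys ! i \<lhd> y) (mset ys - {#ys ! i#})))"
    by (simp add: sum_list_sum_nth lessThan_atLeast0)
  finally show ?thesis by (simp add: mset_update)
qed

text \<open>The double sums run over two successive actions on the entries. Actions on different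
  entries commute. When both hit the same entry \<open>x\<close>, the term with
  \<open>(x \<lhd> y) \<lhd> z\<close> joins the one with \<open>x \<lhd> (z \<lhd> y)\<close> from
  the single sum, and by the pre-Lie identity the result is symmetric in \<open>y\<close> and
  \<open>z\<close>.\<close>

lemma br_swap_sum_aux:
  fixes ys :: "'a list" and y z :: 'a
  defines "n \<equiv> length ys"
  shows "(\<Sum>i<n. br a (ys[i := ys ! i \<lhd> (z \<lhd> y)])) +
      (\<Sum>i<n. \<Sum>j<n. br a (ys[i := ys ! i \<lhd> y, j := ys[i := ys ! i \<lhd> y] ! j \<lhd> z])) =
    (\<Sum>i<n. br a (ys[i := ys ! i \<lhd> (y \<lhd> z)])) +
      (\<Sum>i<n. \<Sum>j<n. br a (ys[i := ys ! i \<lhd> z, j := ys[i := ys ! i \<lhd> z] ! j \<lhd> y]))"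
proof -
  \<comment> \<open>The diagonal is set to zero, so that the sum over the full square is the
    off-diagonal part and can be transposed.\<close>
  define E where "E y z i j = (if i = j then 0 else br a (ys[i := ys ! i \<lhd> y, j := ys ! j \<lhd> z]))" for y z i j
  have D: "br a (ys[i := ys ! i \<lhd> (z \<lhd> y)]) + (\<Sum>j<n. br a (ys[i := ys ! i \<lhd> y, j := ys[i := ys ! i \<lhd> y] ! j \<lhd> z]))
      = br a (ys[i := ys ! i \<lhd> (z \<lhd> y) + (ys ! i \<lhd> y) \<lhd> z]) + (\<Sum>j<n. E y z i j)" if "i < n" for i y z
  proof -
    have 1: "(\<Sum>j<n. br a (ys[i := ys ! i \<lhd> y, j := ys[i := ys ! i \<lhd> y] ! j \<lhd> z])) =
       br a (ys[i := (ys ! i \<lhd> y) \<lhd> z]) + (\<Sum>j\<in>{..<n}-{i}. E y z i j)"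
      using that by (subst sum.remove[of _ i]) (auto simp: E_def n_def intro!: sum.cong)
    have 2: "(\<Sum>j<n. E y z i j) = (\<Sum>j\<in>{..<n}-{i}. E y z i j)"
      using that by (subst sum.remove[of _ i]) (auto simp: E_def)
    show ?thesis using that unfolding 1 2 by (simp add: n_def br_add)
  qed
  have S: "ys ! i \<lhd> (z \<lhd> y) + (ys ! i \<lhd> y) \<lhd> z = ys ! i \<lhd> (y \<lhd> z) + (ys ! i \<lhd> z) \<lhd> y" for i
    using pre_lie[of "ys ! i" y z] by (simp add: algebra_simps)
  have "E y z i j = E z y j i" for i j
    by (cases "i = j") (simp_all add: E_def list_update_swap[of i j])
  then have E: "(\<Sum>i<n. \<Sum>j<n. E y z i j) = (\<Sum>i<n. \<Sum>j<n. E z y i j)"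
    by (subst sum.swap) simp
  have T: "(\<Sum>i<n. br a (ys[i := ys ! i \<lhd> (z \<lhd> y)])) +
      (\<Sum>i<n. \<Sum>j<n. br a (ys[i := ys ! i \<lhd> y, j := ys[i := ys ! i \<lhd> y] ! j \<lhd> z])) =
    (\<Sum>i<n. br a (ys[i := ys ! i \<lhd> (z \<lhd> y) + (ys ! i \<lhd> y) \<lhd> z])) + (\<Sum>i<n. \<Sum>j<n. E y z i j)" for y z
    unfolding sum.distrib[symmetric] using D by (intro sum.cong) simp_all
  show ?thesis
    unfolding T E S ..
qed

text \<open>Unfolding the recursion twice leaves the associator of \<open>br a ys\<close>,
  \<open>z\<close> and \<open>y\<close>, which is symmetric by the pre-Lie identity, two sums that
  trade places, and the bracket treated in \<open>br_swap_sum_aux\<close>.\<close>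

lemma br_swap: "br a (y # z # ys) = br a (z # y # ys)"
proof -
  have bul_minus: "(u - v) \<lhd> w = u \<lhd> w - v \<lhd> w" for u v w by (rule bul_left.diff)
  have expand: "br a (y # z # ys) =
    ((br a ys \<lhd> z) \<lhd> y - br a ys \<lhd> (z \<lhd> y))
      - (\<Sum>i<length ys. br a (ys[i := ys ! i \<lhd> z])) \<lhd> y
      - (\<Sum>i<length ys. br a (ys[i := ys ! i \<lhd> y])) \<lhd> z
      + ((\<Sum>i<length ys. br a (ys[i := ys ! i \<lhd> (z \<lhd> y)])) +
      (\<Sum>i<length ys. \<Sum>j<length ys. br a (ys[i := ys ! i \<lhd> y, j := ys[i := ys ! i \<lhd> y] ! j \<lhd> z])))"
    for y z
    by (simp add: sum.lessThan_Suc_shift bul_minus sum_subtractf bul_left.sum algebra_simps del: sum.lessThan_Suc)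
  show ?thesis
    unfolding expand br_swap_sum_aux[where y = y and z = z] pre_lie[of _ z y] by (simp add: algebra_simps)
qed

text \<open>Permutation invariance by induction on the length. Equal heads reduce to the tails. For
  different heads \<open>y\<close> and \<open>z\<close>, rearranging the tails brings the lists to
  \<open>y # z # ws\<close> and \<open>z # y # ws\<close> with the same \<open>ws\<close>, and
  \<open>br_swap\<close> applies.\<close>

lemma br_eq_brm: "br a ys = brm a (mset ys)"
proof -
  have "mset ys = mset zs \<Longrightarrow> br a ys = br a zs" for zs
  proof (induction "length ys" arbitrary: ys zs rule: less_induct)
    case less
    show ?case
    proof (cases ys)
      case Nil
      then show ?thesis using less.prems by simp
    next
      case (Cons y ys')
      have "br a us = brm a (mset us)" if "length us \<le> length ys'" for us
      proof -
        have "mset us = mset (SOME l. mset l = mset us)"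
          by (metis (mono_tags) someI)
        from less.hyps[OF _ this] that show ?thesis
          by (simp add: brm_def Cons)
      qed
      then have tail: "br a (x # us) = br a (x # vs)" if "mset us = mset vs" "length us = length ys'" for x us vs
      proof -
        note * = \<open>\<And>us. length us \<le> length ys' \<Longrightarrow> br a us = brm a (mset us)\<close>
        have "br a (x # ws) = brm a (mset ws) \<lhd> x
            - (\<Sum>w\<in>#mset ws. brm a (add_mset (w \<lhd> x) (mset ws - {#w#})))"
          if "length ws = length ys'" for ws
          unfolding sum_list_update_mset[where h = "brm a", symmetric] using that by (simp add: *)
        moreover have "length vs = length us" using that by (metis size_mset)
        ultimately show ?thesis using that by simp
      qed
      from Cons less.prems obtain z zs' where zs: "zs = z # zs'" by (cases zs) auto
      show ?thesis
      proof (cases "y = z")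
        case True
        then show ?thesis using tail[of ys' zs' y] less.prems by (simp add: Cons zs)
      next
        case False
        with less.prems obtain M where M: "mset ys' = add_mset z M" "mset zs' = add_mset y M"
          unfolding Cons zs mset.simps by (metis add_eq_conv_ex)
        obtain ws where ws: "mset ws = M" using ex_mset by blast
        have "length zs' = length ys'" using M by (metis size_mset size_add_mset)
        then have "br a ys = br a (y # z # ws)" "br a zs = br a (z # y # ws)"
          unfolding Cons zs using M ws by (intro tail; simp)+
        then show ?thesis by (simp only: br_swap[of a y])
      qed
    qed
  qed
  then show ?thesis unfolding brm_def by (metis (mono_tags) someI)
qed

lemma brm_empty [simp]: "brm a {#} = a"
  using br_eq_brm[of a "[]"] by simp

text \<open>The recursion of \<open>br\<close> solved for the product, now free of any
  ordering.\<close>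

lemma brm_bul:
  "brm a M \<lhd> y = brm a (add_mset y M) + (\<Sum>x\<in>#M. brm a (add_mset (x \<lhd> y) (M - {#x#})))"
proof -
  obtain l where l: "mset l = M" using ex_mset by blast
  have "brm a (add_mset y M) = br a (y # l)"
    by (simp only: br_eq_brm l mset.simps)
  also have "\<dots> = brm a M \<lhd> y - (\<Sum>x\<in>#M. brm a (add_mset (x \<lhd> y) (M - {#x#})))"
    unfolding l[symmetric] sum_list_update_mset[where h = "brm a", symmetric] by (simp flip: br_eq_brm)
  finally show ?thesis by simp
qed

lemma brm_add: "brm a (add_mset (x + y) M) = brm a (add_mset x M) + brm a (add_mset y M)"
proof -
  obtain l where l: "mset l = M" using ex_mset by blast
  \<comment> \<open>The head \<open>0\<close> is a placeholder; the update at position 0 overwrites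
    it.\<close>
  show ?thesis
    using br_add[of 0 "0 # l" a x y] by (simp add: br_eq_brm l del: br.simps)
qed

sublocale brm: additive "\<lambda>x. brm a (add_mset x M)" for a M
  by unfold_locales (rule brm_add)

text \<open>The seed \<open>one\<close> remains as a last factor, so the product of a single
  \<open>x\<close> is \<open>x \<otimes> one\<close>, which in this locale may differ from
  \<open>x\<close>.\<close>

definition pr :: "'a multiset \<Rightarrow> 'a" where
  "pr M = fold_mset (\<otimes>) one M"

lemma pr_empty [simp]: "pr {#} = one"
  by (simp add: pr_def)

lemma pr_add_mset [simp]: "pr (add_mset x M) = x \<otimes> pr M"
proof -
  interpret comp_fun_commute "(\<otimes>)"
    by unfold_locales (simp add: fun_eq_iff dot_left_commute)
  show ?thesis by (simp add: pr_def)
qed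

lemma one_dot_pr: "one \<otimes> pr M = pr M"
  by (cases M) (simp_all add: one_dot_one one_dot_dot)

lemma pr_union: "pr (M + N) = pr M \<otimes> pr N"
  by (induction M) (simp_all add: one_dot_pr dot_assoc)

text \<open>Leibniz for several factors; the empty product is the case
  \<open>one \<lhd> c = 0\<close>.\<close>

lemma pr_bul: "pr M \<lhd> c = (\<Sum>x\<in>#M. (x \<lhd> c) \<otimes> pr (M - {#x#}))"
proof (induction M)
  case (add x M)
  have "(\<Sum>y\<in>#M. (y \<lhd> c) \<otimes> pr (add_mset x M - {#y#})) = x \<otimes> (\<Sum>y\<in>#M. (y \<lhd> c) \<otimes> pr (M - {#y#}))"
  proof -
    have "(\<Sum>y\<in>#M. (y \<lhd> c) \<otimes> pr (add_mset x M - {#y#})) = (\<Sum>y\<in>#M. x \<otimes> ((y \<lhd> c) \<otimes> pr (M - {#y#})))"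
      by (intro arg_cong[of _ _ sum_mset] image_mset_cong)
        (auto simp: dot_left_commute[of x] dest!: multi_member_split)
    also have "\<dots> = x \<otimes> (\<Sum>y\<in>#M. (y \<lhd> c) \<otimes> pr (M - {#y#}))"
    proof -
      have "(\<Sum>y\<in>#N. x \<otimes> g y) = x \<otimes> (\<Sum>y\<in>#N. g y)" for g N
        by (induction N) (simp_all add: dot_right.zero dot_add_right)
      then show ?thesis .
    qed
    finally show ?thesis .
  qed
  then show ?case using add by (simp add: leibniz)
qed (simp add: one_bul)

end


section \<open>Evaluation of partitioned forests\<close>

definition child_blocks :: "('v, 'd) pforest \<Rightarrow> 'v \<Rightarrow> 'v set set" where
  "child_blocks F v = {B \<in> blocks F. \<forall>x\<in>B. (v, x) \<in> edges F}"

section \<open>Blocks, roots and children in a partitioned forest\<close>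

lemma partitioned_forestD:
  assumes "partitioned_forest F"
  shows "finite (verts F)" "edges F \<subseteq> verts F \<times> verts F" "acyclic (edges F)"
    "single_valued ((edges F)\<inverse>)" "partition_on (verts F) (blocks F)"
    "\<lbrakk>B \<in> blocks F; x \<in> B; y \<in> B\<rbrakk> \<Longrightarrow>
        (x \<in> roots F \<and> y \<in> roots F) \<or> (\<exists>u. (u, x) \<in> edges F \<and> (u, y) \<in> edges F)"
  using assms unfolding partitioned_forest_def by simp_all

lemma partitioned_tree_forest: "partitioned_tree F \<Longrightarrow> partitioned_forest F"
  by (simp add: partitioned_tree_def)

lemma parent_unique:
  "\<lbrakk>partitioned_forest F; (u, x) \<in> edges F; (v, x) \<in> edges F\<rbrakk> \<Longrightarrow> u = v"
  using partitioned_forestD(4)[of F] by (auto dest: single_valuedD)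

lemma block_ne: "\<lbrakk>partitioned_forest F; B \<in> blocks F\<rbrakk> \<Longrightarrow> B \<noteq> {}"
  using partition_onD3[OF partitioned_forestD(5)] by blast

lemma block_unique:
  "\<lbrakk>partitioned_forest F; B \<in> blocks F; C \<in> blocks F; x \<in> B; x \<in> C\<rbrakk> \<Longrightarrow> B = C"
  using disjointD[OF partition_onD2[OF partitioned_forestD(5)]] by blast

lemma block_exists: "\<lbrakk>partitioned_forest F; x \<in> verts F\<rbrakk> \<Longrightarrow> \<exists>B\<in>blocks F. x \<in> B"
  using partition_onD1[OF partitioned_forestD(5)] by blast

lemma finite_blocks: "partitioned_forest F \<Longrightarrow> finite (blocks F)"
  by (rule finite_elements[OF partitioned_forestD(1,5)])

lemma finite_block: "\<lbrakk>partitioned_forest F; B \<in> blocks F\<rbrakk> \<Longrightarrow> finite B"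
  by (rule finite_subset[OF blocks_subset partitioned_forestD(1)])

lemma roots_subset: "roots F \<subseteq> verts F"
  by (auto simp: roots_def)

lemma rootsD: "x \<in> roots F \<Longrightarrow> x \<in> verts F"
  by (simp add: roots_def)

lemma finite_roots: "partitioned_forest F \<Longrightarrow> finite (roots F)"
  by (rule finite_subset[OF roots_subset partitioned_forestD(1)])

lemma child_blocks_subset: "child_blocks F v \<subseteq> blocks F"
  by (auto simp: child_blocks_def)

lemma child_blocksD: "B \<in> child_blocks F v \<Longrightarrow> B \<in> blocks F"
  by (simp add: child_blocks_def)

lemma finite_child_blocks: "partitioned_forest F \<Longrightarrow> finite (child_blocks F v)"
  by (rule finite_subset[OF child_blocks_subset finite_blocks])

text \<open>Members of a block that contains a non-root share a parent, and parents are unique, so a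
  single child of \<open>v\<close> decides for its whole block.\<close>

lemma child_blocks_memI:
  assumes F: "partitioned_forest F" and "B \<in> blocks F" "w \<in> B" "(v, w) \<in> edges F"
  shows "B \<in> child_blocks F v"
proof -
  have "(v, x) \<in> edges F" if "x \<in> B" for x
  proof -
    from partitioned_forestD(6)[OF F \<open>B \<in> blocks F\<close> \<open>w \<in> B\<close> that] assms(4)
    obtain u where "(u, w) \<in> edges F" "(u, x) \<in> edges F" by (auto simp: roots_def)
    then show ?thesis using parent_unique[OF F _ assms(4)] by blast
  qed
  then show ?thesis using assms(2) by (simp add: child_blocks_def)
qed

lemma Union_child_blocks:
  assumes F: "partitioned_forest F"
  shows "\<Union> (child_blocks F v) = {w. (v, w) \<in> edges F}"
proof
  show "\<Union> (child_blocks F v) \<subseteq> {w. (v, w) \<in> edges F}" by (auto simp: child_blocks_def)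
  show "{w. (v, w) \<in> edges F} \<subseteq> \<Union> (child_blocks F v)"
    using child_blocks_memI[OF F] block_exists[OF F] edges_subset[OF F] by blast
qed

text \<open>In \<open>(edges F)\<inverse>\<close> a child precedes its parent: this is induction
  from the leaves to the roots, the order along which \<open>ev\<close> recurses.\<close>

lemma wf_parents: "partitioned_forest F \<Longrightarrow> wf ((edges F)\<inverse>)"
  using partitioned_forestD(1,2,3)[of F]
  by (intro finite_acyclic_wf_converse) (auto intro: finite_subset)

section \<open>Child blocks under isomorphism, product and grafting\<close>

lemma child_blocks_embed:
  assumes F: "partitioned_forest F" and inj: "inj_on h (verts F)" and v: "v \<in> verts F"
    and B: "\<And>B. B \<subseteq> h ` verts F \<Longrightarrow> B \<noteq> {} \<Longrightarrow> (\<forall>x\<in>B. (h v, x) \<in> edges G) \<Longrightarrow> B \<in> blocks G \<longleftrightarrow> B \<in> (`) h ` blocks F"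
    and E: "\<And>w. w \<in> verts F \<Longrightarrow> (h v, h w) \<in> edges G \<longleftrightarrow> (v, w) \<in> edges F"
    and G: "partitioned_forest G"
  shows "{B \<in> child_blocks G (h v). B \<subseteq> h ` verts F} = (`) h ` child_blocks F v"
proof (intro equalityI subsetI)
  fix B assume "B \<in> {B \<in> child_blocks G (h v). B \<subseteq> h ` verts F}"
  then have b: "B \<in> blocks G" "\<forall>x\<in>B. (h v, x) \<in> edges G" "B \<subseteq> h ` verts F"
    by (auto simp: child_blocks_def)
  then obtain C where C: "C \<in> blocks F" "B = h ` C" using B[of B] block_ne[OF G] by blast
  then have "C \<in> child_blocks F v" using b E blocks_subset[OF F C(1)] by (auto simp: child_blocks_def)
  then show "B \<in> (`) h ` child_blocks F v" using C by simp
next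
  fix B assume "B \<in> (`) h ` child_blocks F v"
  then obtain C where C: "C \<in> blocks F" "B = h ` C" "\<forall>x\<in>C. (v, x) \<in> edges F"
    by (auto simp: child_blocks_def)
  have sub: "C \<subseteq> verts F" by (rule blocks_subset[OF F C(1)])
  then have e: "\<forall>x\<in>B. (h v, x) \<in> edges G" using C E by auto
  moreover have "B \<in> blocks G" using B[of B] sub C e block_ne[OF F C(1)] by blast
  ultimately show "B \<in> {B \<in> child_blocks G (h v). B \<subseteq> h ` verts F}"
    using sub C by (auto simp: child_blocks_def)
qed

lemma child_blocks_iso:
  assumes F: "partitioned_forest F" and iso: "forest_iso h F G" and v: "v \<in> verts F"
  shows "child_blocks G (h v) = (`) h ` child_blocks F v"
proof -
  note f = forest_isoD[OF iso]
  have G: "partitioned_forest G" using F iso by (rule iso_partitioned_forest)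
  have E: "(h v, h w) \<in> edges G \<longleftrightarrow> (v, w) \<in> edges F" if w: "w \<in> verts F" for w
  proof
    assume "(h v, h w) \<in> edges G"
    then obtain a b where "(a, b) \<in> edges F" "h v = h a" "h w = h b" using f(3) by auto
    moreover from this have "a \<in> verts F" "b \<in> verts F" using edges_subset[OF F] by auto
    ultimately show "(v, w) \<in> edges F" using v w f(1) by (metis inj_onD)
  next
    assume "(v, w) \<in> edges F"
    then show "(h v, h w) \<in> edges G" unfolding f(3) by (rule map_prod_imageI)
  qed
  have "B \<subseteq> h ` verts F" if "B \<in> child_blocks G (h v)" for B
    using blocks_subset[OF G child_blocksD[OF that]] f(2) by simp
  then have "child_blocks G (h v) = {B \<in> child_blocks G (h v). B \<subseteq> h ` verts F}" by blast
  also have "\<dots> = (`) h ` child_blocks F v"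
    by (intro child_blocks_embed[OF F f(1) v _ E G]) (simp_all add: f(4))
  finally show ?thesis .
qed

text \<open>Merging the root blocks is invisible here: roots have no parent, so neither the removed
  root blocks (\<open>nF\<close>, \<open>nG\<close>) nor the merged block (\<open>no_merge\<close>)
  can be a child block.\<close>

lemma child_blocks_tree_prod:
  fixes F :: "('v, 'd) pforest" and G :: "('w, 'd) pforest"
  assumes "partitioned_tree F" "partitioned_tree G"
  shows "child_blocks (tree_prod F G) (Inl v) = (`) Inl ` child_blocks F v"
    and "child_blocks (tree_prod F G) (Inr w) = (`) Inr ` child_blocks G w"
proof -
  note F = partitioned_tree_forest[OF assms(1)] and G = partitioned_tree_forest[OF assms(2)]
  have nF: "B \<noteq> roots F" if "B \<in> child_blocks F v" for B
    using that block_ne[OF F, of B] by (auto simp: child_blocks_def roots_def)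
  have nG: "B \<noteq> roots G" if "B \<in> child_blocks G w" for B
    using that block_ne[OF G, of B] by (auto simp: child_blocks_def roots_def)
  have split: "B \<in> blocks (tree_prod F G) \<longleftrightarrow> B \<in> (`) Inl ` (blocks F - {roots F}) \<or>
      B \<in> (`) Inr ` (blocks G - {roots G}) \<or> B = roots F <+> roots G \<and> B \<noteq> {}" for B
    by (auto simp: tree_prod_def)
  have no_merge: False if "B = roots F <+> roots G" "B \<noteq> {}" "\<forall>x\<in>B. (u, x) \<in> edges (tree_prod F G)" for B u
    using that unfolding roots_tree_prod[symmetric] by (auto simp: roots_def)
  show "child_blocks (tree_prod F G) (Inl v) = (`) Inl ` child_blocks F v"
  proof (intro equalityI subsetI)
    fix B :: "('v + 'w) set" assume "B \<in> child_blocks (tree_prod F G) (Inl v)"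
    then have B: "B \<in> blocks (tree_prod F G)" "\<forall>x\<in>B. (Inl v, x) \<in> edges (tree_prod F G)"
      by (auto simp: child_blocks_def)
    then have "B \<in> (`) Inl ` blocks F \<or> B \<in> (`) Inr ` blocks G"
      using split[of B] no_merge[of B] by blast
    then consider C where "C \<in> blocks F" "B = Inl ` C" | C where "C \<in> blocks G" "B = Inr ` C"
      by (elim disjE imageE) blast+
    then show "B \<in> (`) Inl ` child_blocks F v"
    proof cases
      case 1
      then show ?thesis using B(2) by (auto simp: child_blocks_def edges_tree_prod)
    next
      case 2
      then show ?thesis using B(2) block_ne[OF G 2(1)] by (auto simp: edges_tree_prod)
    qed
  next
    fix B :: "('v + 'w) set" assume "B \<in> (`) Inl ` child_blocks F v"
    then obtain C where "C \<in> child_blocks F v" "B = Inl ` C" by blast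
    then show "B \<in> child_blocks (tree_prod F G) (Inl v)"
      using nF[of C] by (auto simp: child_blocks_def split edges_tree_prod)
  qed
  show "child_blocks (tree_prod F G) (Inr w) = (`) Inr ` child_blocks G w"
  proof (intro equalityI subsetI)
    fix B :: "('v + 'w) set" assume "B \<in> child_blocks (tree_prod F G) (Inr w)"
    then have B: "B \<in> blocks (tree_prod F G)" "\<forall>x\<in>B. (Inr w, x) \<in> edges (tree_prod F G)"
      by (auto simp: child_blocks_def)
    then have "B \<in> (`) Inl ` blocks F \<or> B \<in> (`) Inr ` blocks G"
      using split[of B] no_merge[of B] by blast
    then consider C where "C \<in> blocks F" "B = Inl ` C" | C where "C \<in> blocks G" "B = Inr ` C"
      by (elim disjE imageE) blast+
    then show "B \<in> (`) Inr ` child_blocks G w"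
    proof cases
      case 1
      then show ?thesis using B(2) block_ne[OF F 1(1)] by (auto simp: edges_tree_prod)
    next
      case 2
      then show ?thesis using B(2) by (auto simp: child_blocks_def edges_tree_prod)
    qed
  next
    fix B :: "('v + 'w) set" assume "B \<in> (`) Inr ` child_blocks G w"
    then obtain C where "C \<in> child_blocks G w" "B = Inr ` C" by blast
    then show "B \<in> child_blocks (tree_prod F G) (Inr w)"
      using nG[of C] by (auto simp: child_blocks_def split edges_tree_prod)
  qed
qed

text \<open>All roots of \<open>G\<close> lie in a single block, so grafting gives \<open>s\<close>
  exactly one further child block. An empty \<open>G\<close> has no root block, hence the condition
  on \<open>verts G\<close>.\<close>

lemma child_blocks_graft:
  fixes F :: "('v, 'd) pforest" and G :: "('w, 'd) pforest"
  assumes F: "partitioned_tree F" and G: "partitioned_tree G" and s: "s \<in> verts F"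
  shows "child_blocks (graft s F G) (Inr w) = (`) Inr ` child_blocks G w" (is ?r)
    and "child_blocks (graft s F G) (Inl v) = (`) Inl ` child_blocks F v \<union>
      (if v = s \<and> verts G \<noteq> {} then {Inr ` roots G} else {})" (is ?l)
proof -
  note F' = partitioned_tree_forest[OF F] and G' = partitioned_tree_forest[OF G]
  have split: "B \<in> blocks (graft s F G) \<longleftrightarrow> B \<in> (`) Inl ` blocks F \<or> B \<in> (`) Inr ` blocks G" for B
    by (auto simp: graft_def)
  show ?r
  proof (intro equalityI subsetI)
    fix B :: "('v + 'w) set" assume "B \<in> child_blocks (graft s F G) (Inr w)"
    then have B: "B \<in> blocks (graft s F G)" "\<forall>x\<in>B. (Inr w, x) \<in> edges (graft s F G)"
      by (auto simp: child_blocks_def)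
    then have "B \<in> (`) Inl ` blocks F \<or> B \<in> (`) Inr ` blocks G"
      by (simp add: split)
    then consider C where "C \<in> blocks F" "B = Inl ` C" | C where "C \<in> blocks G" "B = Inr ` C"
      by (elim disjE imageE) blast+
    then show "B \<in> (`) Inr ` child_blocks G w"
      using B(2) block_ne[OF F'] by cases (auto simp: child_blocks_def edges_graft)
  next
    fix B :: "('v + 'w) set" assume "B \<in> (`) Inr ` child_blocks G w"
    then show "B \<in> child_blocks (graft s F G) (Inr w)"
      by (auto simp: child_blocks_def split edges_graft)
  qed
  have rG: "B = roots G" if "B \<in> blocks G" "B \<subseteq> roots G" for B
    using that block_ne[OF G' that(1)] roots_block[OF G] block_unique[OF G' that(1)] blocks_subset[OF G' that(1)]
    by blast
  have rG': "roots G \<in> blocks G" if "verts G \<noteq> {}" using roots_block[OF G that] .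
  show ?l
  proof (intro equalityI subsetI)
    fix B :: "('v + 'w) set" assume "B \<in> child_blocks (graft s F G) (Inl v)"
    then have B: "B \<in> blocks (graft s F G)" "\<forall>x\<in>B. (Inl v, x) \<in> edges (graft s F G)"
      by (auto simp: child_blocks_def)
    then have "B \<in> (`) Inl ` blocks F \<or> B \<in> (`) Inr ` blocks G"
      by (simp add: split)
    then consider C where "C \<in> blocks F" "B = Inl ` C" | C where "C \<in> blocks G" "B = Inr ` C"
      by (elim disjE imageE) blast+
    then show "B \<in> (`) Inl ` child_blocks F v \<union> (if v = s \<and> verts G \<noteq> {} then {Inr ` roots G} else {})"
    proof cases
      case 1
      then show ?thesis using B(2) by (auto simp: child_blocks_def edges_graft)
    next
      case 2
      obtain x where "x \<in> C" using block_ne[OF G' 2(1)] by blast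
      then have "v = s" using B(2) 2 by (auto simp: edges_graft)
      moreover have "C \<subseteq> roots G" using B(2) 2 by (auto simp: edges_graft)
      ultimately show ?thesis using rG[OF 2(1)] 2 \<open>x \<in> C\<close> roots_subset[of G] by auto
    qed
  next
    fix B :: "('v + 'w) set" assume "B \<in> (`) Inl ` child_blocks F v \<union> (if v = s \<and> verts G \<noteq> {} then {Inr ` roots G} else {})"
    then show "B \<in> child_blocks (graft s F G) (Inl v)"
      using rG' by (auto simp: child_blocks_def split edges_graft split: if_splits)
  qed
qed

section \<open>Evaluation with free extra arguments at every vertex\<close>

context total_com_prelie
begin

abbreviation prs :: "('v \<Rightarrow> 'a) \<Rightarrow> 'v set \<Rightarrow> 'a" where
  "prs e B \<equiv> pr (image_mset e (mset_set B))"

text \<open>\<open>X v\<close> is the multiset of arguments of the brace at \<open>v\<close> that do not come from child blocks.\<close>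

definition ev :: "('v, 'd) pforest \<Rightarrow> ('v \<Rightarrow> 'a) \<Rightarrow> ('v \<Rightarrow> 'a multiset) \<Rightarrow> 'v \<Rightarrow> 'a" where
  "ev F f X = wfrec ((edges F)\<inverse>)
     (\<lambda>e v. brm (f v) (X v + image_mset (prs e) (mset_set (child_blocks F v))))"

lemma ev_unfold:
  assumes F: "partitioned_forest F"
  shows "ev F f X v = brm (f v) (X v + image_mset (prs (ev F f X)) (mset_set (child_blocks F v)))"
proof -
  have "prs (cut (ev F f X) ((edges F)\<inverse>) v) B = prs (ev F f X) B" if "B \<in> child_blocks F v" for B
  proof -
    have "finite B" using finite_block[OF F child_blocksD[OF that]] .
    then show ?thesis
      using that by (intro arg_cong[of _ _ pr] image_mset_cong) (auto simp: child_blocks_def cut_apply)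
  qed
  then have *: "image_mset (prs (cut (ev F f X) ((edges F)\<inverse>) v)) (mset_set (child_blocks F v)) =
      image_mset (prs (ev F f X)) (mset_set (child_blocks F v))"
    using finite_child_blocks[OF F] by (intro image_mset_cong) auto
  have "ev F f X v = brm (f v) (X v + image_mset (prs (cut (ev F f X) ((edges F)\<inverse>) v)) (mset_set (child_blocks F v)))"
    unfolding ev_def by (subst wfrec[OF wf_parents[OF F]]) simp
  then show ?thesis unfolding * .
qed

lemma ev_eqI:
  assumes F: "partitioned_forest F" and v: "v \<in> verts F"
    and e: "\<And>v. v \<in> verts F \<Longrightarrow> e v = brm (f v) (X v + image_mset (prs e) (mset_set (child_blocks F v)))"
  shows "ev F f X v = e v"
  using v
proof (induction v rule: wf_induct_rule[OF wf_parents[OF F]])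
  case (1 v)
  have "prs (ev F f X) B = prs e B" if B: "B \<in> child_blocks F v" for B
  proof -
    have "finite B" "B \<subseteq> verts F"
      using finite_block[OF F child_blocksD[OF B]] blocks_subset[OF F child_blocksD[OF B]] .
    then show ?thesis
      using B by (intro arg_cong[of _ _ pr] image_mset_cong 1) (auto simp: child_blocks_def)
  qed
  then have "image_mset (prs (ev F f X)) (mset_set (child_blocks F v)) =
      image_mset (prs e) (mset_set (child_blocks F v))"
    using finite_child_blocks[OF F] by (intro image_mset_cong) auto
  then show ?case by (subst ev_unfold[OF F]) (simp flip: e[OF 1(2)])
qed

lemma prs_image:
  "inj_on h B \<Longrightarrow> prs e (h ` B) = prs (e \<circ> h) B"
  by (simp flip: image_mset_mset_set add: multiset.map_comp)

text \<open>Compares a forest with a larger one in which \<open>h v\<close> may have child blocks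
  \<open>R\<close> that do not come from \<open>v\<close>; their values are booked as extra
  arguments in \<open>X v\<close>. Isomorphisms and products use an empty \<open>R\<close>; after
  grafting, \<open>R\<close> is the root block of the grafted tree at the vertex
  \<open>s\<close>.\<close>

lemma ev_embed:
  assumes F: "partitioned_forest F" and G: "partitioned_forest G" and inj: "inj_on h (verts F)"
    and f: "\<And>v. v \<in> verts F \<Longrightarrow> f' (h v) = f v"
    and X: "\<And>v. v \<in> verts F \<Longrightarrow>
      \<exists>R. finite R \<and> R \<inter> (`) h ` child_blocks F v = {} \<and> child_blocks G (h v) = R \<union> (`) h ` child_blocks F v \<and>
        X v = X' (h v) + image_mset (prs (ev G f' X')) (mset_set R)"
    and v: "v \<in> verts F"
  shows "ev G f' X' (h v) = ev F f X v"
proof -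
  have "ev F f X v = (ev G f' X' \<circ> h) v"
  proof (rule ev_eqI[OF F v])
    fix v assume v: "v \<in> verts F"
    let ?C = "child_blocks F v"
    obtain R where R: "finite R" "R \<inter> (`) h ` ?C = {}" "child_blocks G (h v) = R \<union> (`) h ` ?C"
        "X v = X' (h v) + image_mset (prs (ev G f' X')) (mset_set R)"
      using X[OF v] by blast
    have C: "B \<subseteq> verts F" if "B \<in> ?C" for B using blocks_subset[OF F child_blocksD[OF that]] .
    then have inj': "inj_on ((`) h) ?C"
      using inj by (auto intro!: inj_onI simp: inj_on_image_eq_iff)
    have fin: "finite ?C" by (rule finite_child_blocks[OF F])
    have "image_mset (prs (ev G f' X')) (mset_set ((`) h ` ?C)) =
        image_mset (prs (ev G f' X') \<circ> (`) h) (mset_set ?C)"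
      by (simp flip: image_mset_mset_set[OF inj'] add: multiset.map_comp)
    also have "\<dots> = image_mset (prs (ev G f' X' \<circ> h)) (mset_set ?C)"
      using fin C inj by (intro image_mset_cong) (auto simp: prs_image inj_on_subset)
    finally have "mset_set (child_blocks G (h v)) = mset_set R + mset_set ((`) h ` ?C) \<and>
       image_mset (prs (ev G f' X')) (mset_set ((`) h ` ?C)) = image_mset (prs (ev G f' X' \<circ> h)) (mset_set ?C)"
      using R fin by (auto simp: mset_set_Union)
    then show "(ev G f' X' \<circ> h) v = brm (f v) (X v + image_mset (prs (ev G f' X' \<circ> h)) (mset_set ?C))"
      using R(4) f[OF v] by (simp add: ev_unfold[OF G, of _ _ "h v"] add.assoc)
  qed
  then show ?thesis by simp
qed

definition phi :: "('v, 'd) pforest \<Rightarrow> ('v \<Rightarrow> 'a) \<Rightarrow> ('v \<Rightarrow> 'a multiset) \<Rightarrow> 'a" where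
  "phi F f X = prs (ev F f X) (roots F)"

lemma prs_cong: "finite B \<Longrightarrow> (\<And>x. x \<in> B \<Longrightarrow> e x = e' x) \<Longrightarrow> prs e B = prs e' B"
  by (intro arg_cong[of _ _ pr] image_mset_cong) auto

lemma prs_image_cong:
  "inj_on h B \<Longrightarrow> finite B \<Longrightarrow> (\<And>x. x \<in> B \<Longrightarrow> e (h x) = e' x) \<Longrightarrow> prs e (h ` B) = prs e' B"
  by (subst prs_image) (auto intro: prs_cong)

lemma phi_iso:
  assumes F: "partitioned_forest F" and iso: "forest_iso h F G"
    and "\<And>v. v \<in> verts F \<Longrightarrow> f' (h v) = f v" "\<And>v. v \<in> verts F \<Longrightarrow> X' (h v) = X v"
  shows "phi G f' X' = phi F f X"
proof -
  have inj: "inj_on h (verts F)" using iso by (rule forest_isoD)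
  have "ev G f' X' (h v) = ev F f X v" if "v \<in> verts F" for v
    using assms(3,4) child_blocks_iso[OF F iso] that
    by (intro ev_embed[OF F iso_partitioned_forest[OF F iso] inj]) (auto intro!: exI[of _ "{}"])
  then show ?thesis
    unfolding phi_def iso_roots[OF F iso]
    using inj_on_subset[OF inj roots_subset] finite_roots[OF F]
    by (intro prs_image_cong) (auto dest: rootsD)
qed

lemma prs_Plus:
  assumes "finite A" "finite B" "\<And>x. x \<in> A \<Longrightarrow> e (Inl x) = g x" "\<And>y. y \<in> B \<Longrightarrow> e (Inr y) = k y"
  shows "prs e (A <+> B) = prs g A \<otimes> prs k B"
proof -
  have "mset_set (A <+> B) = mset_set (Inl ` A) + mset_set (Inr ` B)"
    unfolding Plus_def using assms by (subst mset_set_Union) auto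
  then show ?thesis
    using assms by (simp add: pr_union prs_image_cong[of Inl A e g] prs_image_cong[of Inr B e k])
qed

lemma phi_tree_prod:
  assumes F: "partitioned_tree F" and G: "partitioned_tree G"
  shows "phi (tree_prod F G) (case_sum f f') (case_sum X X') = phi F f X \<otimes> phi G f' X'"
proof -
  note F' = partitioned_tree_forest[OF F] and G' = partitioned_tree_forest[OF G]
    and H = partitioned_tree_forest[OF tree_prod_tree[OF F G]]
  have "ev (tree_prod F G) (case_sum f f') (case_sum X X') (Inl v) = ev F f X v" if "v \<in> verts F" for v
    using that by (intro ev_embed[OF F' H]) (auto simp: child_blocks_tree_prod[OF F G] intro!: exI[of _ "{}"])
  moreover have "ev (tree_prod F G) (case_sum f f') (case_sum X X') (Inr v) = ev G f' X' v" if "v \<in> verts G" for v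
    using that by (intro ev_embed[OF G' H]) (auto simp: child_blocks_tree_prod[OF F G] intro!: exI[of _ "{}"])
  ultimately show ?thesis
    unfolding phi_def roots_tree_prod using finite_roots[OF F'] finite_roots[OF G']
    by (intro prs_Plus) (auto dest: rootsD)
qed

text \<open>The new child block of \<open>s\<close> is the root block of \<open>G\<close>, and the
  product over it is the value of \<open>G\<close>, so grafting amounts to one more argument at
  \<open>s\<close>.\<close>

lemma phi_graft:
  assumes F: "partitioned_tree F" and G: "partitioned_tree G" and s: "s \<in> verts F" and ne: "verts G \<noteq> {}"
  shows "phi (graft s F G) (case_sum f f') (case_sum X X') = phi F f (X(s := add_mset (phi G f' X') (X s)))"
proof -
  note F' = partitioned_tree_forest[OF F] and G' = partitioned_tree_forest[OF G]
    and H = partitioned_tree_forest[OF graft_tree[OF F G s]]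
  let ?e = "ev (graft s F G) (case_sum f f') (case_sum X X')"
  have evG: "?e (Inr v) = ev G f' X' v" if "v \<in> verts G" for v
    using that by (intro ev_embed[OF G' H]) (auto simp: child_blocks_graft[OF F G s] intro!: exI[of _ "{}"])
  have pG: "prs ?e (Inr ` roots G) = phi G f' X'"
    unfolding phi_def using finite_roots[OF G'] evG by (intro prs_image_cong) (auto dest: rootsD)
  have rne: "roots G \<noteq> {}" using roots_block[OF G ne] block_ne[OF G'] by blast
  have disj: "Inr ` roots G \<notin> (`) Inl ` S" for S :: "'v set set" using rne by auto
  have "?e (Inl v) = ev F f (X(s := add_mset (phi G f' X') (X s))) v" if "v \<in> verts F" for v
  proof (rule ev_embed[OF F' H _ _ _ that])
    fix v assume "v \<in> verts F"
    show "\<exists>R. finite R \<and> R \<inter> (`) Inl ` child_blocks F v = {} \<and>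
        child_blocks (graft s F G) (Inl v) = R \<union> (`) Inl ` child_blocks F v \<and>
        (X(s := add_mset (phi G f' X') (X s))) v = case_sum X X' (Inl v) + image_mset (prs ?e) (mset_set R)"
      by (rule exI[of _ "if v = s then {Inr ` roots G} else {}"])
        (simp add: child_blocks_graft[OF F G s] ne pG disj)
  qed auto
  then show ?thesis
    unfolding phi_def[of "graft s F G"] phi_def[of F] roots_graft
    using finite_roots[OF F'] by (intro prs_image_cong) (auto dest: rootsD)
qed

end


section \<open>Subtrees below a vertex\<close>

definition desc :: "('v, 'd) pforest \<Rightarrow> 'v \<Rightarrow> 'v set" where
  "desc F v = {s. (v, s) \<in> (edges F)\<^sup>*}"

lemma desc_refl [simp]: "v \<in> desc F v"
  by (simp add: desc_def)

lemma desc_step: "desc F v = insert v (\<Union>w\<in>{w. (v, w) \<in> edges F}. desc F w)"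
  by (auto simp: desc_def intro: converse_rtrancl_into_rtrancl elim: converse_rtranclE)

lemma desc_child: "(v, w) \<in> edges F \<Longrightarrow> desc F w \<subseteq> desc F v"
  using desc_step[of F v] by blast

lemma desc_subset: "\<lbrakk>partitioned_forest F; v \<in> verts F\<rbrakk> \<Longrightarrow> desc F v \<subseteq> verts F"
proof
  fix s assume F: "partitioned_forest F" and v: "v \<in> verts F" and "s \<in> desc F v"
  then have "(v, s) \<in> (edges F)\<^sup>*" by (simp add: desc_def)
  then show "s \<in> verts F"
    using v edges_subset[OF F] by (induction rule: rtrancl_induct) auto
qed

lemma finite_desc: "\<lbrakk>partitioned_forest F; v \<in> verts F\<rbrakk> \<Longrightarrow> finite (desc F v)"
  by (rule finite_subset[OF desc_subset partitioned_forestD(1)])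

lemma not_desc_child:
  assumes F: "partitioned_forest F" and "(v, w) \<in> edges F"
  shows "v \<notin> desc F w"
proof
  assume "v \<in> desc F w"
  then have "(v, v) \<in> (edges F)\<^sup>+" using assms(2) by (auto simp: desc_def)
  then show False using partitioned_forestD(3)[OF F] by (simp add: acyclic_def)
qed

text \<open>Parents are unique, so two ancestors of a common vertex are comparable. If
  \<open>y\<close> lies properly below \<open>x\<close>, then \<open>y\<close> is not a root, and a
  common parent of both would lie on a cycle.\<close>

lemma desc_disjoint:
  assumes F: "partitioned_forest F" and ne: "w \<noteq> w'"
    and sib: "w \<in> roots F \<and> w' \<in> roots F \<or> (\<exists>v. (v, w) \<in> edges F \<and> (v, w') \<in> edges F)"
  shows "desc F w \<inter> desc F w' = {}"
proof (rule ccontr)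
  assume "desc F w \<inter> desc F w' \<noteq> {}"
  then obtain s where s: "(w, s) \<in> (edges F)\<^sup>*" "(w', s) \<in> (edges F)\<^sup>*" by (auto simp: desc_def)
  have "(w, w') \<in> (edges F)\<^sup>* \<or> (w', w) \<in> (edges F)\<^sup>*"
    using single_valued_confluent[OF partitioned_forestD(4)[OF F], of s w w'] s
    by (auto simp: rtrancl_converse)
  moreover have False if sib: "x \<in> roots F \<and> y \<in> roots F \<or> (\<exists>v. (v, x) \<in> edges F \<and> (v, y) \<in> edges F)"
    and xy: "(x, y) \<in> (edges F)\<^sup>*" "x \<noteq> y" for x y
  proof -
    obtain u where u: "(x, u) \<in> (edges F)\<^sup>*" "(u, y) \<in> edges F" using xy by (meson rtranclE)
    then have "y \<notin> roots F" by (auto simp: roots_def)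
    then obtain v where v: "(v, x) \<in> edges F" "(v, y) \<in> edges F" using sib by blast
    then have "v = u" using parent_unique[OF F] u by blast
    then have "(v, v) \<in> (edges F)\<^sup>+" using v u by auto
    then show False using partitioned_forestD(3)[OF F] by (simp add: acyclic_def)
  qed
  ultimately show False using sib ne by metis
qed

lemma below_root:
  assumes F: "partitioned_forest F" and v: "v \<in> verts F"
  shows "\<exists>r\<in>roots F. v \<in> desc F r"
proof -
  have "wf (edges F)"
    using partitioned_forestD(1,2,3)[OF F] by (intro finite_acyclic_wf) (auto intro: finite_subset)
  then show ?thesis using v
  proof (induction v rule: wf_induct_rule)
    case (less v)
    show ?case
    proof (cases "v \<in> roots F")
      case True
      then show ?thesis by (intro bexI[of _ v]) simp_all
    next
      case False
      then obtain u where u: "(u, v) \<in> edges F" using less.prems by (auto simp: roots_def)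
      then have "u \<in> verts F" using edges_subset[OF F] by auto
      from less.IH[OF u this] u show ?thesis by (auto simp: desc_def intro: rtrancl_into_rtrancl)
    qed
  qed
qed

lemma Union_desc_roots:
  assumes F: "partitioned_forest F"
  shows "(\<Union>r\<in>roots F. desc F r) = verts F"
  using below_root[OF F] desc_subset[OF F] roots_subset[of F] by blast

section \<open>Insertion at all vertices realises the action of an element\<close>

context total_com_prelie
begin

lemma ev_cong:
  assumes F: "partitioned_forest F" and X: "\<And>s. s \<in> desc F v \<Longrightarrow> X s = Y s"
  shows "ev F f X v = ev F f Y v"
  using X
proof (induction v rule: wf_induct_rule[OF wf_parents[OF F]])
  case (1 v)
  have "prs (ev F f X) B = prs (ev F f Y) B" if B: "B \<in> child_blocks F v" for B
  proof (rule prs_cong)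
    show "finite B" using finite_block[OF F child_blocksD[OF B]] .
    fix w assume "w \<in> B"
    then have vw: "(v, w) \<in> edges F" using B by (simp add: child_blocks_def)
    show "ev F f X w = ev F f Y w"
    proof (rule 1(1))
      show "(w, v) \<in> (edges F)\<inverse>" using vw by simp
      show "X s = Y s" if "s \<in> desc F w" for s using that 1(2) desc_child[OF vw] by blast
    qed
  qed
  then have "image_mset (prs (ev F f X)) (mset_set (child_blocks F v)) =
      image_mset (prs (ev F f Y)) (mset_set (child_blocks F v))"
    using finite_child_blocks[OF F] by (intro image_mset_cong) auto
  then show ?case using 1(2)[OF desc_refl] by (simp add: ev_unfold[OF F, of _ _ v])
qed

lemma prs_remove: "finite B \<Longrightarrow> w \<in> B \<Longrightarrow> prs e B = e w \<otimes> prs e (B - {w})"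
  by (simp add: mset_set.remove)

lemma prs_bul:
  assumes B: "finite B"
  shows "prs e B \<lhd> c = (\<Sum>w\<in>B. (e w \<lhd> c) \<otimes> prs e (B - {w}))"
proof -
  have "prs e B \<lhd> c = (\<Sum>w\<in>B. (e w \<lhd> c) \<otimes> pr (image_mset e (mset_set B) - {#e w#}))"
    by (simp add: pr_bul sum_unfold_sum_mset multiset.map_comp comp_def)
  also have "\<dots> = (\<Sum>w\<in>B. (e w \<lhd> c) \<otimes> prs e (B - {w}))"
    using B by (intro sum.cong refl) (simp add: mset_set.remove)
  finally show ?thesis .
qed

text \<open>The subtrees at the vertices of \<open>B\<close> are disjoint, so an insertion touches
  one factor of the product. Additivity gathers the insertions in the subtree at \<open>w\<close>
  into the factor of \<open>w\<close>, and \<open>prs_bul\<close> recognises the result.\<close>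

lemma sum_insert_prs:
  assumes F: "partitioned_forest F" and B: "B \<subseteq> verts F"
    and disj: "\<And>w w'. w \<in> B \<Longrightarrow> w' \<in> B \<Longrightarrow> w \<noteq> w' \<Longrightarrow> desc F w \<inter> desc F w' = {}"
    and der: "\<And>w. w \<in> B \<Longrightarrow> (\<Sum>s\<in>desc F w. ev F f (X(s := add_mset c (X s))) w) = ev F f X w \<lhd> c"
  shows "(\<Sum>s\<in>(\<Union>w\<in>B. desc F w). prs (ev F f (X(s := add_mset c (X s)))) B) = prs (ev F f X) B \<lhd> c"
proof -
  have fin: "finite B" using B partitioned_forestD(1)[OF F] finite_subset by blast
  let ?X = "\<lambda>s. X(s := add_mset c (X s))"
  have "(\<Sum>s\<in>(\<Union>w\<in>B. desc F w). prs (ev F f (?X s)) B) = (\<Sum>w\<in>B. \<Sum>s\<in>desc F w. prs (ev F f (?X s)) B)"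
    using fin B disj finite_desc[OF F] by (intro sum.UNION_disjoint) auto
  also have "\<dots> = (\<Sum>w\<in>B. (ev F f X w \<lhd> c) \<otimes> prs (ev F f X) (B - {w}))"
  proof (rule sum.cong[OF refl])
    fix w assume w: "w \<in> B"
    have "prs (ev F f (?X s)) B = ev F f (?X s) w \<otimes> prs (ev F f X) (B - {w})" if s: "s \<in> desc F w" for s
    proof -
      have "prs (ev F f (?X s)) (B - {w}) = prs (ev F f X) (B - {w})"
        using fin disj[of w] w s by (intro prs_cong ev_cong[OF F]) auto
      then show ?thesis by (simp add: prs_remove[OF fin w])
    qed
    then have "(\<Sum>s\<in>desc F w. prs (ev F f (?X s)) B) =
        (\<Sum>s\<in>desc F w. ev F f (?X s) w) \<otimes> prs (ev F f X) (B - {w})"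
      by (simp add: dot_left.sum)
    then show "(\<Sum>s\<in>desc F w. prs (ev F f (?X s)) B) = (ev F f X w \<lhd> c) \<otimes> prs (ev F f X) (B - {w})"
      by (simp add: der[OF w])
  qed
  finally show ?thesis by (simp add: prs_bul[OF fin])
qed

text \<open>Insertions are matched with the terms of \<open>brm_bul\<close>: inserting at
  \<open>v\<close> itself gives the new argument \<open>c\<close>, inserting in the subtrees at a
  child block \<open>B\<close> gives the term in which \<open>c\<close> acts on the product over
  \<open>B\<close>, and the terms of the extra arguments vanish by hypothesis.\<close>

lemma sum_insert_ev:
  assumes F: "partitioned_forest F" and v: "v \<in> verts F"
    and X: "\<And>v x. x \<in># X v \<Longrightarrow> x \<lhd> c = 0"
  shows "(\<Sum>s\<in>desc F v. ev F f (X(s := add_mset c (X s))) v) = ev F f X v \<lhd> c"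
  using v
proof (induction v rule: wf_induct_rule[OF wf_parents[OF F]])
  case (1 v)
  let ?X = "\<lambda>s. X(s := add_mset c (X s))" and ?C = "child_blocks F v"
  let ?P = "prs (ev F f X)" and ?U = "\<lambda>B. \<Union>w\<in>B. desc F w"
  have finC: "finite ?C" by (rule finite_child_blocks[OF F])
  have edge: "(v, w) \<in> edges F" if "B \<in> ?C" "w \<in> B" for B w
    using that by (simp add: child_blocks_def)
  have finB: "finite B" and subB: "B \<subseteq> verts F" if "B \<in> ?C" for B
    using finite_block[OF F child_blocksD[OF that]] blocks_subset[OF F child_blocksD[OF that]] .
  have finU: "finite (?U B)" if "B \<in> ?C" for B
    using finB[OF that] subB[OF that] finite_desc[OF F] by blast
  have disj: "desc F w \<inter> desc F w' = {}" if "B \<in> ?C" "B' \<in> ?C" "w \<in> B" "w' \<in> B'" "w \<noteq> w'" for B B' w w'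
    using desc_disjoint[OF F that(5)] edge[OF that(1,3)] edge[OF that(2,4)] by blast
  have disjU: "?U B \<inter> ?U B' = {}" if "B \<in> ?C" "B' \<in> ?C" "B \<noteq> B'" for B B'
  proof -
    have "w \<noteq> w'" if "w \<in> B" "w' \<in> B'" for w w'
      using block_unique[OF F child_blocksD[OF \<open>B \<in> ?C\<close>] child_blocksD[OF \<open>B' \<in> ?C\<close>]] \<open>B \<noteq> B'\<close> that by blast
    then show ?thesis using disj[OF that(1,2)] by blast
  qed
  have notin: "v \<notin> ?U B" if "B \<in> ?C" for B
    using not_desc_child[OF F edge[OF that]] by blast
  have desc: "desc F v = insert v (\<Union>B\<in>?C. ?U B)"
  proof -
    have "desc F v = insert v (\<Union>w\<in>\<Union>?C. desc F w)"
      unfolding Union_child_blocks[OF F] by (rule desc_step)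
    then show ?thesis by blast
  qed
  have P: "prs (ev F f (?X s)) B = ?P B" if "B \<in> ?C" "s \<notin> ?U B" for s B
    using that finB[OF that(1)] by (intro prs_cong ev_cong[OF F]) auto
  have "ev F f (?X v) v = brm (f v) (add_mset c (X v) + image_mset ?P (mset_set ?C))"
  proof -
    have "image_mset (prs (ev F f (?X v))) (mset_set ?C) = image_mset ?P (mset_set ?C)"
      using finC P notin by (intro image_mset_cong) auto
    then show ?thesis by (simp add: ev_unfold[OF F, of _ _ v])
  qed
  moreover have "(\<Sum>s\<in>?U B. ev F f (?X s) v) =
      brm (f v) (add_mset (?P B \<lhd> c) (X v + image_mset ?P (mset_set (?C - {B}))))" if B: "B \<in> ?C" for B
  proof -
    have "ev F f (?X s) v =
        brm (f v) (add_mset (prs (ev F f (?X s)) B) (X v + image_mset ?P (mset_set (?C - {B}))))"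
      if s: "s \<in> ?U B" for s
    proof -
      have "image_mset (prs (ev F f (?X s))) (mset_set (?C - {B})) = image_mset ?P (mset_set (?C - {B}))"
        using finC s disjU[OF B] by (intro image_mset_cong P) auto
      moreover have "s \<noteq> v" using notin[OF B] s by blast
      ultimately show ?thesis
        by (simp add: ev_unfold[OF F, of _ _ v] mset_set.remove[OF finC B])
    qed
    \<comment> \<open>Only the argument belonging to \<open>B\<close> varies with \<open>s\<close>;
      additivity of the brace moves the sum into that argument.\<close>
    then have "(\<Sum>s\<in>?U B. ev F f (?X s) v) =
        brm (f v) (add_mset (\<Sum>s\<in>?U B. prs (ev F f (?X s)) B) (X v + image_mset ?P (mset_set (?C - {B}))))"
      by (simp add: brm.sum)
    also have "(\<Sum>s\<in>?U B. prs (ev F f (?X s)) B) = ?P B \<lhd> c"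
    proof (rule sum_insert_prs[OF F subB[OF B] disj[OF B B]])
      show "(\<Sum>s\<in>desc F w. ev F f (?X s) w) = ev F f X w \<lhd> c" if "w \<in> B" for w
        by (rule 1(1)) (use edge[OF B that] subB[OF B] that in blast)+
    qed
    finally show ?thesis .
  qed
  moreover have "(\<Sum>s\<in>desc F v. ev F f (?X s) v) = ev F f (?X v) v + (\<Sum>B\<in>?C. \<Sum>s\<in>?U B. ev F f (?X s) v)"
  proof -
    have "v \<notin> (\<Union>B\<in>?C. ?U B)" "finite (\<Union>B\<in>?C. ?U B)" using notin finC finU by blast+
    then have "(\<Sum>s\<in>desc F v. ev F f (?X s) v) = ev F f (?X v) v + (\<Sum>s\<in>(\<Union>B\<in>?C. ?U B). ev F f (?X s) v)"
      unfolding desc by (rule sum.insert[rotated])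
    then show ?thesis using finC finU disjU by (subst (asm) sum.UNION_disjoint) auto
  qed
  moreover have "ev F f X v \<lhd> c = brm (f v) (add_mset c (X v) + image_mset ?P (mset_set ?C)) +
      (\<Sum>B\<in>?C. brm (f v) (add_mset (?P B \<lhd> c) (X v + image_mset ?P (mset_set (?C - {B})))))"
  proof -
    let ?M = "X v + image_mset ?P (mset_set ?C)"
    \<comment> \<open>Here \<open>x \<lhd> c\<close> is \<open>0\<close>, and a brace with a zero
      argument vanishes by additivity.\<close>
    have "(\<Sum>x\<in>#X v. brm (f v) (add_mset (x \<lhd> c) (?M - {#x#}))) = (\<Sum>x\<in>#X v. 0)"
      using X[of _ v] by (intro arg_cong[of _ _ sum_mset] image_mset_cong) (simp add: brm.zero)
    moreover have "(\<Sum>x\<in>#image_mset ?P (mset_set ?C). brm (f v) (add_mset (x \<lhd> c) (?M - {#x#}))) =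
        (\<Sum>B\<in>?C. brm (f v) (add_mset (?P B \<lhd> c) (?M - {#?P B#})))"
      by (simp add: sum_unfold_sum_mset multiset.map_comp comp_def)
    moreover have "?M - {#?P B#} = X v + image_mset ?P (mset_set (?C - {B}))" if "B \<in> ?C" for B
      by (simp add: mset_set.remove[OF finC that])
    ultimately show ?thesis by (simp add: ev_unfold[OF F, of _ _ v] brm_bul)
  qed
  ultimately show ?case by (simp only: cong: sum.cong)
qed

text \<open>The set of roots is treated like a child block: the subtrees at the roots partition the
  vertices.\<close>

lemma sum_insert_phi:
  assumes F: "partitioned_forest F" and X: "\<And>v x. x \<in># X v \<Longrightarrow> x \<lhd> c = 0"
  shows "(\<Sum>s\<in>verts F. phi F f (X(s := add_mset c (X s)))) = phi F f X \<lhd> c"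
  unfolding phi_def Union_desc_roots[OF F, symmetric]
  using desc_disjoint[OF F] by (intro sum_insert_prs[OF F roots_subset] sum_insert_ev[OF F _ X]) (auto dest: rootsD)

end


section \<open>Isomorphism classes of trees with arbitrary vertices\<close>

text \<open>Any countable vertex type is allowed, so the sum types produced by \<open>graft\<close>
  and \<open>tree_prod\<close> can be used directly; the renumbering by \<open>sum_encode\<close> is
  met only when the lifted operations are unfolded.\<close>

definition cls :: "('v::countable, 'd) pforest \<Rightarrow> 'd upt" where
  "cls F = abs_upt (relabel to_nat F)"

lemma to_nat_iso: "forest_iso to_nat F (relabel to_nat F)"
  by (rule relabel_iso) simp

text \<open>Independence of the numbering: it identifies the class of a lifted operation, however
  its vertices were renumbered.\<close>

lemma abs_upt_eq_cls:
  assumes F: "partitioned_tree F" and h: "forest_iso h F G"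
  shows "abs_upt G = cls F"
proof -
  obtain k where "forest_iso k (relabel to_nat F) F"
    using forest_iso_sym[OF partitioned_tree_forest[OF F] to_nat_iso] by blast
  from forest_iso_trans[OF this h] show ?thesis
    unfolding cls_def
    by (intro abs_upt_eqI[symmetric] tree_equivI[OF iso_partitioned_tree[OF F to_nat_iso]])
qed

lemma cls_eqI:
  assumes "partitioned_tree F" "forest_iso h F G"
  shows "cls G = cls F"
  unfolding cls_def[of G] by (rule abs_upt_eq_cls[OF assms(1) forest_iso_trans[OF assms(2) to_nat_iso]])

lemma cls_exists:
  fixes T :: "'d upt"
  obtains F :: "(nat, 'd) pforest" where "partitioned_tree F" "T = cls F"
proof -
  have "tree_equiv (rep_upt T) (rep_upt T)" "abs_upt (rep_upt T) = T"
    using Quotient3_rep_reflp[OF Quotient3_upt] Quotient3_abs_rep[OF Quotient3_upt] by blast+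
  then have "partitioned_tree (rep_upt T)" "T = cls (rep_upt T)"
    using abs_upt_eq_cls[of "rep_upt T", OF _ forest_iso_refl] by (simp_all add: tree_equiv_def)
  then show thesis by (rule that)
qed

text \<open>Size, branching and evaluation of a class are defined through the representative
  \<open>rep_upt\<close>; this isomorphism carries them over to any convenient forest.\<close>

lemma rep_cls:
  assumes "partitioned_tree F"
  shows "\<exists>h. forest_iso h F (rep_upt (cls F))"
proof -
  have "tree_equiv (rep_upt (cls F)) (relabel to_nat F)"
    unfolding cls_def
    by (intro rep_abs_rsp_left[OF Quotient3_upt] tree_equiv_refl iso_partitioned_tree[OF assms to_nat_iso])
  then obtain k where k: "partitioned_tree (rep_upt (cls F))" "forest_iso k (rep_upt (cls F)) (relabel to_nat F)"
    unfolding tree_equiv_def by blast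
  from forest_iso_trans[OF to_nat_iso forest_iso_sym[OF partitioned_tree_forest[OF k(1)] k(2)]]
  show ?thesis by blast
qed

lemma tree_equiv_relabel: "partitioned_tree F \<Longrightarrow> tree_equiv (relabel to_nat F) (relabel to_nat F)"
  by (intro tree_equiv_refl iso_partitioned_tree[OF _ to_nat_iso])

lemma empty_tree_cls: "(empty_tree :: 'd upt) = cls (empty_forest :: ('v::countable, 'd) pforest)"
  unfolding empty_tree_def
  by (rule abs_upt_eq_cls[OF empty_forest_tree, where h = "\<lambda>_. 0"]) (simp add: forest_iso_def empty_forest_def bij_betw_def)

lemma tau_cls: "tau p = cls (single_vertex v p)"
  unfolding tau.abs_eq
  by (rule abs_upt_eq_cls[OF single_vertex_tree, where h = "\<lambda>_. 0"]) (simp add: forest_iso_def single_vertex_def)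

lemma upt_decos_cls: "partitioned_tree F \<Longrightarrow> upt_decos (cls F) = deco F ` verts F"
  unfolding cls_def using forest_isoD(2,5)[OF to_nat_iso[of F]]
  by (subst upt_decos.abs_eq[OF tree_equiv_relabel]) (simp_all add: image_image)

lemma upt_prod_cls:
  assumes F: "partitioned_tree F" and G: "partitioned_tree G"
  shows "upt_prod (cls F) (cls G) = cls (tree_prod F G)"
  unfolding cls_def[of F] cls_def[of G] upt_prod.abs_eq[OF tree_equiv_relabel[OF F] tree_equiv_relabel[OF G]]
  by (rule abs_upt_eq_cls[OF tree_prod_tree[OF F G] forest_iso_trans[OF tree_prod_iso renumber_iso]])
    (rule F G to_nat_iso)+

text \<open>Unifies the two cases of the product: inserting the empty tree at \<open>s\<close> means
  raising the decoration of \<open>s\<close>.\<close>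

definition ins_class :: "'v::countable \<Rightarrow> ('v, 'd) pforest \<Rightarrow> ('w::countable, 'd) pforest \<Rightarrow> 'd upt" where
  "ins_class s F G = (if verts G \<noteq> {} then cls (graft s F G) else cls (bump s F))"

lemma upt_bul_cls:
  fixes F :: "('v::countable, 'd) pforest" and G :: "('w::countable, 'd) pforest"
  assumes F: "partitioned_tree F" and G: "partitioned_tree G"
  shows "upt_bul (cls F) (cls G) =
    (\<Sum>s\<in>verts F. basis (ins_class s F G) :: 'd upt \<Rightarrow>\<^sub>0 'k::field_char_0)"
proof -
  let ?F = "relabel to_nat F" and ?G = "relabel to_nat G"
  note f = forest_isoD[OF to_nat_iso[of F]] and g = forest_isoD[OF to_nat_iso[of G]]
  have reindex: "(\<Sum>s\<in>verts ?F. h s) = (\<Sum>s\<in>verts F. h (to_nat s))" for h :: "nat \<Rightarrow> 'd upt \<Rightarrow>\<^sub>0 'k"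
    unfolding f(2) using sum.reindex[OF f(1), of h] by simp
  have 1: "abs_upt (relabel sum_encode (graft (to_nat s) ?F ?G)) = cls (graft s F G)" if "s \<in> verts F" for s
    by (rule abs_upt_eq_cls[OF graft_tree[OF F G that]
          forest_iso_trans[OF graft_iso[OF F to_nat_iso G to_nat_iso] renumber_iso]])
  have 2: "abs_upt (bump (to_nat s) ?F) = cls (bump s F)" if "s \<in> verts F" for s
    by (rule abs_upt_eq_cls[OF bump_tree[OF F] bump_iso[OF to_nat_iso that]])
  have ne: "verts ?G = {} \<longleftrightarrow> verts G = {}" by (simp add: g(2))
  have "upt_bul (abs_upt ?F) (abs_upt ?G) =
      (\<Sum>s\<in>verts F. basis (ins_class s F G) :: 'd upt \<Rightarrow>\<^sub>0 'k)"
    unfolding upt_bul.abs_eq[OF tree_equiv_relabel[OF F] tree_equiv_relabel[OF G]] reindex ne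
    by (auto simp: 1 2 ins_class_def intro!: sum.cong)
  then show ?thesis by (simp add: cls_def)
qed

section \<open>Isomorphisms relating products, grafts and decorations\<close>

lemma forest_iso_imageI:
  assumes "inj h" "verts G = h ` verts F" "edges G = map_prod h h ` edges F"
    "blocks G = (`) h ` blocks F" "\<And>x. x \<in> verts F \<Longrightarrow> deco G (h x) = deco F x"
  shows "forest_iso h F G"
  using assms by (intro forest_isoI) (auto intro: inj_on_subset)

lemma image_comp_image: "(`) h \<circ> (`) k = (`) (h \<circ> k)"
  by (simp add: fun_eq_iff image_comp)

lemma blocks_tree_prod:
  "blocks (tree_prod F G) = (`) Inl ` (blocks F - {roots F}) \<union> (`) Inr ` (blocks G - {roots G})
     \<union> ({roots F <+> roots G} - {{}})"
  by (simp add: tree_prod_def)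

text \<open>Needed for iterated products: the block created by the inner product is its root block,
  which the outer product removes before merging again.\<close>

lemma nonroot_blocks_tree_prod:
  "blocks (tree_prod F G) - {roots (tree_prod F G)} =
     (`) Inl ` (blocks F - {roots F}) \<union> (`) Inr ` (blocks G - {roots G})"
proof -
  have "Inl ` C \<noteq> roots F <+> roots G" if "C \<noteq> roots F" for C
    using that by (auto simp: Plus_def)
  moreover have "Inr ` C \<noteq> roots F <+> roots G" if "C \<noteq> roots G" for C
    using that by (auto simp: Plus_def)
  ultimately show ?thesis unfolding blocks_tree_prod roots_tree_prod by blast
qed

text \<open>The hypothesis on \<open>H\<close> keeps its blocks apart from the copy of
  \<open>roots F\<close>, which may be empty.\<close>

lemma nonroot_blocks_graft:
  fixes F :: "('v, 'd) pforest" and H :: "('w, 'd) pforest"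
  assumes "{} \<notin> blocks H"
  shows "blocks (graft s F H) - {roots (graft s F H)} =
     (`) Inl ` (blocks F - {roots F}) \<union> (`) Inr ` blocks H"
proof -
  have "(`) Inl ` blocks F - {Inl ` roots F :: ('v + 'w) set} = (`) Inl ` (blocks F - {roots F})"
    by (auto simp: inj_image_eq_iff)
  moreover have "Inr ` C \<noteq> (Inl ` roots F :: ('v + 'w) set)" if "C \<in> blocks H" for C
    using that assms by (metis Inl_Inr_False all_not_in_conv image_iff)
  then have "(Inl ` roots F :: ('v + 'w) set) \<notin> (`) Inr ` blocks H" by force
  ultimately show ?thesis
    unfolding roots_graft unfolding graft_def pforest.simps Un_Diff by simp
qed

fun sum_assoc :: "('a + 'b) + 'c \<Rightarrow> 'a + ('b + 'c)" where
  "sum_assoc (Inl (Inl a)) = Inl a"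
| "sum_assoc (Inl (Inr b)) = Inr (Inl b)"
| "sum_assoc (Inr c) = Inr (Inr c)"

fun sum_swap :: "'a + 'b \<Rightarrow> 'b + 'a" where
  "sum_swap (Inl a) = Inr a"
| "sum_swap (Inr b) = Inl b"

text \<open>Exchanges the second and third summand, the change of vertex set when two operations on
  \<open>F\<close> are performed in the other order.\<close>

fun sum_exchange :: "('a + 'b) + 'c \<Rightarrow> ('a + 'c) + 'b" where
  "sum_exchange (Inl (Inl a)) = Inl (Inl a)"
| "sum_exchange (Inl (Inr b)) = Inr b"
| "sum_exchange (Inr c) = Inl (Inr c)"

lemma inj_sum_assoc: "inj sum_assoc"
  by (rule injI) (auto elim!: sum_assoc.elims)

lemma inj_sum_swap: "inj sum_swap"
  by (rule injI) (auto elim!: sum_swap.elims)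

lemma inj_sum_exchange: "inj sum_exchange"
  by (rule injI) (auto elim!: sum_exchange.elims)

lemma sum_maps_comp:
  "sum_assoc \<circ> Inr = Inr \<circ> Inr" "sum_assoc \<circ> Inl \<circ> Inl = Inl" "sum_assoc \<circ> Inl \<circ> Inr = Inr \<circ> Inl"
  "sum_swap \<circ> Inl = Inr" "sum_swap \<circ> Inr = Inl"
  "sum_exchange \<circ> Inr = Inl \<circ> Inr" "sum_exchange \<circ> Inl \<circ> Inl = Inl \<circ> Inl" "sum_exchange \<circ> Inl \<circ> Inr = Inr"
  "sum_assoc \<circ> (Inl \<circ> Inl) = Inl" "sum_assoc \<circ> (Inl \<circ> Inr) = Inr \<circ> Inl"
  "sum_exchange \<circ> (Inl \<circ> Inl) = Inl \<circ> Inl" "sum_exchange \<circ> (Inl \<circ> Inr) = Inr"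
  "sum_assoc \<circ> (\<lambda>x. Inl (Inl x)) = Inl" "sum_assoc \<circ> (\<lambda>x. Inl (Inr x)) = Inr \<circ> Inl"
  "sum_exchange \<circ> (\<lambda>x. Inl (Inl x)) = Inl \<circ> Inl" "sum_exchange \<circ> (\<lambda>x. Inl (Inr x)) = Inr"
  by (simp_all add: fun_eq_iff)

lemma sum_maps_Plus:
  "sum_assoc ` ((A <+> B) <+> C) = A <+> (B <+> C)"
  "sum_swap ` (A <+> B) = B <+> A"
  "sum_exchange ` ((A <+> B) <+> C) = (A <+> C) <+> B"
  by (simp_all add: Plus_def image_Un image_image Un_ac)

lemma sum_exchange_Inl: "(\<lambda>x. sum_exchange (Inl x)) ` (A <+> B) = Inl ` A <+> B"
  by (simp add: Plus_def image_Un image_image)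

lemma image_diff_empty: "(`) h ` ({B} - {{}}) = {h ` B} - {{}}"
  by auto

lemma edges_tree_prod_eq: "edges (tree_prod F G) = map_prod Inl Inl ` edges F \<union> map_prod Inr Inr ` edges G"
  by (simp add: tree_prod_def)

lemma edges_graft_eq:
  "edges (graft s F G) = map_prod Inl Inl ` edges F \<union> map_prod Inr Inr ` edges G \<union> {Inl s} \<times> Inr ` roots G"
  by (simp add: graft_def)

lemma blocks_graft: "blocks (graft s F G) = (`) Inl ` blocks F \<union> (`) Inr ` blocks G"
  by (simp add: graft_def)

lemma deco_graft_tree_prod [simp]:
  "deco (tree_prod F G) = case_sum (deco F) (deco G)" "deco (graft s F G) = case_sum (deco F) (deco G)"
  by (simp_all add: tree_prod_def graft_def)

lemmas forest_image_simps =
  image_Un image_comp map_prod_compose[symmetric] image_comp_image sum_maps_comp image_Times_map_prod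

lemma tree_prod_assoc: "forest_iso sum_assoc (tree_prod (tree_prod F G) H) (tree_prod F (tree_prod G H))"
proof (rule forest_iso_imageI[OF inj_sum_assoc])
  show "verts (tree_prod F (tree_prod G H)) = sum_assoc ` verts (tree_prod (tree_prod F G) H)"
    by (simp add: verts_tree_prod sum_maps_Plus)
  show "edges (tree_prod F (tree_prod G H)) = map_prod sum_assoc sum_assoc ` edges (tree_prod (tree_prod F G) H)"
    by (simp add: edges_tree_prod_eq forest_image_simps Un_ac)
  show "blocks (tree_prod F (tree_prod G H)) = (`) sum_assoc ` blocks (tree_prod (tree_prod F G) H)"
    unfolding blocks_tree_prod[of F "tree_prod G H"] blocks_tree_prod[of "tree_prod F G" H] nonroot_blocks_tree_prod
      image_Un image_diff_empty
    by (simp add: forest_image_simps roots_tree_prod sum_maps_Plus Un_ac)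
  show "deco (tree_prod F (tree_prod G H)) (sum_assoc x) = deco (tree_prod (tree_prod F G) H) x" for x
    by (cases x rule: sum_assoc.cases) simp_all
qed

lemma tree_prod_swap: "forest_iso sum_swap (tree_prod F G) (tree_prod G F)"
proof (rule forest_iso_imageI[OF inj_sum_swap])
  show "verts (tree_prod G F) = sum_swap ` verts (tree_prod F G)"
    by (simp add: verts_tree_prod sum_maps_Plus)
  show "edges (tree_prod G F) = map_prod sum_swap sum_swap ` edges (tree_prod F G)"
    by (simp add: edges_tree_prod_eq forest_image_simps Un_ac)
  show "blocks (tree_prod G F) = (`) sum_swap ` blocks (tree_prod F G)"
    unfolding blocks_tree_prod image_Un image_diff_empty by (simp add: forest_image_simps sum_maps_Plus Un_ac)
  show "deco (tree_prod G F) (sum_swap x) = deco (tree_prod F G) x" for x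
    by (cases x) simp_all
qed

lemma tree_prod_empty:
  assumes F: "partitioned_tree F"
  shows "forest_iso Inr F (tree_prod empty_forest F)"
proof (rule forest_iso_imageI)
  have "roots F \<in> blocks F \<or> roots F = {}" using roots_block[OF F] tree_verts_empty[OF F] by blast
  moreover have "{} \<notin> blocks F" using block_ne[OF partitioned_tree_forest[OF F]] by blast
  ultimately show "blocks (tree_prod empty_forest F) = (`) Inr ` blocks F"
    unfolding blocks_tree_prod by (auto simp: empty_forest_def roots_def Plus_def)
qed (auto simp: verts_tree_prod edges_tree_prod_eq empty_forest_def)

text \<open>Grafting keeps the roots of \<open>F\<close>, so the new child block of \<open>s\<close>
  and the merging of root blocks do not interfere.\<close>

lemma graft_tree_prod:
  assumes H: "partitioned_tree H"
  shows "forest_iso sum_exchange (graft (Inl s) (tree_prod F G) H) (tree_prod (graft s F H) G)"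
proof (rule forest_iso_imageI[OF inj_sum_exchange])
  have ne: "{} \<notin> blocks H" using block_ne[OF partitioned_tree_forest[OF H]] by blast
  show "verts (tree_prod (graft s F H) G) = sum_exchange ` verts (graft (Inl s) (tree_prod F G) H)"
    by (simp add: verts_tree_prod verts_graft sum_maps_Plus)
  show "edges (tree_prod (graft s F H) G) = map_prod sum_exchange sum_exchange ` edges (graft (Inl s) (tree_prod F G) H)"
    by (simp add: edges_tree_prod_eq edges_graft_eq forest_image_simps Un_ac)
  show "blocks (tree_prod (graft s F H) G) = (`) sum_exchange ` blocks (graft (Inl s) (tree_prod F G) H)"
    unfolding blocks_tree_prod[of "graft s F H"] nonroot_blocks_graft[OF ne]
    unfolding blocks_graft blocks_tree_prod
    unfolding roots_graft image_Un image_diff_empty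
    by (simp add: forest_image_simps sum_exchange_Inl Un_ac)
  show "deco (tree_prod (graft s F H) G) (sum_exchange x) = deco (graft (Inl s) (tree_prod F G) H) x" for x
    by (cases x rule: sum_exchange.cases) simp_all
qed

lemma bump_tree_prod: "bump (Inl s) (tree_prod F G) = tree_prod (bump s F) G"
  by (auto simp: bump_def tree_prod_def roots_def fun_eq_iff split: sum.splits)

text \<open>Source of the symmetry of the associator. It includes \<open>s = t\<close>: the two root
  blocks stay separate child blocks of that vertex.\<close>

lemma graft_exchange:
  "forest_iso sum_exchange (graft (Inl t) (graft s F G) H) (graft (Inl s) (graft t F H) G)"
proof (rule forest_iso_imageI[OF inj_sum_exchange])
  show "verts (graft (Inl s) (graft t F H) G) = sum_exchange ` verts (graft (Inl t) (graft s F G) H)"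
    by (simp add: verts_graft sum_maps_Plus)
  show "edges (graft (Inl s) (graft t F H) G) = map_prod sum_exchange sum_exchange ` edges (graft (Inl t) (graft s F G) H)"
    by (simp add: edges_graft_eq forest_image_simps Un_ac)
  show "blocks (graft (Inl s) (graft t F H) G) = (`) sum_exchange ` blocks (graft (Inl t) (graft s F G) H)"
    by (simp add: blocks_graft forest_image_simps Un_ac)
  show "deco (graft (Inl s) (graft t F H) G) (sum_exchange x) = deco (graft (Inl t) (graft s F G) H) x" for x
    by (cases x rule: sum_exchange.cases) simp_all
qed

text \<open>The roots of \<open>graft t G H\<close> are those of \<open>G\<close>, so
  \<open>s\<close> gets the same new edges on both sides.\<close>

lemma graft_assoc:
  "forest_iso sum_assoc (graft (Inr t) (graft s F G) H) (graft s F (graft t G H))"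
proof (rule forest_iso_imageI[OF inj_sum_assoc])
  show "verts (graft s F (graft t G H)) = sum_assoc ` verts (graft (Inr t) (graft s F G) H)"
    by (simp add: verts_graft sum_maps_Plus)
  show "edges (graft s F (graft t G H)) = map_prod sum_assoc sum_assoc ` edges (graft (Inr t) (graft s F G) H)"
    by (simp add: edges_graft_eq roots_graft forest_image_simps Un_ac)
  show "blocks (graft s F (graft t G H)) = (`) sum_assoc ` blocks (graft (Inr t) (graft s F G) H)"
    by (simp add: blocks_graft forest_image_simps Un_ac)
  show "deco (graft s F (graft t G H)) (sum_assoc x) = deco (graft (Inr t) (graft s F G) H) x" for x
    by (cases x rule: sum_assoc.cases) simp_all
qed

lemma roots_bump [simp]: "roots (bump s F) = roots F"
  by (simp add: bump_def roots_def)

lemma verts_bump [simp]: "verts (bump s F) = verts F"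
  by (simp add: bump_def)

lemma bump_graft:
  "bump (Inl t) (graft s F G) = graft s (bump t F) G"
  "bump (Inr t) (graft s F G) = graft s F (bump t G)"
  unfolding graft_def roots_bump by (auto simp: bump_def fun_eq_iff split: sum.splits)

lemma bump_commute: "bump s (bump t F) = bump t (bump s F)"
  by (auto simp: bump_def fun_upd_def fun_eq_iff)


section \<open>The Com-PreLie algebra of partitioned trees\<close>

lemma lookup_ucp_scale [simp]: "Poly_Mapping.lookup (ucp_scale c x) T = c * Poly_Mapping.lookup x T"
  unfolding ucp_scale_def by (cases "Poly_Mapping.lookup x T = 0") (simp_all add: map.rep_eq)

lemma vector_space_ucp: "vector_space ucp_scale"
  by unfold_locales (simp_all add: poly_mapping_eq_iff fun_eq_iff lookup_add algebra_simps)

global_interpretation ucp: vector_space "ucp_scale :: 'k::field_char_0 \<Rightarrow> ('d upt \<Rightarrow>\<^sub>0 'k) \<Rightarrow> _"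
  by (rule vector_space_ucp)

lemma lookup_basis: "Poly_Mapping.lookup (basis T) S = (if T = S then 1 else 0)"
  by (simp add: basis_def lookup_single when_def)

lemma keys_basis [simp]: "Poly_Mapping.keys (basis T :: 'd upt \<Rightarrow>\<^sub>0 'k::field_char_0) = {T}"
  by (simp add: basis_def)

lemma keys_ucp_scale: "Poly_Mapping.keys (ucp_scale c x) \<subseteq> Poly_Mapping.keys x"
  by (auto simp: in_keys_iff)

lemma sum_basis_expansion:
  fixes x :: "'d upt \<Rightarrow>\<^sub>0 'k::field_char_0"
  shows "x = (\<Sum>T\<in>Poly_Mapping.keys x. ucp_scale (Poly_Mapping.lookup x T) (basis T))"
  by (rule poly_mapping_eqI) (simp add: lookup_sum lookup_basis if_distrib in_keys_iff cong: if_cong)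

lemma subspace_UCP: "ucp.subspace (UCP D)"
  unfolding ucp.subspace_def UCP_def
  by (auto dest!: subsetD[OF Poly_Mapping.keys_add] subsetD[OF keys_ucp_scale])

lemma basis_UCP: "basis T \<in> UCP D \<longleftrightarrow> T \<in> UPT D"
  by (simp add: UCP_def)

text \<open>Reduces linear statements to basis trees; used once per argument, it reduces the
  identities between the bilinear products to trees.\<close>

lemma UCP_induct [consumes 1, case_names zero add scale basis]:
  assumes x: "x \<in> UCP D"
    and zero: "P 0" and add: "\<And>x y. x \<in> UCP D \<Longrightarrow> y \<in> UCP D \<Longrightarrow> P x \<Longrightarrow> P y \<Longrightarrow> P (x + y)"
    and scale: "\<And>c x. x \<in> UCP D \<Longrightarrow> P x \<Longrightarrow> P (ucp_scale c x)"
    and basis: "\<And>T. T \<in> UPT D \<Longrightarrow> P (basis T)"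
  shows "P x"
proof -
  have "P (\<Sum>T\<in>K. ucp_scale (c T) (basis T)) \<and> (\<Sum>T\<in>K. ucp_scale (c T) (basis T)) \<in> UCP D"
    if "finite K" "K \<subseteq> UPT D" for K c
    using that
  proof (induction K)
    case empty
    then show ?case by (simp add: zero ucp.subspace_0[OF subspace_UCP])
  next
    case (insert T K)
    then show ?case
      by (simp add: add scale basis basis_UCP ucp.subspace_add[OF subspace_UCP] ucp.subspace_scale[OF subspace_UCP])
  qed
  from this[of "Poly_Mapping.keys x" "Poly_Mapping.lookup x"] x show ?thesis
    by (simp add: UCP_def flip: sum_basis_expansion)
qed

lemma UPT_UNIV [simp]: "T \<in> UPT UNIV" "x \<in> UCP UNIV"
  by (auto simp: UCP_def UPT_def)

text \<open>The case of unrestricted decorations: identities between products are proved on the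
  whole type and inherited by each \<open>UCP D\<close>.\<close>

lemmas ucp_induct = UCP_induct[of _ UNIV, simplified, case_names zero add scale basis]

text \<open>Cancellation can make the support of \<open>x + y\<close> smaller than the union of the
  supports. Missing coefficients are zero, so all sums may be taken over a common finite
  set.\<close>

lemma bilinear_extension_superset:
  fixes x y :: "'d upt \<Rightarrow>\<^sub>0 'k::field_char_0"
  assumes "finite K" "Poly_Mapping.keys x \<subseteq> K" "finite L" "Poly_Mapping.keys y \<subseteq> L"
  shows "bilinear_extension m x y =
    (\<Sum>S\<in>K. \<Sum>T\<in>L. ucp_scale (Poly_Mapping.lookup x S * Poly_Mapping.lookup y T) (m S T))"
proof -
  have "(\<Sum>T\<in>L. ucp_scale (a * Poly_Mapping.lookup y T) (m S T)) =
      (\<Sum>T\<in>Poly_Mapping.keys y. ucp_scale (a * Poly_Mapping.lookup y T) (m S T))" for a S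
    using assms by (intro sum.mono_neutral_right) (auto simp: in_keys_iff)
  then have "(\<Sum>S\<in>K. \<Sum>T\<in>L. ucp_scale (Poly_Mapping.lookup x S * Poly_Mapping.lookup y T) (m S T)) =
      (\<Sum>S\<in>K. \<Sum>T\<in>Poly_Mapping.keys y. ucp_scale (Poly_Mapping.lookup x S * Poly_Mapping.lookup y T) (m S T))"
    by simp
  also have "\<dots> = bilinear_extension m x y"
    unfolding bilinear_extension_def using assms
    by (intro sum.mono_neutral_right) (auto simp: in_keys_iff)
  finally show ?thesis ..
qed

context
  fixes m :: "'d upt \<Rightarrow> 'd upt \<Rightarrow> ('d upt \<Rightarrow>\<^sub>0 'k::field_char_0)"
begin

lemma bilinear_extension_add_left:
  "bilinear_extension m (x + y) z = bilinear_extension m x z + bilinear_extension m y z"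
proof -
  let ?K = "Poly_Mapping.keys x \<union> Poly_Mapping.keys y"
  show ?thesis
    using Poly_Mapping.keys_add[of x y]
    by (simp add: bilinear_extension_superset[of ?K _ "Poly_Mapping.keys z"] lookup_add
        ucp.scale_left_distrib distrib_right sum.distrib)
qed

lemma bilinear_extension_add_right:
  "bilinear_extension m z (x + y) = bilinear_extension m z x + bilinear_extension m z y"
proof -
  let ?K = "Poly_Mapping.keys x \<union> Poly_Mapping.keys y"
  show ?thesis
    using Poly_Mapping.keys_add[of x y]
    by (simp add: bilinear_extension_superset[of "Poly_Mapping.keys z" _ ?K] lookup_add
        ucp.scale_left_distrib distrib_left sum.distrib)
qed

lemma bilinear_extension_scale_left:
  "bilinear_extension m (ucp_scale c x) y = ucp_scale c (bilinear_extension m x y)"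
  using keys_ucp_scale[of c x]
  by (simp add: bilinear_extension_superset[of "Poly_Mapping.keys x" _ "Poly_Mapping.keys y"]
      ucp.scale_sum_right mult.assoc)

lemma bilinear_extension_scale_right:
  "bilinear_extension m x (ucp_scale c y) = ucp_scale c (bilinear_extension m x y)"
  using keys_ucp_scale[of c y]
  by (simp add: bilinear_extension_superset[of "Poly_Mapping.keys x" _ "Poly_Mapping.keys y"]
      ucp.scale_sum_right mult.left_commute)

lemma bilinear_extension_basis: "bilinear_extension m (basis S) (basis T) = m S T"
  by (simp add: bilinear_extension_def lookup_basis)

lemma bilinear_extension_zero: "bilinear_extension m 0 x = 0" "bilinear_extension m x 0 = 0"
  by (simp_all add: bilinear_extension_def)

lemma bilinear_extension_UCP:
  assumes "\<And>S T. S \<in> UPT D \<Longrightarrow> T \<in> UPT D \<Longrightarrow> m S T \<in> UCP D" and "x \<in> UCP D" "y \<in> UCP D"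
  shows "bilinear_extension m x y \<in> UCP D"
  using assms unfolding bilinear_extension_def
  by (intro ucp.subspace_sum[OF subspace_UCP] ucp.subspace_scale[OF subspace_UCP]) (auto simp: UCP_def)

end

lemmas ucp_bilinear =
  bilinear_extension_add_left[of "\<lambda>S T. basis (upt_prod S T)", folded ucp_dot_def]
  bilinear_extension_add_right[of "\<lambda>S T. basis (upt_prod S T)", folded ucp_dot_def]
  bilinear_extension_scale_left[of "\<lambda>S T. basis (upt_prod S T)", folded ucp_dot_def]
  bilinear_extension_scale_right[of "\<lambda>S T. basis (upt_prod S T)", folded ucp_dot_def]
  bilinear_extension_basis[of "\<lambda>S T. basis (upt_prod S T)", folded ucp_dot_def]
  bilinear_extension_zero[of "\<lambda>S T. basis (upt_prod S T)", folded ucp_dot_def]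
  bilinear_extension_add_left[of upt_bul, folded ucp_bul_def]
  bilinear_extension_add_right[of upt_bul, folded ucp_bul_def]
  bilinear_extension_scale_left[of upt_bul, folded ucp_bul_def]
  bilinear_extension_scale_right[of upt_bul, folded ucp_bul_def]
  bilinear_extension_basis[of upt_bul, folded ucp_bul_def]
  bilinear_extension_zero[of upt_bul, folded ucp_bul_def]

lemma ucp_sum:
  "ucp_dot (sum f K) z = (\<Sum>k\<in>K. ucp_dot (f k) z)"
  "ucp_dot z (sum f K) = (\<Sum>k\<in>K. ucp_dot z (f k))"
  "ucp_bul (sum f K) z = (\<Sum>k\<in>K. ucp_bul (f k) z)"
  "ucp_bul z (sum f K) = (\<Sum>k\<in>K. ucp_bul z (f k))"
  by (induction K rule: infinite_finite_induct; simp add: ucp_bilinear)+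

section \<open>Identities on basis trees\<close>

lemma upt_prod_commute: "upt_prod S T = upt_prod T S"
proof -
  obtain F G :: "(nat, 'a) pforest"
    where [simp]: "partitioned_tree F" "partitioned_tree G" "S = cls F" "T = cls G"
    using cls_exists by metis
  show ?thesis by (simp add: upt_prod_cls cls_eqI[OF tree_prod_tree tree_prod_swap[of F G]])
qed

lemma upt_prod_assoc: "upt_prod (upt_prod S T) U = upt_prod S (upt_prod T U)"
proof -
  obtain F G H :: "(nat, 'a) pforest"
    where [simp]: "partitioned_tree F" "partitioned_tree G" "partitioned_tree H"
      "S = cls F" "T = cls G" "U = cls H"
    using cls_exists by metis
  show ?thesis
    by (simp add: upt_prod_cls tree_prod_tree cls_eqI[OF tree_prod_tree tree_prod_assoc[of F G H]])
qed

lemma upt_prod_empty: "upt_prod empty_tree T = T"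
proof -
  obtain F :: "(nat, 'a) pforest" where [simp]: "partitioned_tree F" "T = cls F"
    using cls_exists by metis
  show ?thesis
    unfolding empty_tree_cls[where 'v = nat]
    by (simp add: upt_prod_cls empty_forest_tree cls_eqI[OF _ tree_prod_empty[of F]])
qed

lemma ins_class_tree_prod:
  assumes "partitioned_tree F" "partitioned_tree G" "partitioned_tree H" "s \<in> verts F"
  shows "ins_class (Inl s) (tree_prod F G) H = upt_prod (ins_class s F H) (cls G)"
proof -
  have "cls (tree_prod (graft s F H) G) = cls (graft (Inl s) (tree_prod F G) H)"
    using assms
    by (intro cls_eqI[OF _ graft_tree_prod] graft_tree tree_prod_tree) (simp_all add: verts_tree_prod InlI)
  then show ?thesis
    using assms by (simp add: ins_class_def bump_tree_prod upt_prod_cls graft_tree bump_tree)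
qed

text \<open>Swapping the factors reduces this to the left-hand case, since grafting and raising are
  transported along the isomorphism \<open>sum_swap\<close>.\<close>

lemma ins_class_tree_prod':
  assumes "partitioned_tree F" "partitioned_tree G" "partitioned_tree H" "s \<in> verts G"
  shows "ins_class (Inr s) (tree_prod F G) H = upt_prod (cls F) (ins_class s G H)"
proof -
  have swap: "partitioned_tree (tree_prod F G)" "forest_iso sum_swap (tree_prod F G) (tree_prod G F)"
    by (rule tree_prod_tree[OF assms(1,2)], rule tree_prod_swap)
  have s: "Inr s \<in> verts (tree_prod F G)" using assms(4) by (simp add: verts_tree_prod InrI)
  have "cls (graft (Inl s) (tree_prod G F) H) = cls (graft (Inr s) (tree_prod F G) H)"
    using graft_iso[OF swap assms(3) forest_iso_refl, of "Inr s"]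
    by (intro cls_eqI[OF graft_tree[OF swap(1) assms(3) s]]) simp
  moreover have "cls (bump (Inl s) (tree_prod G F)) = cls (bump (Inr s) (tree_prod F G))"
    using bump_iso[OF swap(2) s] by (intro cls_eqI[OF bump_tree[OF swap(1)]]) simp
  ultimately have "ins_class (Inr s) (tree_prod F G) H = ins_class (Inl s) (tree_prod G F) H"
    by (simp add: ins_class_def)
  then show ?thesis using ins_class_tree_prod[OF assms(2,1,3,4)] by (simp add: upt_prod_commute)
qed

lemma sum_Plus: "finite A \<Longrightarrow> finite B \<Longrightarrow> sum f (A <+> B) = (\<Sum>a\<in>A. f (Inl a)) + (\<Sum>b\<in>B. f (Inr b))"
  by (simp add: sum.Plus comp_def)

text \<open>The vertices of a product are the disjoint union of those of its factors, and inserting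
  at one of them changes only its own factor.\<close>

lemma upt_leibniz:
  "upt_bul (upt_prod S T) U =
     ucp_dot (upt_bul S U) (basis T) + ucp_dot (basis S) (upt_bul T U :: 'd upt \<Rightarrow>\<^sub>0 'k::field_char_0)"
proof -
  obtain F G H :: "(nat, 'd) pforest"
    where t [simp]: "partitioned_tree F" "partitioned_tree G" "partitioned_tree H"
      and "S = cls F" "T = cls G" "U = cls H"
    using cls_exists by metis
  then show ?thesis
    using partitioned_forestD(1)[OF partitioned_tree_forest[OF t(1)]]
      partitioned_forestD(1)[OF partitioned_tree_forest[OF t(2)]]
    by (simp add: upt_prod_cls upt_bul_cls tree_prod_tree verts_tree_prod sum_Plus ucp_sum
        ucp_bilinear ins_class_tree_prod ins_class_tree_prod' cong: sum.cong)
qed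

text \<open>
  The associator of \<open>F\<close>, \<open>G\<close>, \<open>H\<close> collects the trees in which \<open>G\<close> and \<open>H\<close> are both inserted at
  vertices of \<open>F\<close>; grafting at a vertex of \<open>G\<close> cancels.
\<close>

lemma upt_associator:
  fixes F G H :: "(nat, 'd) pforest"
  assumes F: "partitioned_tree F" and G: "partitioned_tree G" and H: "partitioned_tree H"
  shows "ucp_bul (upt_bul (cls F) (cls G)) (basis (cls H)) - ucp_bul (basis (cls F)) (upt_bul (cls G) (cls H)) =
    (\<Sum>s\<in>verts F. \<Sum>t\<in>verts F. basis (if verts G \<noteq> {} then ins_class (Inl t) (graft s F G) H
       else ins_class t (bump s F) H) :: 'd upt \<Rightarrow>\<^sub>0 'k::field_char_0)"
proof -
  have fin: "finite (verts F)" "finite (verts G)"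
    using F G by (auto intro: partitioned_forestD(1) partitioned_tree_forest)
  show ?thesis
  proof (cases "verts G = {}")
    case True
    \<comment> \<open>An empty \<open>G\<close> has no vertices, so
      \<open>upt_bul (cls G) (cls H)\<close> is an empty sum and the second term of the associator
      is zero.\<close>
    then show ?thesis
      by (simp add: upt_bul_cls F G H bump_tree ucp_sum ucp_bilinear ins_class_def[of _ F G])
  next
    case False
    have 1: "ucp_bul (upt_bul (cls F) (cls G)) (basis (cls H)) =
      (\<Sum>s\<in>verts F. \<Sum>t\<in>verts F. basis (ins_class (Inl t) (graft s F G) H) :: 'd upt \<Rightarrow>\<^sub>0 'k) +
      (\<Sum>s\<in>verts F. \<Sum>t\<in>verts G. basis (ins_class (Inr t) (graft s F G) H))"
      using False fin
      by (simp add: upt_bul_cls F G H graft_tree ucp_sum ucp_bilinear ins_class_def[of _ F G] verts_graft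
          sum_Plus sum.distrib)
    have 2: "upt_bul (cls F) (ins_class t G H) = (\<Sum>s\<in>verts F. basis (ins_class (Inr t) (graft s F G) H))"
      if t: "t \<in> verts G" for t
    proof (cases "verts H = {}")
      case True
      then show ?thesis using False
        by (simp add: ins_class_def upt_bul_cls F G bump_tree bump_graft)
    next
      case H': False
      have "cls (graft s F (graft t G H)) = cls (graft (Inr t) (graft s F G) H)" if "s \<in> verts F" for s
        using that t by (intro cls_eqI[OF _ graft_assoc] graft_tree F G H) (simp_all add: verts_graft InrI)
      then show ?thesis using H' False t
        by (simp add: ins_class_def upt_bul_cls F G H graft_tree verts_graft)
    qed
    have "ucp_bul (basis (cls F)) (upt_bul (cls G) (cls H)) =
      (\<Sum>s\<in>verts F. \<Sum>t\<in>verts G. basis (ins_class (Inr t) (graft s F G) H) :: 'd upt \<Rightarrow>\<^sub>0 'k)"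
      by (subst sum.swap) (simp add: upt_bul_cls[OF G H] ucp_sum ucp_bilinear 2)
    then show ?thesis using False by (simp add: 1)
  qed
qed

text \<open>By \<open>upt_associator\<close> a summand has \<open>G\<close> inserted at
  \<open>s\<close> and \<open>H\<close> at \<open>t\<close>, both vertices of \<open>F\<close>. The
  two insertions commute in all four combinations of grafting and raising, so exchanging the sums
  suffices.\<close>

lemma upt_pre_lie:
  "ucp_bul (upt_bul S T) (basis U) - ucp_bul (basis S) (upt_bul T U) =
   ucp_bul (upt_bul S U) (basis T) - ucp_bul (basis S) (upt_bul U T :: 'd upt \<Rightarrow>\<^sub>0 'k::field_char_0)"
proof -
  obtain F G H :: "(nat, 'd) pforest"
    where t: "partitioned_tree F" "partitioned_tree G" "partitioned_tree H"
      and STU: "S = cls F" "T = cls G" "U = cls H"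
    using cls_exists by metis
  have swap: "(if verts G \<noteq> {} then ins_class (Inl t) (graft s F G) H else ins_class t (bump s F) H) =
    (if verts H \<noteq> {} then ins_class (Inl s) (graft t F H) G else ins_class s (bump t F) G)"
    if st: "s \<in> verts F" "t \<in> verts F" for s t
  proof -
    have "cls (graft (Inl s) (graft t F H) G) = cls (graft (Inl t) (graft s F G) H)"
      using st by (intro cls_eqI[OF _ graft_exchange] graft_tree t) (simp_all add: verts_graft InlI)
    then show ?thesis by (simp add: ins_class_def bump_graft bump_commute)
  qed
  show ?thesis
    unfolding STU upt_associator[OF t] upt_associator[OF t(1,3,2)]
    by (rule trans[OF sum.swap], rule sum.cong[OF refl], rule sum.cong[OF refl],
        rule arg_cong[of _ _ basis], erule (1) swap)
qed

lemma cls_UPT: "partitioned_tree F \<Longrightarrow> cls F \<in> UPT D \<longleftrightarrow> (\<forall>v\<in>verts F. snd (deco F v) \<in> D)"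
  by (simp add: UPT_def upt_decos_cls image_subset_iff mem_Times_iff)

lemma ins_class_UPT:
  assumes "partitioned_tree F" "partitioned_tree G" "s \<in> verts F" "cls F \<in> UPT D" "cls G \<in> UPT D"
  shows "ins_class s F G \<in> UPT D"
proof (cases "verts G = {}")
  case True
  then show ?thesis using assms by (simp add: ins_class_def cls_UPT bump_tree) (simp add: bump_def)
next
  case False
  then show ?thesis using assms by (auto simp: ins_class_def cls_UPT graft_tree verts_graft)
qed

lemma upt_bul_UCP: "S \<in> UPT D \<Longrightarrow> T \<in> UPT D \<Longrightarrow> upt_bul S T \<in> UCP D"
proof -
  assume ST: "S \<in> UPT D" "T \<in> UPT D"
  obtain F G :: "(nat, 'a) pforest"
    where FG: "partitioned_tree F" "partitioned_tree G" "S = cls F" "T = cls G"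
    using cls_exists by metis
  then show ?thesis using ST
    by (simp add: upt_bul_cls basis_UCP ins_class_UPT ucp.subspace_sum[OF subspace_UCP])
qed

lemma upt_prod_UPT: "S \<in> UPT D \<Longrightarrow> T \<in> UPT D \<Longrightarrow> upt_prod S T \<in> UPT D"
proof -
  assume ST: "S \<in> UPT D" "T \<in> UPT D"
  obtain F G :: "(nat, 'a) pforest"
    where FG: "partitioned_tree F" "partitioned_tree G" "S = cls F" "T = cls G"
    using cls_exists by metis
  then show ?thesis using ST
    by (auto simp: upt_prod_cls cls_UPT tree_prod_tree verts_tree_prod)
qed

lemma empty_tree_UPT: "empty_tree \<in> UPT D"
  unfolding empty_tree_cls[where 'v = nat]
  by (simp add: UPT_def upt_decos_cls empty_forest_tree) (simp add: empty_forest_def)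

section \<open>Extension of the identities by bilinearity\<close>

lemma ucp_dot_commute: "ucp_dot x y = ucp_dot y x"
proof (induction x rule: ucp_induct)
  case (basis S)
  show ?case by (induction y rule: ucp_induct) (simp_all add: ucp_bilinear upt_prod_commute)
qed (simp_all add: ucp_bilinear)

lemma ucp_dot_assoc: "ucp_dot (ucp_dot x y) z = ucp_dot x (ucp_dot y z)"
proof (induction x rule: ucp_induct)
  case (basis S)
  show ?case
  proof (induction y rule: ucp_induct)
    case (basis T)
    show ?case by (induction z rule: ucp_induct) (simp_all add: ucp_bilinear upt_prod_assoc)
  qed (simp_all add: ucp_bilinear)
qed (simp_all add: ucp_bilinear)

lemma ucp_dot_one: "ucp_dot (basis empty_tree) x = x"
  by (induction x rule: ucp_induct) (simp_all add: ucp_bilinear upt_prod_empty)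

lemma ucp_leibniz: "ucp_bul (ucp_dot x y) z = ucp_dot (ucp_bul x z) y + ucp_dot x (ucp_bul y z)"
proof (induction x rule: ucp_induct)
  case (basis S)
  show ?case
  proof (induction y rule: ucp_induct)
    case (basis T)
    show ?case
      by (induction z rule: ucp_induct) (simp_all add: ucp_bilinear upt_leibniz ucp.scale_right_distrib add_ac)
  qed (simp_all add: ucp_bilinear ucp.scale_right_distrib add_ac)
qed (simp_all add: ucp_bilinear ucp.scale_right_distrib add_ac)

lemma ucp_pre_lie:
  "ucp_bul (ucp_bul x y) z - ucp_bul x (ucp_bul y z) = ucp_bul (ucp_bul x z) y - ucp_bul x (ucp_bul z y)"
proof (induction x rule: ucp_induct)
  case (basis S)
  show ?case
  proof (induction y rule: ucp_induct)
    case (basis T)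
    show ?case
      by (induction z rule: ucp_induct)
        (simp_all add: ucp_bilinear upt_pre_lie[of S T] add_diff_add flip: ucp.scale_right_diff_distrib)
  qed (simp_all add: ucp_bilinear add_diff_add flip: ucp.scale_right_diff_distrib)
qed (simp_all add: ucp_bilinear add_diff_add flip: ucp.scale_right_diff_distrib)

lemma unitary_com_prelie_algebra_UCP:
  "unitary_com_prelie_algebra ucp_scale (UCP D) ucp_dot ucp_bul (basis empty_tree)"
proof unfold_locales
  show "ucp_dot x y \<in> UCP D" if "x \<in> UCP D" "y \<in> UCP D" for x y
    unfolding ucp_dot_def using that by (intro bilinear_extension_UCP) (simp_all add: basis_UCP upt_prod_UPT)
  show "ucp_bul x y \<in> UCP D" if "x \<in> UCP D" "y \<in> UCP D" for x y
    unfolding ucp_bul_def using that by (intro bilinear_extension_UCP) (simp_all add: upt_bul_UCP)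
  show "ucp_dot x (basis empty_tree) = x" for x
    by (simp add: ucp_dot_commute[of x] ucp_dot_one)
  show "ucp_dot x y = ucp_dot y x" for x y by (rule ucp_dot_commute)
qed (simp_all add: subspace_UCP ucp_bilinear ucp_dot_assoc ucp_dot_one ucp_pre_lie ucp_leibniz
    basis_UCP empty_tree_UPT)


section \<open>Generation by single vertices\<close>

text \<open>Blocks are intersected with \<open>W\<close> because \<open>W\<close> may cut through
  the root block, as in \<open>split_roots_iso\<close>.\<close>

definition restrict_forest :: "('v, 'd) pforest \<Rightarrow> 'v set \<Rightarrow> ('v, 'd) pforest" where
  "restrict_forest F W =
     \<lparr>verts = W, edges = edges F \<inter> W \<times> W, blocks = (\<lambda>B. B \<inter> W) ` blocks F - {{}}, deco = deco F\<rparr>"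

lemma restrict_forest_simps [simp]:
  "verts (restrict_forest F W) = W" "edges (restrict_forest F W) = edges F \<inter> W \<times> W"
  "deco (restrict_forest F W) = deco F"
  by (simp_all add: restrict_forest_def)

lemma roots_restrict: "roots (restrict_forest F W) = {v \<in> W. \<forall>u\<in>W. (u, v) \<notin> edges F}"
  by (auto simp: roots_def)

lemma restrict_partitioned_forest:
  assumes F: "partitioned_forest F" and W: "W \<subseteq> verts F"
  shows "partitioned_forest (restrict_forest F W)"
proof (rule partitioned_forestI)
  let ?R = "restrict_forest F W"
  note f = partitioned_forestD[OF F]
  show "finite (verts ?R)" using f(1) W by (simp add: finite_subset)
  show "edges ?R \<subseteq> verts ?R \<times> verts ?R" by auto
  show "acyclic (edges ?R)" using f(3) by (rule acyclic_subset) simp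
  show "single_valued ((edges ?R)\<inverse>)" using f(4) by (auto simp: single_valued_def)
  show "partition_on (verts ?R) (blocks ?R)"
  proof (rule partition_onI)
    have "\<Union> (blocks ?R) = \<Union> (blocks F) \<inter> W" by (auto simp: restrict_forest_def)
    then show "\<Union> (blocks ?R) = verts ?R" using partition_onD1[OF f(5)] W by auto
    show "{} \<notin> blocks ?R" by (simp add: restrict_forest_def)
    fix p q assume pq: "p \<in> blocks ?R" "q \<in> blocks ?R" "p \<noteq> q"
    then obtain B C where BC: "B \<in> blocks F" "C \<in> blocks F" "p = B \<inter> W" "q = C \<inter> W"
      by (auto simp: restrict_forest_def)
    then have "B \<noteq> C" using pq(3) by blast
    then have "B \<inter> C = {}" using block_unique[OF F BC(1,2)] by auto
    then show "disjnt p q" using BC(3,4) by (auto simp: disjnt_def)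
  qed
  show "(x \<in> roots ?R \<and> y \<in> roots ?R) \<or> (\<exists>u. (u, x) \<in> edges ?R \<and> (u, y) \<in> edges ?R)"
    if Bxy: "B \<in> blocks ?R" "x \<in> B" "y \<in> B" for B x y
  proof -
    obtain C where C: "C \<in> blocks F" "x \<in> C" "y \<in> C" "x \<in> W" "y \<in> W"
      using Bxy by (auto simp: restrict_forest_def)
    from f(6)[OF C(1-3)] show ?thesis
    proof
      assume "x \<in> roots F \<and> y \<in> roots F"
      then show ?thesis using C by (auto simp: roots_restrict roots_def[of F])
    next
      assume "\<exists>u. (u, x) \<in> edges F \<and> (u, y) \<in> edges F"
      then obtain u where u: "(u, x) \<in> edges F" "(u, y) \<in> edges F" by blast
      show ?thesis
      proof (cases "u \<in> W")
        case True
        then show ?thesis using u C by auto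
      next
        \<comment> \<open>When the common parent is removed, both vertices become roots of the
          restriction.\<close>
        case False
        then have "v \<notin> W" if "(v, x) \<in> edges F \<or> (v, y) \<in> edges F" for v
          using that parent_unique[OF F u(1)] parent_unique[OF F u(2)] by blast
        then show ?thesis using C by (auto simp: roots_restrict)
      qed
    qed
  qed
qed

lemma blocks_restrict:
  assumes "\<And>B. B \<in> blocks F \<Longrightarrow> B \<subseteq> W \<or> B \<inter> W = {}" "{} \<notin> blocks F"
  shows "blocks (restrict_forest F W) = {B \<in> blocks F. B \<subseteq> W}"
proof (intro equalityI subsetI)
  fix C assume "C \<in> blocks (restrict_forest F W)"
  then obtain B where "B \<in> blocks F" "C = B \<inter> W" "C \<noteq> {}" by (auto simp: restrict_forest_def)
  then show "C \<in> {B \<in> blocks F. B \<subseteq> W}" using assms(1)[of B] by (auto simp: Int_absorb2)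
next
  fix C assume "C \<in> {B \<in> blocks F. B \<subseteq> W}"
  then have "C \<in> blocks F" "C = C \<inter> W" "C \<noteq> {}" using assms(2) by auto
  then show "C \<in> blocks (restrict_forest F W)" unfolding restrict_forest_def by auto
qed

text \<open>The map \<open>case_sum id id\<close> glues the disjoint union of two complementary
  vertex sets back together; both splitting isomorphisms below are given by it.\<close>

lemma codiagonal_comp:
  "case_sum id id \<circ> Inl = id" "case_sum id id \<circ> Inr = id"
  by (simp_all add: fun_eq_iff)

lemmas codiagonal_simps =
  image_Un image_comp map_prod_compose[symmetric] image_comp_image codiagonal_comp map_prod.id image_Times_map_prod

lemma image_id_set [simp]: "(`) id = id"
  by (simp add: fun_eq_iff)

text \<open>\<open>W\<close> is a union of full components, so only the root block can be cut by it,
  and the product merges the two halves of that block again.\<close>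

lemma split_roots_iso:
  assumes F: "partitioned_tree F" and W: "W \<subseteq> verts F"
    and closed: "\<And>u v. (u, v) \<in> edges F \<Longrightarrow> u \<in> W \<longleftrightarrow> v \<in> W"
  defines "W' \<equiv> verts F - W"
  shows "partitioned_tree (restrict_forest F W)" "partitioned_tree (restrict_forest F W')"
    and "forest_iso (case_sum id id) (tree_prod (restrict_forest F W) (restrict_forest F W')) F"
proof -
  note F' = partitioned_tree_forest[OF F]
  have closed': "u \<in> W' \<longleftrightarrow> v \<in> W'" if "(u, v) \<in> edges F" for u v
    using closed[OF that] that edges_subset[OF F'] by (auto simp: W'_def)
  have W': "W' \<subseteq> verts F" by (auto simp: W'_def)
  have roots: "roots (restrict_forest F U) = roots F \<inter> U"
    if "U \<subseteq> verts F" "\<And>u v. (u, v) \<in> edges F \<Longrightarrow> u \<in> U \<longleftrightarrow> v \<in> U" for U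
    using that unfolding roots_restrict unfolding roots_def by blast
  have tree: "partitioned_tree (restrict_forest F U)"
    if U: "U \<subseteq> verts F" "\<And>u v. (u, v) \<in> edges F \<Longrightarrow> u \<in> U \<longleftrightarrow> v \<in> U" for U
  proof (rule partitioned_treeI[OF restrict_partitioned_forest[OF F' U(1)]])
    fix x y assume "x \<in> roots (restrict_forest F U)" "y \<in> roots (restrict_forest F U)"
    then have xy: "x \<in> roots F" "y \<in> roots F" "x \<in> U" "y \<in> U" by (simp_all add: roots[OF U])
    then obtain B where "B \<in> blocks F" "x \<in> B" "y \<in> B" using F unfolding partitioned_tree_def by blast
    then show "\<exists>B\<in>blocks (restrict_forest F U). x \<in> B \<and> y \<in> B"
      using xy by (intro bexI[of _ "B \<inter> U"]) (auto simp: restrict_forest_def)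
  qed
  have blocks: "blocks (restrict_forest F U) - {roots F \<inter> U} = {B \<in> blocks F - {roots F}. B \<subseteq> U}"
    if U: "U \<subseteq> verts F" "\<And>u v. (u, v) \<in> edges F \<Longrightarrow> u \<in> U \<longleftrightarrow> v \<in> U" for U
  proof (intro equalityI subsetI)
    fix C assume "C \<in> blocks (restrict_forest F U) - {roots F \<inter> U}"
    then obtain B where B: "B \<in> blocks F" "C = B \<inter> U" "C \<noteq> {}" "C \<noteq> roots F \<inter> U"
      by (auto simp: restrict_forest_def)
    then have ne: "B \<noteq> roots F" by blast
    obtain x where x: "x \<in> B" "x \<in> U" using B by blast
    have "x \<notin> roots F"
      using ne block_unique[OF F' B(1) roots_block[OF F] x(1)] x(2) U(1) by blast
    \<comment> \<open>A block other than the root block has a common parent; closedness carries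
      membership in \<open>U\<close> from \<open>x\<close> up to this parent and down to
      \<open>y\<close>.\<close>
    have "y \<in> U" if y: "y \<in> B" for y
    proof -
      obtain u where "(u, x) \<in> edges F" "(u, y) \<in> edges F"
        using partitioned_forestD(6)[OF F' B(1) x(1) y] \<open>x \<notin> roots F\<close> by blast
      then show ?thesis using U(2) x(2) by blast
    qed
    then show "C \<in> {B \<in> blocks F - {roots F}. B \<subseteq> U}" using B ne by (auto simp: Int_absorb2 subset_iff)
  next
    fix C assume "C \<in> {B \<in> blocks F - {roots F}. B \<subseteq> U}"
    then have C: "C \<in> blocks F" "C \<noteq> roots F" "C \<subseteq> U" by auto
    obtain x where x: "x \<in> C" using block_ne[OF F' C(1)] by blast
    then have "x \<notin> roots F"
      using C block_unique[OF F' C(1) roots_block[OF F] x] U(1) by blast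
    then have "C \<noteq> roots F \<inter> U" using x by blast
    moreover have "C = C \<inter> U" using C by blast
    ultimately show "C \<in> blocks (restrict_forest F U) - {roots F \<inter> U}"
      using C x unfolding restrict_forest_def by auto
  qed
  show "partitioned_tree (restrict_forest F W)" "partitioned_tree (restrict_forest F W')"
    by (rule tree[OF W closed], assumption) (rule tree[OF W' closed'], assumption)
  show "forest_iso (case_sum id id) (tree_prod (restrict_forest F W) (restrict_forest F W')) F"
  proof (rule forest_isoI)
    show "inj_on (case_sum id id) (verts (tree_prod (restrict_forest F W) (restrict_forest F W')))"
      by (auto simp: inj_on_def verts_tree_prod W'_def)
    show "verts F = case_sum id id ` verts (tree_prod (restrict_forest F W) (restrict_forest F W'))"
      using W by (auto simp: verts_tree_prod W'_def Plus_def image_Un image_image)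
    have "edges F = (edges F \<inter> W \<times> W) \<union> (edges F \<inter> W' \<times> W')"
      using closed closed' edges_subset[OF F'] by (auto simp: W'_def)
    then show "edges F = map_prod (case_sum id id) (case_sum id id) `
        edges (tree_prod (restrict_forest F W) (restrict_forest F W'))"
      unfolding edges_tree_prod_eq by (simp add: codiagonal_simps)
    have "B \<subseteq> W \<or> B \<subseteq> W'" if B: "B \<in> blocks F - {roots F}" for B
    proof -
      obtain x where x: "x \<in> B" "x \<in> verts F" using B block_ne[OF F'] blocks_subset[OF F'] by blast
      have U: "B \<subseteq> U" if "x \<in> U" and U: "U \<subseteq> verts F" "\<And>u v. (u, v) \<in> edges F \<Longrightarrow> u \<in> U \<longleftrightarrow> v \<in> U" for U
      proof -
        have "B \<inter> U \<in> blocks (restrict_forest F U)" using x that \<open>B \<in> blocks F - {roots F}\<close>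
          by (auto simp: restrict_forest_def)
        moreover have "x \<notin> roots F"
          using \<open>B \<in> blocks F - {roots F}\<close> block_unique[OF F' _ roots_block[OF F] x(1)] x(2) by blast
        then have "B \<inter> U \<noteq> roots F \<inter> U" using x that by blast
        ultimately have "B \<inter> U \<in> {B \<in> blocks F - {roots F}. B \<subseteq> U}" using blocks[OF U] by blast
        then have "B \<inter> U = B"
          using block_unique[OF F', of "B \<inter> U" B x] x that(1) \<open>B \<in> blocks F - {roots F}\<close> by blast
        then show ?thesis by blast
      qed
      show ?thesis using U[OF _ W closed] U[OF _ W' closed'] x by (auto simp: W'_def)
    qed
    then have "blocks F - {roots F} = {B \<in> blocks F - {roots F}. B \<subseteq> W} \<union> {B \<in> blocks F - {roots F}. B \<subseteq> W'}"
      by blast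
    also have "\<dots> = (blocks (restrict_forest F W) - {roots F \<inter> W}) \<union> (blocks (restrict_forest F W') - {roots F \<inter> W'})"
      by (simp only: blocks[OF W closed] blocks[OF W' closed'])
    finally have nonroot: "blocks F - {roots F} =
      (blocks (restrict_forest F W) - {roots F \<inter> W}) \<union> (blocks (restrict_forest F W') - {roots F \<inter> W'})" .
    have rootsW: "roots (restrict_forest F W) = roots F \<inter> W" "roots (restrict_forest F W') = roots F \<inter> W'"
      by (rule roots[OF W closed], assumption) (rule roots[OF W' closed'], assumption)
    have "blocks F = (blocks F - {roots F}) \<union> ({roots F} - {{}})"
      using roots_block[OF F] block_ne[OF F'] tree_verts_empty[OF F] by blast
    moreover have "case_sum id id ` (roots F \<inter> W <+> roots F \<inter> W') = roots F"
      using roots_subset[of F] by (auto simp: Plus_def image_Un image_image W'_def)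
    ultimately show "blocks F = (`) (case_sum id id) ` blocks (tree_prod (restrict_forest F W) (restrict_forest F W'))"
      unfolding blocks_tree_prod rootsW image_Un image_diff_empty nonroot
      by (simp add: codiagonal_simps)
    show "deco F (case_sum id id x) = deco (tree_prod (restrict_forest F W) (restrict_forest F W')) x" for x
      by (cases x) simp_all
  qed
qed

text \<open>\<open>W\<close> consists of the subtrees hanging from the block \<open>B\<close>. Its
  roots form \<open>B\<close>, the only edges entering it go from \<open>r\<close> to
  \<open>B\<close>, and no block is cut, so \<open>F\<close> arises by grafting the part on
  \<open>W\<close> at \<open>r\<close>.\<close>

lemma split_child_block_iso:
  assumes F: "partitioned_tree F" and r: "r \<in> verts F" and B: "B \<in> child_blocks F r"
  defines "W \<equiv> \<Union>w\<in>B. desc F w"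
  defines "W' \<equiv> verts F - W"
  shows "r \<in> W'" "W \<noteq> {}" "W \<subseteq> verts F" "roots (restrict_forest F W') = roots F"
    and "partitioned_tree (restrict_forest F W')" "partitioned_tree (restrict_forest F W)"
    and "forest_iso (case_sum id id) (graft r (restrict_forest F W') (restrict_forest F W)) F"
proof -
  note F' = partitioned_tree_forest[OF F]
  have edge: "(r, w) \<in> edges F" if "w \<in> B" for w using B that by (simp add: child_blocks_def)
  have BW: "B \<subseteq> W" by (auto simp: W_def)
  show W: "W \<subseteq> verts F"
    using desc_subset[OF F'] blocks_subset[OF F' child_blocksD[OF B]] by (auto simp: W_def)
  show "W \<noteq> {}" using BW block_ne[OF F' child_blocksD[OF B]] by blast
  have W': "W' \<subseteq> verts F" by (auto simp: W'_def)
  have rW: "r \<notin> W" using not_desc_child[OF F' edge] by (auto simp: W_def)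
  then show rW': "r \<in> W'" using r by (simp add: W'_def)
  have down: "v \<in> W" if "(u, v) \<in> edges F" "u \<in> W" for u v
    using that by (auto simp: W_def desc_def intro: rtrancl_into_rtrancl)
  have parent: "v \<in> B \<or> (\<exists>u\<in>W. (u, v) \<in> edges F)" if "v \<in> W" for v
    using that by (auto simp: W_def desc_def elim: rtranclE)
  have B_out: "u \<notin> W" if "v \<in> B" "(u, v) \<in> edges F" for u v
    using parent_unique[OF F' edge[OF that(1)] that(2)] rW by blast
  have rootsW: "roots (restrict_forest F W) = B"
    using BW parent B_out unfolding roots_restrict by blast
  show rootsW': "roots (restrict_forest F W') = roots F"
  proof -
    have "v \<notin> W" if "v \<in> roots F" for v using parent[of v] edge that by (auto simp: roots_def)
    then show ?thesis
      using down edges_subset[OF F'] unfolding roots_restrict unfolding roots_def W'_def by blast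
  qed
  \<comment> \<open>A block meeting \<open>W\<close> either is \<open>B\<close> or has its common
    parent in \<open>W\<close>.\<close>
  have saturated: "C \<subseteq> W \<or> C \<inter> W = {}" if C: "C \<in> blocks F" for C
  proof (rule disjCI)
    assume "C \<inter> W \<noteq> {}"
    then obtain x where x: "x \<in> C" "x \<in> W" by blast
    show "C \<subseteq> W"
    proof (cases "x \<in> B")
      case True
      then show ?thesis using block_unique[OF F' C child_blocksD[OF B] x(1)] BW by blast
    next
      case False
      then obtain u where u: "u \<in> W" "(u, x) \<in> edges F" using parent[OF x(2)] by blast
      show ?thesis
      proof
        fix y assume "y \<in> C"
        with partitioned_forestD(6)[OF F' C x(1)] u(2) obtain u' where "(u', x) \<in> edges F" "(u', y) \<in> edges F"
          by (auto simp: roots_def)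
        then show "y \<in> W" using parent_unique[OF F' u(2)] down u(1) by blast
      qed
    qed
  qed
  have ne: "{} \<notin> blocks F" using block_ne[OF F'] by blast
  have saturated': "C \<subseteq> W' \<or> C \<inter> W' = {}" if "C \<in> blocks F" for C
    using saturated[OF that] blocks_subset[OF F' that] by (auto simp: W'_def)
  have blocksW: "blocks (restrict_forest F W) = {B \<in> blocks F. B \<subseteq> W}"
    and blocksW': "blocks (restrict_forest F W') = {B \<in> blocks F. B \<subseteq> W'}"
    by (rule blocks_restrict[OF _ ne], erule saturated saturated')+
  show "partitioned_tree (restrict_forest F W)"
  proof (rule partitioned_treeI[OF restrict_partitioned_forest[OF F' W]])
    fix x y assume "x \<in> roots (restrict_forest F W)" "y \<in> roots (restrict_forest F W)"
    then show "\<exists>B\<in>blocks (restrict_forest F W). x \<in> B \<and> y \<in> B"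
      unfolding rootsW blocksW
      using child_blocksD[OF B] BW by (intro bexI[of _ B]) simp_all
  qed
  show "partitioned_tree (restrict_forest F W')"
  proof (rule partitioned_treeI[OF restrict_partitioned_forest[OF F' W']])
    fix x y assume xy: "x \<in> roots (restrict_forest F W')" "y \<in> roots (restrict_forest F W')"
    then have "x \<in> W'" "y \<in> W'" by (auto simp: roots_restrict)
    obtain C where C: "C \<in> blocks F" "x \<in> C" "y \<in> C"
      using F xy unfolding rootsW' partitioned_tree_def by blast
    then have "C \<subseteq> W'" using saturated'[OF C(1)] \<open>x \<in> W'\<close> by blast
    then show "\<exists>B\<in>blocks (restrict_forest F W'). x \<in> B \<and> y \<in> B"
      unfolding blocksW' using C by (intro bexI[of _ C]) simp_all
  qed
  show "forest_iso (case_sum id id) (graft r (restrict_forest F W') (restrict_forest F W)) F"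
  proof (rule forest_isoI)
    show "inj_on (case_sum id id) (verts (graft r (restrict_forest F W') (restrict_forest F W)))"
      by (auto simp: inj_on_def verts_graft W'_def)
    show "verts F = case_sum id id ` verts (graft r (restrict_forest F W') (restrict_forest F W))"
      using W by (auto simp: verts_graft W'_def Plus_def image_Un image_image)
    have "edges F = (edges F \<inter> W' \<times> W') \<union> (edges F \<inter> W \<times> W) \<union> {r} \<times> B"
    proof (intro equalityI subsetI)
      fix e assume e: "e \<in> edges F"
      obtain u v where uv: "e = (u, v)" by force
      then have "u \<in> verts F" "v \<in> verts F" using e edges_subset[OF F'] by auto
      moreover have "u = r \<and> v \<in> B" if "u \<notin> W" "v \<in> W"
        using parent[OF that(2)] parent_unique[OF F', of u v] edge e that(1) uv by blast
      ultimately show "e \<in> (edges F \<inter> W' \<times> W') \<union> (edges F \<inter> W \<times> W) \<union> {r} \<times> B"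
        using e down[of u v] uv by (auto simp: W'_def)
    qed (use edge in auto)
    then show "edges F = map_prod (case_sum id id) (case_sum id id) `
        edges (graft r (restrict_forest F W') (restrict_forest F W))"
      unfolding edges_graft_eq rootsW by (simp add: codiagonal_simps)
    have "blocks F = {B \<in> blocks F. B \<subseteq> W'} \<union> {B \<in> blocks F. B \<subseteq> W}"
      using saturated blocks_subset[OF F'] unfolding W'_def by blast
    then show "blocks F = (`) (case_sum id id) ` blocks (graft r (restrict_forest F W') (restrict_forest F W))"
      unfolding blocks_graft blocksW blocksW'
      by (simp add: codiagonal_simps)
    show "deco F (case_sum id id x) = deco (graft r (restrict_forest F W') (restrict_forest F W)) x" for x
      by (cases x) simp_all
  qed
qed

definition tree_size :: "'d upt \<Rightarrow> nat" where
  "tree_size T = card (verts (rep_upt T))"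

text \<open>Second component of the induction measure. It decides between trees of equal size with a
  single root; the union over the roots gives a value to every class.\<close>

definition tree_branches :: "'d upt \<Rightarrow> nat" where
  "tree_branches T = card (\<Union>r\<in>roots (rep_upt T). child_blocks (rep_upt T) r)"

lemma tree_size_cls: "partitioned_tree F \<Longrightarrow> tree_size (cls F) = card (verts F)"
  using rep_cls[of F] by (auto simp: tree_size_def forest_iso_def bij_betw_same_card)

lemma tree_branches_cls:
  assumes F: "partitioned_tree F"
  shows "tree_branches (cls F) = card (\<Union>r\<in>roots F. child_blocks F r)"
proof -
  obtain h where h: "forest_iso h F (rep_upt (cls F))" using rep_cls[OF F] by blast
  note F' = partitioned_tree_forest[OF F]
  have "(\<Union>r\<in>roots (rep_upt (cls F)). child_blocks (rep_upt (cls F)) r) = (`) h ` (\<Union>r\<in>roots F. child_blocks F r)"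
    unfolding iso_roots[OF F' h] by (simp add: image_UN child_blocks_iso[OF F' h] rootsD)
  moreover have "inj_on ((`) h) (\<Union>r\<in>roots F. child_blocks F r)"
  proof (rule inj_onI)
    fix A B assume "A \<in> (\<Union>r\<in>roots F. child_blocks F r)" "B \<in> (\<Union>r\<in>roots F. child_blocks F r)" "h ` A = h ` B"
    moreover from this have "A \<subseteq> verts F" "B \<subseteq> verts F" using blocks_subset[OF F' child_blocksD] by blast+
    ultimately show "A = B" using inj_on_image_eq_iff[OF forest_isoD(1)[OF h]] by blast
  qed
  ultimately show ?thesis by (simp add: tree_branches_def card_image)
qed

text \<open>Isolates generation: such an \<open>S\<close> contains \<open>UCP D\<close>, see
  \<open>UCP_mem\<close>. Uniqueness of morphisms takes for \<open>S\<close> the set on which two of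
  them agree.\<close>

locale ucp_subalgebra =
  fixes S :: "('d upt \<Rightarrow>\<^sub>0 'k::field_char_0) set" and D :: "'d set"
  assumes subspace: "ucp.subspace S"
    and dot: "x \<in> S \<Longrightarrow> y \<in> S \<Longrightarrow> ucp_dot x y \<in> S"
    and bul: "x \<in> S \<Longrightarrow> y \<in> S \<Longrightarrow> ucp_bul x y \<in> S"
    and one: "basis empty_tree \<in> S"
    and vertex: "d \<in> D \<Longrightarrow> basis (tau (0, d)) \<in> S"
begin

text \<open>Acting by the empty tree raises the decoration of a single vertex by one.\<close>

lemma tau_mem: "d \<in> D \<Longrightarrow> basis (tau (k, d)) \<in> S"
proof (induction k)
  case (Suc k)
  let ?F = "single_vertex (0::nat) (k, d)"
  have "ucp_bul (basis (tau (k, d))) (basis empty_tree) = (basis (cls (bump 0 ?F)) :: 'd upt \<Rightarrow>\<^sub>0 'k)"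
    unfolding tau_cls[of _ "0::nat"] empty_tree_cls[where 'v = nat]
    by (simp add: ucp_bilinear upt_bul_cls single_vertex_tree empty_forest_tree ins_class_def)
      (simp add: single_vertex_def empty_forest_def)
  also have "cls (bump 0 ?F) = tau (Suc k, d)"
    unfolding tau_cls[of _ "0::nat"]
    by (rule cls_eqI[OF single_vertex_tree, where h = id]) (simp add: forest_iso_def bump_def single_vertex_def)
  finally show ?case
    using bul[OF Suc.IH[OF Suc.prems] one] by simp
qed (rule vertex)

lemma basis_mem: "T \<in> UPT D \<Longrightarrow> basis T \<in> S"
proof (induction T rule: wf_induct_rule[OF wf_measures[of "[tree_size, tree_branches]"]])
  case (1 T)
  obtain F :: "(nat, 'd) pforest" where F: "partitioned_tree F" and T: "T = cls F"
    using cls_exists by metis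
  note F' = partitioned_tree_forest[OF F]
  have fin: "finite (verts F)" by (rule partitioned_forestD(1)[OF F'])
  have D: "snd (deco F v) \<in> D" if "v \<in> verts F" for v
    using "1.prems" that unfolding T cls_UPT[OF F] by blast
  have IH: "basis (cls G) \<in> S"
    if "partitioned_tree G" "card (verts G) < card (verts F) \<or> card (verts G) = card (verts F) \<and>
        card (\<Union>r\<in>roots G. child_blocks G r) < card (\<Union>r\<in>roots F. child_blocks F r)"
      "\<And>v. v \<in> verts G \<Longrightarrow> snd (deco G v) \<in> D" for G :: "('v::countable, 'd) pforest"
    using "1.IH"[of "cls G"] that by (simp add: T tree_size_cls tree_branches_cls F cls_UPT)
  consider (empty) "verts F = {}" | (roots) r r' where "r \<in> roots F" "r' \<in> roots F" "r \<noteq> r'"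
    | (child) r B where "roots F = {r}" "B \<in> child_blocks F r"
    | (single) r where "roots F = {r}" "child_blocks F r = {}"
  proof (cases "verts F = {}")
    case False
    then have "roots F \<noteq> {}" using roots_block[OF F] block_ne[OF F'] by blast
    then obtain r where "r \<in> roots F" by blast
    then show thesis using that by (cases "roots F = {r}") auto
  qed auto
  then show ?case
  proof cases
    case empty
    have "forest_iso id F empty_forest"
      using empty tree_verts_empty[OF F empty] by (auto simp: forest_iso_def empty_forest_def)
    then have "T = empty_tree" unfolding T empty_tree_cls[where 'v = nat] by (rule cls_eqI[OF F, symmetric])
    then show ?thesis by (simp add: one)
  next
    case roots
    \<comment> \<open>The subtree at one root: it is closed along edges in both directions because
      \<open>r\<close> has no parent, and it misses \<open>r'\<close>.\<close>
    define W where "W = desc F r"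
    have W: "W \<subseteq> verts F" unfolding W_def by (rule desc_subset[OF F' rootsD[OF roots(1)]])
    have closed: "u \<in> W \<longleftrightarrow> v \<in> W" if uv: "(u, v) \<in> edges F" for u v
    proof
      show "v \<in> W" if "u \<in> W" using that uv by (auto simp: W_def desc_def)
      show "u \<in> W" if "v \<in> W"
      proof -
        have "(r, v) \<in> (edges F)\<^sup>*" "v \<noteq> r" using that uv roots(1) by (auto simp: W_def desc_def roots_def)
        then obtain u' where "(r, u') \<in> (edges F)\<^sup>*" "(u', v) \<in> edges F" by (auto elim: rtranclE)
        then show ?thesis using parent_unique[OF F' uv] by (auto simp: W_def desc_def)
      qed
    qed
    let ?H = "restrict_forest F W" and ?G = "restrict_forest F (verts F - W)"
    have split: "partitioned_tree ?H" "partitioned_tree ?G" "forest_iso (case_sum id id) (tree_prod ?H ?G) F"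
      using split_roots_iso[OF F W] closed by blast+
    have "r \<in> W" by (simp add: W_def)
    moreover have "r' \<in> verts F - W"
      using desc_disjoint[OF F' roots(3)] roots(1,2) rootsD[OF roots(2)] desc_refl[of r' F] by (auto simp: W_def)
    ultimately have card: "card W < card (verts F)" "card (verts F - W) < card (verts F)"
      using W fin by (auto intro!: psubset_card_mono)
    have "basis (cls ?H) \<in> S" by (rule IH[OF split(1)]) (use card D W in auto)
    moreover have "basis (cls ?G) \<in> S" by (rule IH[OF split(2)]) (use card D in auto)
    ultimately have "ucp_dot (basis (cls ?H)) (basis (cls ?G)) \<in> S" by (rule dot)
    then have "basis (cls (tree_prod ?H ?G)) \<in> S"
      by (simp add: ucp_bilinear upt_prod_cls split)
    then show ?thesis unfolding T cls_eqI[OF tree_prod_tree[OF split(1,2)] split(3)] .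
  next
    case child
    have r: "r \<in> verts F" using child(1) rootsD[of r F] by simp
    define W where "W = (\<Union>w\<in>B. desc F w)"
    note split = split_child_block_iso[OF F r child(2), folded W_def]
    let ?G = "restrict_forest F W" and ?H = "restrict_forest F (verts F - W)"
    have card: "card W < card (verts F)" "card (verts F - W) < card (verts F)"
      using split(1-3) fin by (auto intro!: psubset_card_mono)
    have tree: "partitioned_tree (graft s ?H ?G)" if "s \<in> verts F - W" for s
      using that split(5,6) by (intro graft_tree) simp_all
    have size: "card (verts (graft s ?H ?G)) = card (verts F)" for s
      using fin split(3) by (simp add: verts_graft card_Plus finite_subset card_Diff_subset card_mono)
    \<comment> \<open>Grafting at \<open>r\<close> adds one child block at the root, grafting
      elsewhere adds none. As \<open>T\<close> is the case \<open>s = r\<close>, all other terms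
      have strictly fewer branches at the same size.\<close>
    have branches: "card (\<Union>q\<in>roots (graft s ?H ?G). child_blocks (graft s ?H ?G) q) =
        card (child_blocks ?H r) + (if r = s then 1 else 0)" if "s \<in> verts F - W" for s
    proof -
      have "finite (child_blocks ?H r)"
        by (rule finite_child_blocks[OF partitioned_tree_forest[OF split(5)]])
      moreover have "(Inr ` roots ?G :: (nat + nat) set) \<notin> (`) Inl ` child_blocks ?H r"
        using block_ne[OF partitioned_tree_forest[OF split(5)] child_blocksD] by (auto simp: image_iff) blast
      moreover have "inj_on ((`) (Inl :: nat \<Rightarrow> nat + nat)) (child_blocks ?H r)"
        by (rule inj_onI) (simp add: inj_image_eq_iff)
      ultimately show ?thesis
        using that split(2) by (cases "s = r") (simp_all add: roots_graft split(4) child_blocks_graft[OF split(5,6)] child(1) card_image)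
    qed
    have TF: "T = cls (graft r ?H ?G)"
      unfolding T by (rule cls_eqI[OF tree[OF split(1)] split(7)])
    have less: "basis (cls (graft s ?H ?G)) \<in> S" if s: "s \<in> verts F - W - {r}" for s
    proof (rule IH)
      have "tree_branches T = card (child_blocks ?H r) + 1"
        using branches[OF split(1)] by (simp add: TF tree_branches_cls tree[OF split(1)])
      then have "card (\<Union>q\<in>roots F. child_blocks F q) = card (child_blocks ?H r) + 1"
        by (simp add: T tree_branches_cls F)
      then show "card (verts (graft s ?H ?G)) < card (verts F) \<or> card (verts (graft s ?H ?G)) = card (verts F) \<and>
        card (\<Union>r\<in>roots (graft s ?H ?G). child_blocks (graft s ?H ?G) r) < card (\<Union>r\<in>roots F. child_blocks F r)"
        using s branches[of s] size[of s] by simp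
      show "snd (deco (graft s ?H ?G) v) \<in> D" if "v \<in> verts (graft s ?H ?G)" for v
        using that D split(3) by (auto simp: verts_graft)
    qed (use s tree in auto)
    have "basis (cls ?H) \<in> S" by (rule IH[OF split(5)]) (use card D in auto)
    moreover have "basis (cls ?G) \<in> S" by (rule IH[OF split(6)]) (use card D split(3) in auto)
    ultimately have "ucp_bul (basis (cls ?H)) (basis (cls ?G)) \<in> S" by (rule bul)
    then have "(\<Sum>s\<in>verts F - W. basis (cls (graft s ?H ?G))) \<in> S"
      using split(2) by (simp add: ucp_bilinear upt_bul_cls split ins_class_def)
    \<comment> \<open>The summand at \<open>s = r\<close> is \<open>T\<close>; subtracting the
      others isolates it.\<close>
    moreover have "(\<Sum>s\<in>verts F - W. basis (cls (graft s ?H ?G))) =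
        (basis T :: 'd upt \<Rightarrow>\<^sub>0 'k) + (\<Sum>s\<in>verts F - W - {r}. basis (cls (graft s ?H ?G)))"
      using fin split(1) by (simp add: TF sum.remove)
    moreover have "(\<Sum>s\<in>verts F - W - {r}. basis (cls (graft s ?H ?G))) \<in> S"
      using less by (rule ucp.subspace_sum[OF subspace])
    ultimately show ?thesis
      using ucp.subspace_diff[OF subspace] by (metis add_diff_cancel_right')
  next
    case single
    have no_child: "(r, w) \<notin> edges F" for w
      using Union_child_blocks[OF F', of r] unfolding single(2) by auto
    have "desc F r = {r}" using desc_step[of F r] no_child by simp
    then have V: "verts F = {r}" using Union_desc_roots[OF F'] single(1) by simp
    have "edges F = {}"
      using edges_subset[OF F'] no_child unfolding V by auto
    moreover have "blocks F = {{r}}"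
    proof -
      have "blocks F \<subseteq> {{r}}"
        using blocks_subset[OF F'] block_ne[OF F'] unfolding V by (auto simp: subset_singleton_iff)
      then show ?thesis using block_exists[OF F', of r] V by auto
    qed
    ultimately have "forest_iso id F (single_vertex r (deco F r))"
      using V by (simp add: forest_iso_def single_vertex_def)
    then have "T = tau (deco F r)"
      unfolding T tau_cls[of _ r] by (rule cls_eqI[OF F, symmetric])
    then show ?thesis
      using tau_mem[of "snd (deco F r)" "fst (deco F r)"] D V by simp
  qed
qed

lemma UCP_mem: "x \<in> UCP D \<Longrightarrow> x \<in> S"
  by (induction x rule: UCP_induct)
    (simp_all add: basis_mem ucp.subspace_0[OF subspace] ucp.subspace_add[OF subspace] ucp.subspace_scale[OF subspace])

end


section \<open>The universal property\<close>

context total_com_prelie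
begin

definition psi :: "('d \<Rightarrow> 'a) \<Rightarrow> ('v, 'd) pforest \<Rightarrow> 'a" where
  "psi a F = phi F (\<lambda>v. a (snd (deco F v))) (\<lambda>v. replicate_mset (fst (deco F v)) one)"

lemma psi_iso: "partitioned_forest F \<Longrightarrow> forest_iso h F G \<Longrightarrow> psi a G = psi a F"
  unfolding psi_def by (rule phi_iso) (auto simp: forest_isoD(5))

lemma psi_cls:
  assumes "partitioned_tree F"
  shows "psi a (rep_upt (cls F)) = psi a F"
  using rep_cls[OF assms] psi_iso[OF partitioned_tree_forest[OF assms]] by blast

lemma psi_tree_prod:
  assumes "partitioned_tree F" "partitioned_tree G"
  shows "psi a (tree_prod F G) = psi a F \<otimes> psi a G"
proof -
  have "(\<lambda>v. a (snd (deco (tree_prod F G) v))) = case_sum (\<lambda>v. a (snd (deco F v))) (\<lambda>v. a (snd (deco G v)))"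
    "(\<lambda>v. replicate_mset (fst (deco (tree_prod F G) v)) one) =
       case_sum (\<lambda>v. replicate_mset (fst (deco F v)) one) (\<lambda>v. replicate_mset (fst (deco G v)) one)"
    by (auto simp: fun_eq_iff split: sum.splits)
  then show ?thesis unfolding psi_def using phi_tree_prod[OF assms] by simp
qed

text \<open>Decorations enter evaluation through \<open>f\<close> and \<open>X\<close> only, so
  raising one leaves the recursion itself unchanged.\<close>

lemma ev_bump: "ev (bump s F) = ev F"
  by (simp add: ev_def child_blocks_def bump_def fun_eq_iff)

text \<open>Inserting \<open>G\<close> at \<open>s\<close> adds the value of \<open>G\<close> to the
  arguments at \<open>s\<close>. For empty \<open>G\<close> that value is the empty product
  \<open>one\<close>, and raising the decoration adds exactly one copy of it. Then
  \<open>sum_insert_phi\<close> applies, since all extra arguments are copies of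
  \<open>one\<close>.\<close>

lemma sum_psi_ins_class:
  assumes F: "partitioned_tree F" and G: "partitioned_tree G"
  shows "(\<Sum>s\<in>verts F. psi a (rep_upt (ins_class s F G))) = psi a F \<lhd> psi a G"
proof -
  let ?f = "\<lambda>v. a (snd (deco F v))" and ?X = "\<lambda>v. replicate_mset (fst (deco F v)) one"
  have "psi a (rep_upt (ins_class s F G)) = phi F ?f (?X(s := add_mset (psi a G) (?X s)))" if s: "s \<in> verts F" for s
  proof (cases "verts G = {}")
    case True
    have "roots G = {}" using tree_verts_empty[OF G True] by simp
    then have "psi a G = one" by (simp add: psi_def phi_def)
    moreover have "(\<lambda>v. a (snd (deco (bump s F) v))) = ?f"
      "(\<lambda>v. replicate_mset (fst (deco (bump s F) v)) one) = ?X(s := add_mset one (?X s))"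
      by (auto simp: fun_eq_iff bump_def)
    ultimately show ?thesis
      using True by (simp add: ins_class_def psi_cls bump_tree F)
        (simp add: psi_def phi_def ev_bump)
  next
    case False
    have "(\<lambda>v. a (snd (deco (graft s F G) v))) = case_sum ?f (\<lambda>v. a (snd (deco G v)))"
      "(\<lambda>v. replicate_mset (fst (deco (graft s F G) v)) one) =
         case_sum ?X (\<lambda>v. replicate_mset (fst (deco G v)) one)"
      by (auto simp: fun_eq_iff split: sum.splits)
    then have "psi a (graft s F G) = phi F ?f (?X(s := add_mset (psi a G) (?X s)))"
      unfolding psi_def using phi_graft[OF F G s False] by simp
    then show ?thesis
      using False by (simp add: ins_class_def psi_cls graft_tree F G s)
  qed
  then have "(\<Sum>s\<in>verts F. psi a (rep_upt (ins_class s F G))) =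
      (\<Sum>s\<in>verts F. phi F ?f (?X(s := add_mset (psi a G) (?X s))))"
    by (rule sum.cong[OF refl])
  also have "\<dots> = phi F ?f ?X \<lhd> psi a G"
    by (rule sum_insert_phi[OF partitioned_tree_forest[OF F]]) (auto simp: one_bul split: if_splits)
  finally show ?thesis by (simp add: psi_def)
qed

lemma psi_empty: "psi a (rep_upt empty_tree) = one"
  unfolding empty_tree_cls[where 'v = nat]
  by (simp add: psi_cls empty_forest_tree) (simp add: psi_def phi_def empty_forest_def roots_def)

text \<open>The factor \<open>one\<close> is the seed of the product over the roots; it disappears
  once \<open>a d\<close> is known to lie in the carrier.\<close>

lemma psi_tau: "psi a (rep_upt (tau (0, d))) = a d \<otimes> one"
proof -
  let ?F = "single_vertex (0::nat) (0, d)"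
  have "roots ?F = {0}" "child_blocks ?F 0 = {}"
    by (auto simp: roots_def child_blocks_def single_vertex_def)
  then show ?thesis
    unfolding tau_cls[of _ "0::nat"] psi_cls[OF single_vertex_tree] unfolding psi_def phi_def
    by (simp add: ev_unfold[OF partitioned_tree_forest[OF single_vertex_tree]]) (simp add: single_vertex_def)
qed

end

section \<open>From a carrier subspace to products on the whole type\<close>

context unitary_com_prelie_algebra
begin

text \<open>A projection onto \<open>A\<close> is a linear left inverse of the identity on
  \<open>A\<close> with range in \<open>A\<close>.\<close>

lemma projection_exists:
  obtains p where "\<And>x. p x \<in> A" "\<And>x. x \<in> A \<Longrightarrow> p x = x" "\<And>x y. p (x + y) = p x + p y"
    "\<And>c x. p (scale c x) = scale c (p x)"
proof -
  interpret vector_space_pair scale scale ..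
  have "Vector_Spaces.linear scale scale id" by (rule linear_id)
  from linear_exists_left_inverse_on[OF this subspace_carrier]
  obtain p where p: "range p \<subseteq> A" "Vector_Spaces.linear scale scale p" "\<forall>x\<in>A. p (id x) = x"
    by auto
  interpret p: Vector_Spaces.linear scale scale p by (rule p(2))
  from p show thesis by (intro that[of p]) (auto simp: p.add p.scale)
qed

text \<open>Applying the projection to both arguments yields total products that agree with the
  given ones on \<open>A\<close>; for them \<open>one\<close> fixes all products, though not all
  elements, as \<open>total_com_prelie\<close> demands. The map is built on the whole type,
  including trees with decorations outside \<open>D\<close>, where the values of \<open>a\<close>
  are arbitrary.\<close>

lemma universal_map_exists:
  assumes a: "\<And>d. d \<in> D \<Longrightarrow> a d \<in> A"
  shows "\<exists>\<phi> :: ('d upt \<Rightarrow>\<^sub>0 'k) \<Rightarrow> 'a. (\<forall>x. \<phi> x \<in> A) \<and> (\<forall>x y. \<phi> (x + y) = \<phi> x + \<phi> y) \<and>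
    (\<forall>c x. \<phi> (ucp_scale c x) = scale c (\<phi> x)) \<and> (\<forall>x y. \<phi> (ucp_dot x y) = dot (\<phi> x) (\<phi> y)) \<and>
    (\<forall>x y. \<phi> (ucp_bul x y) = bul (\<phi> x) (\<phi> y)) \<and> \<phi> (basis empty_tree) = one \<and>
    (\<forall>d\<in>D. \<phi> (basis (tau (0, d))) = a d)"
proof -
  obtain p where p: "\<And>x. p x \<in> A" "\<And>x. x \<in> A \<Longrightarrow> p x = x" "\<And>x y. p (x + y) = p x + p y"
    "\<And>c x. p (scale c x) = scale c (p x)"
    using projection_exists by blast
  define dot' where "dot' x y = dot (p x) (p y)" for x y
  define bul' where "bul' x y = bul (p x) (p y)" for x y
  interpret total: total_com_prelie dot' bul' one
    by unfold_locales
      (simp_all add: dot'_def bul'_def p dot_closed bul_closed one_closed dot_add_left bul_add_left bul_add_right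
        dot_assoc pre_lie leibniz dot_one_left, simp add: dot_commute p)
  define g where "g T = total.psi a (rep_upt T)" for T
  \<comment> \<open>A product is \<open>one\<close> or a value of \<open>dot'\<close>, so it lies in
    \<open>A\<close> even if some \<open>a d\<close> does not.\<close>
  have pr_closed: "total.pr M \<in> A" for M
    by (cases M) (simp_all add: one_closed dot'_def dot_closed p)
  then have g_closed: "g T \<in> A" for T
    by (simp add: g_def total.psi_def total.phi_def)
  define \<phi> :: "('d upt \<Rightarrow>\<^sub>0 'k) \<Rightarrow> 'a" where
    "\<phi> x = (\<Sum>T\<in>Poly_Mapping.keys x. scale (Poly_Mapping.lookup x T) (g T))" for x
  have superset: "\<phi> x = (\<Sum>T\<in>K. scale (Poly_Mapping.lookup x T) (g T))"
    if "finite K" "Poly_Mapping.keys x \<subseteq> K" for x K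
    unfolding \<phi>_def using that by (intro sum.mono_neutral_left) (auto simp: in_keys_iff)
  have closed: "\<phi> x \<in> A" for x
    unfolding \<phi>_def by (intro subspace_sum[OF subspace_carrier] subspace_scale[OF subspace_carrier] g_closed)
  have add: "\<phi> (x + y) = \<phi> x + \<phi> y" for x y
  proof -
    let ?K = "Poly_Mapping.keys x \<union> Poly_Mapping.keys y"
    show ?thesis
      using Poly_Mapping.keys_add[of x y]
      by (simp add: superset[of ?K] lookup_add scale_left_distrib sum.distrib)
  qed
  have scale: "\<phi> (ucp_scale c x) = scale c (\<phi> x)" for c x
    using keys_ucp_scale[of c x]
    by (simp add: superset[of "Poly_Mapping.keys x"] scale_sum_right)
  have basis: "\<phi> (basis T) = g T" for T
    by (simp add: \<phi>_def lookup_basis)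
  have zero: "\<phi> 0 = 0" by (simp add: \<phi>_def)
  have sum: "\<phi> (sum h K) = (\<Sum>k\<in>K. \<phi> (h k))" for h :: "nat \<Rightarrow> 'd upt \<Rightarrow>\<^sub>0 'k" and K
    by (induction K rule: infinite_finite_induct) (simp_all add: zero add)
  have bil0: "dot 0 (\<phi> x) = 0" "dot (\<phi> x) 0 = 0" "bul 0 (\<phi> x) = 0" "bul (\<phi> x) 0 = 0" for x
    using dot_scale_left[OF closed closed, of 0 x x] dot_scale_right[OF closed closed, of x 0 x]
      bul_scale_left[OF closed closed, of 0 x x] bul_scale_right[OF closed closed, of x 0 x] by simp_all
  have dot: "\<phi> (ucp_dot x y) = dot (\<phi> x) (\<phi> y)" for x y
  proof (induction x rule: ucp_induct)
    case (basis S)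
    show ?case
    proof (induction y rule: ucp_induct)
      case (basis T)
      obtain F G :: "(nat, 'd) pforest" where [simp]: "partitioned_tree F" "partitioned_tree G"
          and ST: "S = cls F" "T = cls G"
        using cls_exists by metis
      have "g (upt_prod S T) = dot' (g S) (g T)"
        unfolding ST by (simp add: upt_prod_cls g_def total.psi_cls tree_prod_tree total.psi_tree_prod)
      then show ?case by (simp add: ucp_bilinear \<open>\<And>T. \<phi> (basis T) = g T\<close> dot'_def p g_closed)
    qed (simp_all add: ucp_bilinear bil0 zero add scale closed dot_add_left dot_add_right
      dot_scale_left dot_scale_right)
  qed (simp_all add: ucp_bilinear bil0 zero add scale closed dot_add_left dot_add_right
      dot_scale_left dot_scale_right)
  have bul: "\<phi> (ucp_bul x y) = bul (\<phi> x) (\<phi> y)" for x y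
  proof (induction x rule: ucp_induct)
    case (basis S)
    show ?case
    proof (induction y rule: ucp_induct)
      case (basis T)
      obtain F G :: "(nat, 'd) pforest" where [simp]: "partitioned_tree F" "partitioned_tree G"
          and ST: "S = cls F" "T = cls G"
        using cls_exists by metis
      have "\<phi> (upt_bul S T) = bul' (g S) (g T)"
        unfolding ST by (simp add: upt_bul_cls sum \<open>\<And>T. \<phi> (basis T) = g T\<close>)
          (simp add: g_def total.psi_cls total.sum_psi_ins_class)
      then show ?case by (simp add: ucp_bilinear \<open>\<And>T. \<phi> (basis T) = g T\<close> bul'_def p g_closed)
    qed (simp_all add: ucp_bilinear bil0 zero add scale closed bul_add_left bul_add_right
      bul_scale_left bul_scale_right)
  qed (simp_all add: ucp_bilinear bil0 zero add scale closed bul_add_left bul_add_right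
      bul_scale_left bul_scale_right)
  have "\<phi> (basis empty_tree) = one" by (simp add: basis g_def total.psi_empty)
  moreover have "\<phi> (basis (tau (0, d))) = a d" if "d \<in> D" for d
    using a[OF that] by (simp add: basis g_def total.psi_tau dot'_def p one_closed dot_one_right)
  ultimately show ?thesis using closed add scale dot bul by blast
qed

end

lemma tau_UPT: "tau (k, d) \<in> UPT D \<longleftrightarrow> d \<in> D"
  unfolding tau_cls[of _ "0::nat"] by (simp add: cls_UPT single_vertex_tree) (simp add: single_vertex_def)

text \<open>Agreement is stable under all operations of the algebra, so generation by the trees
  \<open>tau (0, d)\<close> decides.\<close>

lemma ucp_morphism_unique:
  fixes scale :: "'k::field_char_0 \<Rightarrow> 'a::ab_group_add \<Rightarrow> 'a" and D :: "'d set"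
  assumes "unitary_com_prelie_morphism ucp_scale (UCP D) ucp_dot ucp_bul (basis empty_tree) scale A dot bul one \<phi>"
    and "unitary_com_prelie_morphism ucp_scale (UCP D) ucp_dot ucp_bul (basis empty_tree) scale A dot bul one \<psi>"
    and tau: "\<And>d. d \<in> D \<Longrightarrow> \<phi> (basis (tau (0, d))) = \<psi> (basis (tau (0, d)))"
    and x: "x \<in> UCP D"
  shows "\<phi> x = \<psi> x"
proof -
  interpret f: unitary_com_prelie_morphism ucp_scale "UCP D" ucp_dot ucp_bul "basis empty_tree" scale A dot bul one \<phi>
    by fact
  interpret g: unitary_com_prelie_morphism ucp_scale "UCP D" ucp_dot ucp_bul "basis empty_tree" scale A dot bul one \<psi>
    by fact
  have zero: "\<phi> 0 = 0" "\<psi> 0 = 0"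
    using f.map_scale[OF ucp.subspace_0[OF subspace_UCP], of 0] g.map_scale[OF ucp.subspace_0[OF subspace_UCP], of 0]
    by simp_all
  interpret ucp_subalgebra "{x \<in> UCP D. \<phi> x = \<psi> x}" D
    by unfold_locales
      (auto simp: ucp.subspace_def zero f.map_add g.map_add f.map_scale g.map_scale f.map_dot g.map_dot
        f.map_bul g.map_bul f.map_one g.map_one tau f.source.dot_closed f.source.bul_closed f.source.one_closed
        ucp.subspace_0[OF subspace_UCP] ucp.subspace_add[OF subspace_UCP] ucp.subspace_scale[OF subspace_UCP]
        basis_UCP tau_UPT empty_tree_UPT)
  show ?thesis using UCP_mem[OF x] by simp
qed

theorem proposition3p4:
  fixes D :: "'d set"
  shows "unitary_com_prelie_algebra (ucp_scale :: 'k::field_char_0 \<Rightarrow> _) (UCP D) ucp_dot ucp_bul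
           (basis empty_tree) \<and>
         (\<forall>(scale :: 'k \<Rightarrow> 'a::ab_group_add \<Rightarrow> 'a) A dot bul one a.
            unitary_com_prelie_algebra scale A dot bul one \<longrightarrow> (\<forall>d\<in>D. a d \<in> A) \<longrightarrow>
            (\<exists>!\<phi>. \<phi> \<in> UCP D \<rightarrow>\<^sub>E A \<and>
               unitary_com_prelie_morphism ucp_scale (UCP D) ucp_dot ucp_bul (basis empty_tree)
                 scale A dot bul one \<phi> \<and>
               (\<forall>d\<in>D. \<phi> (basis (tau (0, d))) = a d)))"
proof (intro conjI allI impI)
  show ucp: "unitary_com_prelie_algebra (ucp_scale :: 'k \<Rightarrow> _) (UCP D) ucp_dot ucp_bul (basis empty_tree)"
    by (rule unitary_com_prelie_algebra_UCP)
  fix scale :: "'k \<Rightarrow> 'a \<Rightarrow> 'a" and A dot bul one a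
  assume alg: "unitary_com_prelie_algebra scale A dot bul one" and a: "\<forall>d\<in>D. a d \<in> A"
  interpret u: unitary_com_prelie_algebra "ucp_scale :: 'k \<Rightarrow> _" "UCP D" ucp_dot ucp_bul "basis empty_tree"
    by (rule ucp)
  obtain \<phi> :: "('d upt \<Rightarrow>\<^sub>0 'k) \<Rightarrow> 'a" where \<phi>: "\<And>x. \<phi> x \<in> A" "\<And>x y. \<phi> (x + y) = \<phi> x + \<phi> y"
    "\<And>c x. \<phi> (ucp_scale c x) = scale c (\<phi> x)" "\<And>x y. \<phi> (ucp_dot x y) = dot (\<phi> x) (\<phi> y)"
    "\<And>x y. \<phi> (ucp_bul x y) = bul (\<phi> x) (\<phi> y)" "\<phi> (basis empty_tree) = one"
    "\<And>d. d \<in> D \<Longrightarrow> \<phi> (basis (tau (0, d))) = a d"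
    using unitary_com_prelie_algebra.universal_map_exists[OF alg, of D a] a by blast
  \<comment> \<open>Morphisms are constrained on \<open>UCP D\<close> only; restricting
    \<open>\<phi>\<close> to an extensional function turns uniqueness into an equality of
    functions.\<close>
  have mor: "unitary_com_prelie_morphism ucp_scale (UCP D) ucp_dot ucp_bul (basis empty_tree) scale A dot bul one
      (restrict \<phi> (UCP D))"
    by (intro unitary_com_prelie_morphism.intro ucp alg unitary_com_prelie_morphism_axioms.intro)
      (simp_all add: \<phi> u.dot_closed u.bul_closed u.one_closed
        ucp.subspace_add[OF subspace_UCP] ucp.subspace_scale[OF subspace_UCP])
  show "\<exists>!\<phi>. \<phi> \<in> UCP D \<rightarrow>\<^sub>E A \<and>
      unitary_com_prelie_morphism ucp_scale (UCP D) ucp_dot ucp_bul (basis empty_tree) scale A dot bul one \<phi> \<and>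
      (\<forall>d\<in>D. \<phi> (basis (tau (0, d))) = a d)"
  proof (rule ex1I[of _ "restrict \<phi> (UCP D)"])
    show "restrict \<phi> (UCP D) \<in> UCP D \<rightarrow>\<^sub>E A \<and>
      unitary_com_prelie_morphism ucp_scale (UCP D) ucp_dot ucp_bul (basis empty_tree) scale A dot bul one
        (restrict \<phi> (UCP D)) \<and>
      (\<forall>d\<in>D. restrict \<phi> (UCP D) (basis (tau (0, d))) = a d)"
      using mor by (simp add: \<phi> basis_UCP tau_UPT)
  next
    fix \<psi> assume \<psi>: "\<psi> \<in> UCP D \<rightarrow>\<^sub>E A \<and>
      unitary_com_prelie_morphism ucp_scale (UCP D) ucp_dot ucp_bul (basis empty_tree) scale A dot bul one \<psi> \<and>
      (\<forall>d\<in>D. \<psi> (basis (tau (0, d))) = a d)"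
    show "\<psi> = restrict \<phi> (UCP D)"
    proof (rule extensionalityI[of _ "UCP D"])
      show "\<psi> \<in> extensional (UCP D)" using \<psi> by (simp add: PiE_def)
      show "\<psi> x = restrict \<phi> (UCP D) x" if "x \<in> UCP D" for x
      proof (rule ucp_morphism_unique[OF _ mor _ that])
        show "\<psi> (basis (tau (0, d))) = restrict \<phi> (UCP D) (basis (tau (0, d)))" if "d \<in> D" for d
          using that \<psi> by (simp add: \<phi> basis_UCP tau_UPT)
      qed (use \<psi> in blast)
    qed simp
  qed
qed


end
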